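(* Let $F$ be a $G$-function with rational Taylor coefficients such that $F(z)\notin\mathbb{Q}(z)$, let $\varepsilon>0$, let $a\in\mathbb{Z}$, $a\neq0$, and let $b\ge2$ be an integer. There exists $M$ depending only on $F,\varepsilon,a$ such that for every integer $s\ge1$ with $b^s\ge M$ and every integer $t\ge1$, $$\limsup_{n\to\infty}\frac1n\,\mathcal{N}_b\big(F(a/b^s),t,n\big)\le\frac{\varepsilon}{t}.$$
   Context: A $G$-function is a power series $F(z)=\sum_{n\ge0}a_nz^n$ with algebraic coefficients for which there is $C>0$ such that for all $n\ge1$: (i) the maximum of the moduli of the conjugates of $a_n$ is at most $C^n$; (ii) there is a sequence of nonzero rational integers $d_n$ with $|d_n|\le C^n$ such that $d_na_m$ is an algebraic integer for all $m\le n$; (iii) $F$ satisfies a nonzero homogeneous linear differential equation with coefficients in $\overline{\mathbb{Q}}(z)$. For integers $b\ge2$, $t\ge1$ and an irrational real $\xi$, write the base-$b$ expansion of the fractional part of $\xi$ as $0.a_1a_2a_3\ldots$. For $n\ge1$, $\mathcal{N}_b(\xi,t,n)$ is the largest integer $\ell$ such that the word $(a_na_{n+1}\cdots a_{n+t-1})^\ell$ (the block of length $t$ starting at $a_n$ repeated $\ell$ times) is a prefix of the infinite word $a_na_{n+1}a_{n+2}\ldots$. (Part of the conclusion is that $F(a/b^s)$ is irrational, so this is well defined.) *)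

theory Defs
  imports "HOL-Analysis.Analysis" "HOL-Computational_Algebra.Computational_Algebra"
begin

text \<open>G-function with rational Taylor coefficients a :: nat => rat.
  For rational numbers the conjugates of a n reduce to a n itself, and a rational
  algebraic integer is a rational integer.  The linear differential equation with
  coefficients in algebraic rational functions is written after clearing
  denominators: polynomials P 0, ..., P m with algebraic complex coefficients,
  not all zero, with sum_k P_k * F^(k) = 0 as formal power series.\<close>
definition rat_G_function :: "(nat \<Rightarrow> rat) \<Rightarrow> bool" where
  "rat_G_function a \<longleftrightarrow>
     (\<exists>C::real. C > 0 \<and>
        (\<forall>n\<ge>1. \<bar>real_of_rat (a n)\<bar> \<le> C ^ n) \<and>
        (\<exists>d :: nat \<Rightarrow> int. \<forall>n\<ge>1. d n \<noteq> 0 \<and> real_of_int \<bar>d n\<bar> \<le> C ^ n \<and>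
             (\<forall>m\<le>n. of_int (d n) * a m \<in> \<int>)) \<and>
        (\<exists>(m::nat) (P :: nat \<Rightarrow> complex poly).
             (\<forall>k\<le>m. \<forall>i. algebraic (coeff (P k) i)) \<and> (\<exists>k\<le>m. P k \<noteq> 0) \<and>
             (\<Sum>k\<le>m. fps_of_poly (P k) * (fps_deriv ^^ k) (Abs_fps (\<lambda>n. of_rat (a n) :: complex))) = 0))"

definition rat_fps_is_rational_function :: "(nat \<Rightarrow> rat) \<Rightarrow> bool" where
  "rat_fps_is_rational_function a \<longleftrightarrow>
     (\<exists>p q :: rat poly. q \<noteq> 0 \<and> fps_of_poly q * Abs_fps a = fps_of_poly p)"

text \<open>k-th base-b digit (k \<ge> 1) of the fractional part of xi: frac xi = 0.a_1 a_2 a_3 ...\<close>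
definition digit :: "nat \<Rightarrow> real \<Rightarrow> nat \<Rightarrow> nat" where
  "digit b xi k = nat (\<lfloor>real b ^ k * frac xi\<rfloor>) mod b"

text \<open>N_b(xi,t,n): largest l such that (a_n ... a_{n+t-1})^l is a prefix of a_n a_{n+1} ...\<close>
definition Nrep :: "nat \<Rightarrow> real \<Rightarrow> nat \<Rightarrow> nat \<Rightarrow> nat" where
  "Nrep b xi t n = (GREATEST l. \<forall>i < l * t. digit b xi (n + i) = digit b xi (n + i mod t))"

end

theory Submission
  imports Defs "Jordan_Normal_Form.Determinant"
begin

text \<open>
  A long repetition of a block of length \<open>t\<close> at position \<open>n\<close> gives a rational number with denominator
  \<open>b\<^bsup>n-1\<^esup>(b\<^bsup>t\<^esup> - 1)\<close> very close to \<open>\<xi> = F(a/b\<^sup>s)\<close>, so it suffices to show, with \<open>\<beta> = b\<^sup>s\<close> and a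
  fixed integer \<open>B\<close>, that \<open>\<bar>\<xi> - z/(B\<beta>\<^sup>m)\<bar> \<ge> \<beta>\<^bsup>-(1+\<epsilon>)m\<^esup>\<close> for large \<open>m\<close>.

  Let \<open>1, F, \<dots>, F\<^bsup>(q-1)\<^esup>\<close> be a maximal family of this shape that is independent over the rational
  functions. Siegel's lemma gives an integer polynomial \<open>Q\<close> of degree \<open>L\<close>, small compared with \<open>K\<close>, with
  coefficients of size \<open>c\<^bsup>K\<^esup>\<close>, such that the coefficients of all \<open>Q F\<^bsup>(j)\<^esup>\<close> vanish from \<open>K + 1\<close> up to
  \<open>K + H\<close>, where \<open>L\<close> only slightly exceeds \<open>q H\<close>. Because \<open>Q\<close> has small degree, both \<open>Q(a/\<beta>) z/(B\<beta>\<^sup>m)\<close>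
  and the truncation \<open>P(a/\<beta>)\<close> of \<open>Q F\<close> have denominator essentially \<open>B\<beta>\<^bsup>K\<^esup>\<close> when \<open>m\<close> is close to \<open>K\<close>,
  while \<open>Q F - P\<close> at \<open>a/\<beta>\<close> is smaller than \<open>\<beta>\<^bsup>-K\<^esup>\<close> once \<open>\<beta>\<close> is large.

  That the two numbers differ is arranged by replacing \<open>Q\<close> by \<open>T\<^sup>k Q\<^bsup>(k)\<^esup>/k!\<close> for some small \<open>k\<close>. The
  corresponding truncations are the covariant derivatives of the vector of approximants, and the
  determinant of the first \<open>q + 1\<close> of them is divisible by a power of \<open>z\<close> nearly equal to its degree,
  so its order at \<open>a/\<beta>\<close> is small; that it is not zero is Shidlovskii's lemma. The denominators of the
  truncations are controlled by those of the Taylor coefficients of \<open>F\<close>, so no further property of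
  the differential equation is needed.
\<close>

section \<open>Determinants and linear systems over integral domains\<close>

text \<open>The matrix is transposed so that the products in the Leibniz formula run over the columns
  of \<open>W\<close>, which is where the degree and divisibility information will be available.\<close>

definition fdet :: "nat \<Rightarrow> (nat \<Rightarrow> nat \<Rightarrow> 'a::comm_ring_1) \<Rightarrow> 'a" where
  "fdet n W = Determinant.det (Matrix.mat n n (\<lambda>(i, k). W k i))"

lemma fdet_Leibniz:
  "fdet n W = (\<Sum>p | p permutes {0..<n}. signof p * (\<Prod>i = 0..<n. W (p i) i))"
proof -
  have "fdet n W = (\<Sum>p | p permutes {0..<n}. signof p *
          (\<Prod>i = 0..<n. Matrix.mat n n (\<lambda>(i, k). W k i) $$ (i, p i)))"
    unfolding fdet_def by (rule det_def') auto
  also have "\<dots> = (\<Sum>p | p permutes {0..<n}. signof p * (\<Prod>i = 0..<n. W (p i) i))"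
    by (intro sum.cong refl arg_cong2[where f = "(*)"] prod.cong)
       (auto dest: permutes_in_image)
  finally show ?thesis .
qed

lemma fdet_eq_0_imp_dependent:
  fixes W :: "nat \<Rightarrow> nat \<Rightarrow> 'a::idom"
  assumes "fdet n W = 0"
  shows "\<exists>c. (\<exists>k<n. c k \<noteq> 0) \<and> (\<forall>i<n. (\<Sum>k<n. c k * W k i) = 0)"
proof -
  let ?A = "Matrix.mat n n (\<lambda>(i, k). W k i)"
  obtain v where v: "v \<in> carrier_vec n" "v \<noteq> 0\<^sub>v n" "?A *\<^sub>v v = 0\<^sub>v n"
    using assms iffD1[OF det_0_iff_vec_prod_zero[of ?A n]] unfolding fdet_def by (meson mat_carrier)
  have "\<exists>k<n. vec_index v k \<noteq> 0"
  proof (rule ccontr)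
    assume "\<not> (\<exists>k<n. vec_index v k \<noteq> 0)"
    then have "v = 0\<^sub>v n" using v(1) by (intro eq_vecI) auto
    then show False using v(2) by simp
  qed
  moreover have "(\<Sum>k<n. vec_index v k * W k i) = 0" if "i < n" for i
  proof -
    have "vec_index (?A *\<^sub>v v) i = 0" using v(3) that by simp
    then show ?thesis using that v(1)
      by (simp add: scalar_prod_def atLeast0LessThan mult.commute)
  qed
  ultimately show ?thesis by blast
qed

text \<open>Zero equations are added to make the system square; every product in the Leibniz formula
  then contains a factor from the zero column \<open>m\<close>.\<close>

lemma underdetermined_system:
  fixes c :: "nat \<Rightarrow> nat \<Rightarrow> 'a::idom"
  assumes "m < n"
  shows "\<exists>x. (\<exists>j<n. x j \<noteq> 0) \<and> (\<forall>i<m. (\<Sum>j<n. c i j * x j) = 0)"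
proof -
  define W where "W = (\<lambda>k i. if i < m then c i k else 0)"
  have "signof p * (\<Prod>i = 0..<n. W (p i) i) = 0" for p
  proof -
    have "(\<Prod>i = 0..<n. W (p i) i) = 0"
      by (rule prod_zero) (use assms in \<open>auto simp: W_def intro!: bexI[of _ m]\<close>)
    then show ?thesis by simp
  qed
  then have "fdet n W = 0" unfolding fdet_Leibniz by (intro sum.neutral) auto
  from fdet_eq_0_imp_dependent[OF this] obtain x where
    x: "\<exists>k<n. x k \<noteq> 0" "\<forall>i<n. (\<Sum>k<n. x k * W k i) = 0" by blast
  have "(\<Sum>j<n. c i j * x j) = 0" if "i < m" for i
  proof -
    have "(\<Sum>j<n. c i j * x j) = (\<Sum>k<n. x k * W k i)"
      using that by (intro sum.cong) (auto simp: W_def)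
    then show ?thesis using x(2) that assms by simp
  qed
  then show ?thesis using x(1) by blast
qed

text \<open>Cramer's rule without division: \<open>g\<close> is column \<open>i\<close> of the
  adjugate. It makes the determinant the first multiplier in the evaluation argument at a
  point.\<close>

lemma fdet_Cramer:
  assumes "i < n"
  shows "\<exists>g. \<forall>j<n. (\<Sum>k<n. g k * W k j) = (if j = i then fdet n W else 0)"
proof -
  let ?A = "Matrix.mat n n (\<lambda>(i, k). W k i)"
  have A: "?A \<in> carrier_mat n n" by simp
  have "?A * adj_mat ?A = fdet n W \<cdot>\<^sub>m 1\<^sub>m n"
    unfolding fdet_def by (rule adj_mat(2)[OF A])
  then have "(?A * adj_mat ?A) $$ (j, i) = (if j = i then fdet n W else 0)" if "j < n" for j
    using that assms by simp
  moreover have "(?A * adj_mat ?A) $$ (j, i) = (\<Sum>k<n. adj_mat ?A $$ (k, i) * W k j)" if "j < n" for j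
  proof -
    have "(?A * adj_mat ?A) $$ (j, i) = (\<Sum>k<n. W k j * adj_mat ?A $$ (k, i))"
      using that assms adj_mat(1)[OF A] by (simp add: scalar_prod_def atLeast0LessThan)
    then show ?thesis by (simp add: mult.commute)
  qed
  ultimately have "\<forall>j<n. (\<Sum>k<n. adj_mat ?A $$ (k, i) * W k j) = (if j = i then fdet n W else 0)"
    by simp
  then show ?thesis by (rule exI[of _ "\<lambda>k. adj_mat ?A $$ (k, i)"])
qed

text \<open>The bound varies with the column because the column of common denominators will have far
  smaller degree than the columns of numerators.\<close>

lemma degree_fdet_le:
  fixes W :: "nat \<Rightarrow> nat \<Rightarrow> 'a::idom poly"
  assumes "\<And>k i. k < n \<Longrightarrow> i < n \<Longrightarrow> degree (W k i) \<le> D i"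
  shows "degree (fdet n W) \<le> (\<Sum>i<n. D i)"
  unfolding fdet_Leibniz
proof (rule degree_sum_le)
  show "finite {p. p permutes {0..<n}}" by (simp add: finite_permutations)
  fix p assume "p \<in> {p. p permutes {0..<n}}"
  then have p: "p i < n" if "i < n" for i using that permutes_in_image by fastforce
  have "degree (signof p * (\<Prod>i = 0..<n. W (p i) i)) = degree (\<Prod>i = 0..<n. W (p i) i)"
    by (simp add: sign_def)
  also have "\<dots> \<le> (\<Sum>i = 0..<n. degree (W (p i) i))"
    using degree_prod_sum_le[of "{0..<n}" "\<lambda>i. W (p i) i"] by (simp add: o_def)
  also have "\<dots> \<le> (\<Sum>i = 0..<n. D i)" using p by (intro sum_mono assms) auto
  finally show "degree (signof p * (\<Prod>i = 0..<n. W (p i) i)) \<le> (\<Sum>i<n. D i)"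
    by (simp add: atLeast0LessThan)
qed

lemma prod_dvd_fdet:
  assumes "\<And>k i. k < n \<Longrightarrow> i < n \<Longrightarrow> d i dvd W k i"
  shows "(\<Prod>i<n. d i) dvd fdet n W"
  unfolding fdet_Leibniz
proof (rule dvd_sum)
  fix p assume "p \<in> {p. p permutes {0..<n}}"
  then have p: "p i < n" if "i < n" for i using that permutes_in_image by fastforce
  have "(\<Prod>i<n. d i) dvd (\<Prod>i<n. W (p i) i)" using p by (intro prod_dvd_prod assms) auto
  then show "(\<Prod>i<n. d i) dvd signof p * (\<Prod>i = 0..<n. W (p i) i)"
    by (simp add: atLeast0LessThan)
qed

text \<open>The change is multiplication by a unit lower triangular matrix. With \<open>y i\<close>
  a truncated series it turns numerators into remainders of high order, up to sign and
  truncation.\<close>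

lemma fdet_column_operation:
  assumes "0 < n"
  shows "fdet n (\<lambda>k i. if i = 0 then W k 0 else W k i - W k 0 * y i) = fdet n W"
proof -
  let ?A = "Matrix.mat n n (\<lambda>(i, k). W k i)"
  let ?C = "Matrix.mat n n (\<lambda>(i, j). if i = j then 1 else if j = 0 then - y i else 0)"
  have "?C * ?A = Matrix.mat n n (\<lambda>(i, k). if i = 0 then W k 0 else W k i - W k 0 * y i)"
  proof (rule eq_matI)
    fix i k assume "i < dim_row (Matrix.mat n n (\<lambda>(i, k). if i = 0 then W k 0 else W k i - W k 0 * y i))"
      and "k < dim_col (Matrix.mat n n (\<lambda>(i, k). if i = 0 then W k 0 else W k i - W k 0 * y i))"
    then have ik: "i < n" "k < n" by auto
    have "(?C * ?A) $$ (i, k) =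
        (\<Sum>j<n. (if i = j then 1 else if j = 0 then - y i else 0) * W k j)"
      using ik by (simp add: scalar_prod_def atLeast0LessThan)
    also have "\<dots> = (\<Sum>j<n. (if j = i then W k i else 0) +
                         (if j = 0 then (if i = 0 then 0 else - y i * W k 0) else 0))"
      by (intro sum.cong) auto
    also have "\<dots> = W k i + (if i = 0 then 0 else - y i * W k 0)"
      unfolding sum.distrib using ik assms by simp
    finally show "(?C * ?A) $$ (i, k) =
        Matrix.mat n n (\<lambda>(i, k). if i = 0 then W k 0 else W k i - W k 0 * y i) $$ (i, k)"
      using ik by (simp add: mult.commute)
  qed auto
  moreover have "Determinant.det (?C * ?A) = Determinant.det ?C * Determinant.det ?A"
    by (rule det_mult[of _ n]) auto
  ultimately have "fdet n (\<lambda>k i. if i = 0 then W k 0 else W k i - W k 0 * y i) = Determinant.det ?C * fdet n W"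
    unfolding fdet_def by simp
  moreover have "Determinant.det ?C = 1"
  proof -
    have "Determinant.det ?C = prod_list (diag_mat ?C)"
      by (rule det_lower_triangular[of n]) auto
    also have "\<dots> = (\<Prod>i = 0..<n. ?C $$ (i, i))" by (simp add: prod_list_diag_prod)
    also have "\<dots> = 1" by (intro prod.neutral) auto
    finally show ?thesis .
  qed
  ultimately show ?thesis by simp
qed

section \<open>Linear differential equations in formal power series\<close>

lemma fps_nth_higher_deriv_prod:
  fixes u :: "'a::comm_ring_1 fps"
  shows "fps_nth ((fps_deriv ^^ k) u) j = (\<Prod>i<k. of_nat (j + k - i)) * fps_nth u (j + k)"
proof (induction k arbitrary: j)
  case (Suc k)
  have "(\<Prod>i<Suc k. of_nat (j + Suc k - i) :: 'a) = (\<Prod>i<k. of_nat (j + 1 + k - i)) * of_nat (j + 1)"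
    by simp
  then show ?case using Suc[of "j + 1"] by (simp add: mult_ac)
qed simp

text \<open>\<open>z^k d^k/dz^k\<close> is diagonal on monomials, with falling factorials as
  eigenvalues; for \<open>j < k\<close> one factor is zero, so the formula is uniform in
  \<open>j\<close>.\<close>

lemma fps_nth_Euler_power:
  fixes u :: "'a::comm_ring_1 fps"
  shows "fps_nth (fps_X ^ k * (fps_deriv ^^ k) u) j = (\<Prod>i<k. of_nat j - of_nat i) * fps_nth u j"
proof (cases "j < k")
  case True
  then have "(\<Prod>i<k. of_nat j - of_nat i :: 'a) = 0" by (intro prod_zero) auto
  with True show ?thesis by (simp add: fps_X_power_mult_nth)
next
  case False
  have "(\<Prod>i<k. of_nat (j - k + k - i) :: 'a) = (\<Prod>i<k. of_nat j - of_nat i)"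
    using False by (intro prod.cong) (auto simp: of_nat_diff)
  with False show ?thesis by (simp add: fps_X_power_mult_nth fps_nth_higher_deriv_prod)
qed

lemma fps_higher_deriv_lincomb:
  "(fps_deriv ^^ k) (\<Sum>i\<in>S. fps_const (c i) * u i) = (\<Sum>i\<in>S. fps_const (c i) * (fps_deriv ^^ k) (u i))"
  by (induction k) (auto simp: fps_deriv_sum)

lemma fps_mult_nth_lowest:
  fixes f g :: "'a::comm_ring_1 fps"
  assumes "\<And>i. i < m \<Longrightarrow> fps_nth f i = 0" and "\<And>j. j < e \<Longrightarrow> fps_nth g j = 0"
  shows "fps_nth (f * g) (m + e) = fps_nth f m * fps_nth g e"
proof -
  have "fps_nth (f * g) (m + e) = (\<Sum>i\<in>{0..m + e}. fps_nth f i * fps_nth g (m + e - i))"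
    by (simp add: fps_mult_nth)
  also have "\<dots> = (\<Sum>i\<in>{m}. fps_nth f i * fps_nth g (m + e - i))"
  proof (rule sum.mono_neutral_right)
    show "\<forall>i\<in>{0..m + e} - {m}. fps_nth f i * fps_nth g (m + e - i) = 0"
    proof
      fix i assume i: "i \<in> {0..m + e} - {m}"
      show "fps_nth f i * fps_nth g (m + e - i) = 0"
      proof (cases "i < m")
        case False
        then have "m + e - i < e" using i by auto
        then show ?thesis using assms(2) by simp
      qed (simp add: assms(1))
    qed
  qed auto
  finally show ?thesis by simp
qed

text \<open>The orders of vanishing of the solutions are roots of the indicial polynomial, which has
  degree at most \<open>n - 1\<close>.\<close>

lemma ode_solutions_dependent:
  fixes \<alpha> u :: "nat \<Rightarrow> 'a::field_char_0 fps"
  assumes "\<exists>k<n. \<alpha> k \<noteq> 0"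
    and ode: "\<And>i. i < n \<Longrightarrow> (\<Sum>k<n. \<alpha> k * (fps_deriv ^^ k) (u i)) = 0"
  shows "\<exists>c. (\<exists>i<n. c i \<noteq> 0) \<and> (\<Sum>i<n. fps_const (c i) * u i) = 0"
proof -
  define S where "S = {k. k < n \<and> \<alpha> k \<noteq> 0}"
  have S: "finite S" "S \<noteq> {}" using assms(1) by (auto simp: S_def)
  \<comment> \<open>After multiplication by \<open>z^n\<close> the equation is a combination of
    Euler operators with coefficients \<open>A k\<close>; \<open>\<mu>\<close> is the least order
    among the nonzero \<open>A k\<close>.\<close>
  define \<mu> where "\<mu> = Min ((\<lambda>k. subdegree (\<alpha> k) + (n - k)) ` S)"
  have \<mu>_le: "\<mu> \<le> subdegree (\<alpha> k) + (n - k)" if "k \<in> S" for k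
    unfolding \<mu>_def using S that by (intro Min_le) auto
  have "\<mu> \<in> (\<lambda>k. subdegree (\<alpha> k) + (n - k)) ` S"
    unfolding \<mu>_def using S by (intro Min_in) auto
  then obtain k1 where k1: "k1 \<in> S" "\<mu> = subdegree (\<alpha> k1) + (n - k1)" by auto
  define A where "A k = fps_X ^ (n - k) * \<alpha> k" for k
  define a where "a k = fps_nth (A k) \<mu>" for k
  have A_low: "fps_nth (A k) j = 0" if "j < \<mu>" "k < n" for j k
  proof (cases "\<alpha> k = 0")
    case False
    then have "j < subdegree (\<alpha> k) + (n - k)" using \<mu>_le[of k] that by (auto simp: S_def)
    then show ?thesis by (auto simp: A_def fps_X_power_mult_nth intro!: nth_less_subdegree_zero)
  qed (simp add: A_def)
  have "a k1 \<noteq> 0" using k1 by (auto simp: a_def A_def fps_X_power_mult_nth S_def)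
  define p where "p k = (\<Prod>i<k. [:- of_nat i, 1 :: 'a:])" for k
  have deg_p: "degree (p k) = k" and lead_p: "coeff (p k) k = 1" for k
  proof -
    show "degree (p k) = k" unfolding p_def by (subst degree_prod_eq_sum_degree) auto
    moreover have "lead_coeff (p k) = 1" unfolding p_def by (simp add: lead_coeff_prod)
    ultimately show "coeff (p k) k = 1" by simp
  qed
  have poly_p: "poly (p k) x = (\<Prod>i<k. x - of_nat i)" for k x
    unfolding p_def poly_prod by (intro prod.cong) auto
  \<comment> \<open>The indicial polynomial: on a series of order \<open>e\<close>, the operator
    produces at \<open>\<mu> + e\<close> the lowest coefficient times the value of \<open>q\<close>
    at \<open>e\<close>.\<close>
  define q where "q = (\<Sum>k<n. Polynomial.smult (a k) (p k))"
  have "degree q \<le> n - 1"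
    unfolding q_def
    by (intro degree_sum_le) (auto simp: deg_p)
  have "q \<noteq> 0"
  proof -
    \<comment> \<open>The \<open>p k\<close> have distinct degrees, so the largest index with
      \<open>a k \<noteq> 0\<close> supplies the leading coefficient.\<close>
    define k0 where "k0 = Max {k. k < n \<and> a k \<noteq> 0}"
    have k1': "k1 \<in> {k. k < n \<and> a k \<noteq> 0}" using \<open>a k1 \<noteq> 0\<close> k1 by (simp add: S_def)
    have "k0 \<in> {k. k < n \<and> a k \<noteq> 0}" unfolding k0_def by (rule Max_in) (use k1' in auto)
    then have k0: "k0 < n" "a k0 \<noteq> 0" by auto
    have gt: "a k = 0" if "k0 < k" "k < n" for k
    proof (rule ccontr)
      assume "a k \<noteq> 0"
      then have "k \<le> k0" unfolding k0_def using that by (intro Max_ge) auto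
      then show False using that by simp
    qed
    have "coeff q k0 = (\<Sum>k<n. a k * coeff (p k) k0)" by (simp add: q_def coeff_sum)
    also have "\<dots> = (\<Sum>k\<in>{k0}. a k * coeff (p k) k0)"
    proof (rule sum.mono_neutral_right)
      show "\<forall>k\<in>{..<n} - {k0}. a k * coeff (p k) k0 = 0"
      proof
        fix k assume k: "k \<in> {..<n} - {k0}"
        then consider "k < k0" | "k0 < k" "k < n" by fastforce
        then show "a k * coeff (p k) k0 = 0"
          by cases (auto simp: gt deg_p coeff_eq_0)
      qed
    qed (use k0 in auto)
    finally have "coeff q k0 = a k0" by (simp add: lead_p)
    then show ?thesis using k0 by auto
  qed
  define E where "E = {e::nat. poly q (of_nat e) = 0}"
  have inj: "inj_on (of_nat :: nat \<Rightarrow> 'a) E" by (simp add: inj_on_def)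
  have sub: "of_nat ` E \<subseteq> {x. poly q x = 0}" by (auto simp: E_def)
  have fin: "finite {x. poly q x = 0}" using \<open>q \<noteq> 0\<close> by (rule poly_roots_finite)
  have "finite E" using finite_imageD[OF finite_subset[OF sub fin] inj] .
  have "card E = card (of_nat ` E :: 'a set)" by (rule card_image[OF inj, symmetric])
  also have "\<dots> \<le> card {x. poly q x = 0}" by (rule card_mono[OF fin sub])
  also have "\<dots> \<le> degree q" using \<open>q \<noteq> 0\<close> by (rule card_poly_roots_bound)
  finally have "card E < n" using \<open>degree q \<le> n - 1\<close> k1 by (auto simp: S_def)
  obtain h where h: "bij_betw h {0..<card E} E" using ex_bij_betw_nat_finite[OF \<open>finite E\<close>] by blast
  \<comment> \<open>Fewer than \<open>n\<close> exponents can be orders of solutions, so some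
    nontrivial constant combination has zero coefficients at all of them. Having no admissible
    order, it must be zero.\<close>
  obtain x where x: "\<exists>j<n. x j \<noteq> 0"
    "\<forall>i<card E. (\<Sum>j<n. fps_nth (u j) (h i) * x j) = 0"
    using underdetermined_system[OF \<open>card E < n\<close>, of "\<lambda>i j. fps_nth (u j) (h i)"] by blast
  define v where "v = (\<Sum>j<n. fps_const (x j) * u j)"
  have v_E: "fps_nth v e = 0" if e: "e \<in> E" for e
  proof -
    obtain i where "i < card E" "h i = e" using h e unfolding bij_betw_def by (metis atLeastLessThan_iff imageE)
    then show ?thesis using x(2) by (auto simp: v_def fps_sum_nth mult.commute)
  qed
  have "(\<Sum>k<n. \<alpha> k * (fps_deriv ^^ k) v) = (\<Sum>k<n. \<Sum>j<n. fps_const (x j) * (\<alpha> k * (fps_deriv ^^ k) (u j)))"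
    unfolding v_def fps_higher_deriv_lincomb by (simp add: sum_distrib_left mult_ac)
  also have "\<dots> = (\<Sum>j<n. fps_const (x j) * (\<Sum>k<n. \<alpha> k * (fps_deriv ^^ k) (u j)))"
    by (subst sum.swap) (simp add: sum_distrib_left)
  also have "\<dots> = 0" by (simp add: ode)
  finally have ode_v: "(\<Sum>k<n. \<alpha> k * (fps_deriv ^^ k) v) = 0" .
  have "v = 0"
  proof (rule ccontr)
    assume "v \<noteq> 0"
    define e where "e = subdegree v"
    have ve: "fps_nth v e \<noteq> 0" using \<open>v \<noteq> 0\<close> by (simp add: e_def)
    have "0 = fps_nth (fps_X ^ n * (\<Sum>k<n. \<alpha> k * (fps_deriv ^^ k) v)) (\<mu> + e)"
      by (simp add: ode_v)
    also have "fps_X ^ n * (\<Sum>k<n. \<alpha> k * (fps_deriv ^^ k) v) =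
        (\<Sum>k<n. A k * (fps_X ^ k * (fps_deriv ^^ k) v))"
      unfolding sum_distrib_left
    proof (rule sum.cong)
      fix k assume "k \<in> {..<n}"
      then have "(fps_X :: 'a fps) ^ n = fps_X ^ (n - k) * fps_X ^ k"
        by (simp flip: power_add)
      then show "fps_X ^ n * (\<alpha> k * (fps_deriv ^^ k) v) = A k * (fps_X ^ k * (fps_deriv ^^ k) v)"
        by (simp add: A_def mult_ac)
    qed simp
    also have "fps_nth \<dots> (\<mu> + e) = (\<Sum>k<n. a k * ((\<Prod>i<k. of_nat e - of_nat i) * fps_nth v e))"
      unfolding fps_sum_nth
    proof (rule sum.cong)
      fix k assume k: "k \<in> {..<n}"
      have "fps_nth v j = 0" if "j < e" for j
        using that unfolding e_def by (rule nth_less_subdegree_zero)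
      then have "fps_nth (A k * (fps_X ^ k * (fps_deriv ^^ k) v)) (\<mu> + e) =
          fps_nth (A k) \<mu> * fps_nth (fps_X ^ k * (fps_deriv ^^ k) v) e"
        using k by (intro fps_mult_nth_lowest) (simp_all add: A_low fps_nth_Euler_power)
      then show "fps_nth (A k * (fps_X ^ k * (fps_deriv ^^ k) v)) (\<mu> + e) =
          a k * ((\<Prod>i<k. of_nat e - of_nat i) * fps_nth v e)"
        by (simp add: fps_nth_Euler_power a_def)
    qed simp
    also have "\<dots> = poly q (of_nat e) * fps_nth v e"
      by (simp add: q_def poly_sum poly_p sum_distrib_right mult.assoc)
    finally have "e \<in> E" using ve by (simp add: E_def)
    then show False using v_E ve by blast
  qed
  then show ?thesis using x(1) by (intro exI[of _ x] conjI) (simp_all add: v_def)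
qed

section \<open>Power series solutions of linear systems\<close>

fun linear_system_coeff ::
    "nat \<Rightarrow> (nat \<Rightarrow> nat \<Rightarrow> 'a::field_char_0 fps) \<Rightarrow> (nat \<Rightarrow> 'a) \<Rightarrow> nat \<Rightarrow> nat \<Rightarrow> 'a" where
  "linear_system_coeff n B z0 0 = z0"
| "linear_system_coeff n B z0 (Suc m) =
     (\<lambda>j. (\<Sum>i<n. \<Sum>l\<le>m. linear_system_coeff n B z0 l i * fps_nth (B i j) (m - l)) / of_nat (Suc m))"

text \<open>Comparing coefficients of \<open>z^m\<close> in \<open>Z' = Z B\<close> expresses
  coefficient \<open>m + 1\<close> through the earlier ones; characteristic zero allows the division
  by \<open>m + 1\<close>.\<close>

lemma linear_system_solution:
  fixes B :: "nat \<Rightarrow> nat \<Rightarrow> 'a::field_char_0 fps"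
  shows "\<exists>Z. (\<forall>j. fps_nth (Z j) 0 = z0 j) \<and> (\<forall>j. fps_deriv (Z j) = (\<Sum>i<n. Z i * B i j))"
proof (intro exI conjI allI)
  fix j
  let ?Z = "\<lambda>j. Abs_fps (\<lambda>m. linear_system_coeff n B z0 m j)"
  show "fps_nth (?Z j) 0 = z0 j" by simp
  show "fps_deriv (?Z j) = (\<Sum>i<n. ?Z i * B i j)"
  proof (rule fps_ext)
    fix m
    show "fps_nth (fps_deriv (?Z j)) m = fps_nth (\<Sum>i<n. ?Z i * B i j) m"
      by (simp add: fps_sum_nth fps_mult_nth atLeast0AtMost del: of_nat_Suc)
  qed
qed

section \<open>Independence over the polynomials\<close>

definition poly_independent :: "nat \<Rightarrow> (nat \<Rightarrow> 'a::field fps) \<Rightarrow> bool" where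
  "poly_independent n b \<longleftrightarrow>
     (\<forall>c. (\<Sum>p<n. fps_of_poly (c p) * b p) = 0 \<longrightarrow> (\<forall>p<n. c p = 0))"

lemma poly_independentD:
  "poly_independent n b \<Longrightarrow> (\<Sum>p<n. fps_of_poly (c p) * b p) = 0 \<Longrightarrow> p < n \<Longrightarrow> c p = 0"
  unfolding poly_independent_def by blast

text \<open>A maximal independent subfamily is built one series at a time: a new series joins unless
  a nonzero polynomial multiple of it is already spanned. The single denominator
  \<open>\<delta>\<close> serves all of \<open>S\<close>.\<close>

lemma poly_independent_spanning:
  fixes S :: "'a::field fps set"
  assumes "finite S"
  shows "\<exists>P b \<delta> \<rho>. poly_independent P b \<and> \<delta> \<noteq> 0 \<and>
           (\<forall>z\<in>S. fps_of_poly \<delta> * z = (\<Sum>p<P. fps_of_poly (\<rho> z p) * b p))"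
  using assms
proof (induction S rule: finite_induct)
  case empty
  have "poly_independent 0 (\<lambda>_. 0 :: 'a fps)" by (simp add: poly_independent_def)
  then show ?case by (intro exI[of _ "0::nat"] exI[of _ "\<lambda>_. 0"] exI[of _ 1]) auto
next
  case (insert s S)
  then obtain P b \<delta> \<rho> where IH: "poly_independent P b" "\<delta> \<noteq> 0"
    "\<And>z. z \<in> S \<Longrightarrow> fps_of_poly \<delta> * z = (\<Sum>p<P. fps_of_poly (\<rho> z p) * b p)" by blast
  show ?case
  proof (cases "\<exists>c \<sigma>. \<sigma> \<noteq> 0 \<and> fps_of_poly \<sigma> * s = (\<Sum>p<P. fps_of_poly (c p) * b p)")
    case True
    then obtain c \<sigma> where c: "\<sigma> \<noteq> 0" "fps_of_poly \<sigma> * s = (\<Sum>p<P. fps_of_poly (c p) * b p)" by blast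
    define \<rho>' where "\<rho>' z p = (if z = s then \<delta> * c p else \<sigma> * \<rho> z p)" for z p
    have span: "fps_of_poly (\<sigma> * \<delta>) * z = (\<Sum>p<P. fps_of_poly (\<rho>' z p) * b p)" if "z \<in> insert s S" for z
    proof (cases "z = s")
      case True
      have "fps_of_poly (\<sigma> * \<delta>) * s = fps_of_poly \<delta> * (fps_of_poly \<sigma> * s)"
        by (simp add: fps_of_poly_mult mult_ac)
      also have "\<dots> = (\<Sum>p<P. fps_of_poly (\<rho>' s p) * b p)"
        unfolding c(2) by (simp add: \<rho>'_def sum_distrib_left fps_of_poly_mult mult_ac)
      finally show ?thesis using True by simp
    next
      case False
      then have "fps_of_poly (\<sigma> * \<delta>) * z = fps_of_poly \<sigma> * (\<Sum>p<P. fps_of_poly (\<rho> z p) * b p)"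
        using that IH(3)[of z] by (simp add: fps_of_poly_mult mult_ac)
      then show ?thesis using False
        by (simp add: \<rho>'_def sum_distrib_left fps_of_poly_mult mult_ac)
    qed
    have "\<sigma> * \<delta> \<noteq> 0" using c IH by simp
    show ?thesis
      by (rule exI[of _ P], rule exI[of _ b], rule exI[of _ "\<sigma> * \<delta>"], rule exI[of _ \<rho>'],
          intro conjI ballI) (fact IH(1), fact, rule span)
  next
    case False
    define b' where "b' = b(P := s)"
    have indep: "poly_independent (Suc P) b'"
      unfolding poly_independent_def
    proof (intro allI impI)
      fix c p assume c: "(\<Sum>p<Suc P. fps_of_poly (c p) * b' p) = 0" and p: "p < Suc P"
      have eq: "(\<Sum>p<P. fps_of_poly (c p) * b p) + fps_of_poly (c P) * s = 0"
        using c by (simp add: b'_def)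
      have cP: "c P = 0"
      proof (rule ccontr)
        assume "c P \<noteq> 0"
        have "fps_of_poly (c P) * s = - (\<Sum>p<P. fps_of_poly (c p) * b p)"
          using eq by (simp add: eq_neg_iff_add_eq_0 add.commute)
        also have "\<dots> = (\<Sum>p<P. fps_of_poly (- c p) * b p)"
          by (simp add: sum_negf fps_of_poly_uminus)
        finally have "\<exists>c \<sigma>. \<sigma> \<noteq> 0 \<and> fps_of_poly \<sigma> * s = (\<Sum>p<P. fps_of_poly (c p) * b p)"
          using \<open>c P \<noteq> 0\<close> by (intro exI[of _ "\<lambda>p. - c p"] exI[of _ "c P"] conjI)
        then show False using False by contradiction
      qed
      with eq have "(\<Sum>p<P. fps_of_poly (c p) * b p) = 0" by simp
      then have "c p = 0" if "p < P" by (rule poly_independentD[OF IH(1)]) (rule that)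
      then show "c p = 0" using cP p by (cases "p = P") auto
    qed
    define \<rho>' where "\<rho>' z p = (if z = s then if p = P then \<delta> else 0
          else if p = P then 0 else \<rho> z p)" for z p
    have span: "fps_of_poly \<delta> * z = (\<Sum>p<Suc P. fps_of_poly (\<rho>' z p) * b' p)" if "z \<in> insert s S" for z
    proof (cases "z = s")
      case True
      then show ?thesis by (simp add: \<rho>'_def b'_def)
    next
      case False
      then have "fps_of_poly \<delta> * z = (\<Sum>p<P. fps_of_poly (\<rho> z p) * b p)"
        using that IH(3)[of z] by blast
      also have "\<dots> = (\<Sum>p<Suc P. fps_of_poly (\<rho>' z p) * b' p)"
        using False by (simp add: \<rho>'_def b'_def)
      finally show ?thesis .
    qed
    show ?thesis
      by (rule exI[of _ "Suc P"], rule exI[of _ b'], rule exI[of _ \<delta>], rule exI[of _ \<rho>'],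
          intro conjI ballI) (fact indep, fact IH(2), rule span)
  qed
qed

text \<open>If linear combinations of arbitrarily high order existed, they could be normalised at one
  index; by induction their differences would vanish eventually, so they would stabilise.\<close>

lemma independent_order_bounded:
  fixes u :: "'i \<Rightarrow> 'a::field fps"
  assumes "finite S"
    and "\<And>c. (\<Sum>i\<in>S. fps_const (c i) * u i) = 0 \<Longrightarrow> \<forall>i\<in>S. c i = 0"
  shows "\<exists>N. \<forall>c. (\<forall>m<N. fps_nth (\<Sum>i\<in>S. fps_const (c i) * u i) m = 0) \<longrightarrow> (\<forall>i\<in>S. c i = 0)"
  using assms
proof (induction S rule: finite_induct)
  case (insert s S)
  define L where "L c = (\<Sum>i\<in>S. fps_const (c i) * u i)" for c
  have L_ins: "(\<Sum>i\<in>insert s S. fps_const (c i) * u i) = fps_const (c s) * u s + L c" for c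
    using insert.hyps by (simp add: L_def)
  have indep: "c s = 0 \<and> (\<forall>i\<in>S. c i = 0)" if "fps_const (c s) * u s + L c = 0" for c
    using insert.prems[of c] that unfolding L_ins by blast
  have "\<forall>i\<in>S. c i = 0" if "L c = 0" for c
  proof -
    have "L (c(s := 0)) = L c" unfolding L_def using insert.hyps by (intro sum.cong) auto
    then have "\<forall>i\<in>S. (c(s := 0)) i = 0" using indep[of "c(s := 0)"] that by auto
    then show ?thesis using insert.hyps by (metis fun_upd_other)
  qed
  then obtain N where N: "\<And>c. (\<forall>m<N. fps_nth (L c) m = 0) \<Longrightarrow> \<forall>i\<in>S. c i = 0"
    using insert.IH unfolding L_def by blast
  have L_nth: "fps_nth (L c) m = (\<Sum>i\<in>S. c i * fps_nth (u i) m)" for c m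
    by (simp add: L_def fps_sum_nth)
  show ?case
  proof (cases "\<exists>c. c s = 1 \<and> (\<forall>m<N. fps_nth (u s + L c) m = 0)")
    case False
    show ?thesis
    proof (intro exI[of _ N] allI impI)
      fix c assume c: "\<forall>m<N. fps_nth (\<Sum>i\<in>insert s S. fps_const (c i) * u i) m = 0"
      have cs: "c s = 0"
      proof (rule ccontr)
        assume "c s \<noteq> 0"
        define d where "d i = c i / c s" for i
        have "fps_nth (u s + L d) m = fps_nth (\<Sum>i\<in>insert s S. fps_const (c i) * u i) m / c s" for m
          unfolding L_ins using \<open>c s \<noteq> 0\<close>
          by (simp add: L_nth d_def sum_divide_distrib add_divide_distrib)
        then have "d s = 1 \<and> (\<forall>m<N. fps_nth (u s + L d) m = 0)"
          using c \<open>c s \<noteq> 0\<close> by (simp add: d_def)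
        then show False using False by blast
      qed
      then show "\<forall>i\<in>insert s S. c i = 0" using c N[of c] unfolding L_ins by simp
    qed
  next
    case True
    then obtain c0 where c0: "c0 s = 1" "\<forall>m<N. fps_nth (u s + L c0) m = 0" by blast
    have "u s + L c0 \<noteq> 0" using indep[of c0] c0(1) by auto
    then obtain m0 where m0: "fps_nth (u s + L c0) m0 \<noteq> 0" by (auto simp: fps_eq_iff)
    show ?thesis
    proof (intro exI[of _ "max N (Suc m0)"] allI impI)
      fix c assume c: "\<forall>m<max N (Suc m0). fps_nth (\<Sum>i\<in>insert s S. fps_const (c i) * u i) m = 0"
      \<comment> \<open>Subtracting \<open>c s\<close> times the normalised combination
        \<open>c0\<close> removes \<open>u s\<close>, so the choice of \<open>N\<close> makes the
        rest vanish; the nonzero coefficient at \<open>m0\<close> then gives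
        \<open>c s = 0\<close>.\<close>
      define d where "d i = c i - c s * c0 i" for i
      have Ld: "fps_nth (L d) m = fps_nth (\<Sum>i\<in>insert s S. fps_const (c i) * u i) m
          - c s * fps_nth (u s + L c0) m" for m
        unfolding L_ins
        by (simp add: L_nth d_def sum_subtractf left_diff_distrib sum_distrib_left algebra_simps)
      have d0: "\<forall>i\<in>S. d i = 0" by (rule N) (use c c0 in \<open>simp add: Ld\<close>)
      then have "fps_nth (L d) m0 = 0" by (simp add: L_nth)
      then have cs: "c s = 0" using Ld[of m0] c m0 by simp
      then show "\<forall>i\<in>insert s S. c i = 0" using d0 by (simp add: d_def)
    qed
  qed
qed simp

section \<open>Shidlovskii's lemma\<close>

text \<open>\<open>cov_deriv n T A v k = T\<^sup>k \<nabla>\<^sup>k v\<close> for the connection \<open>\<nabla> = d/dz - A/T\<close>, whose horizontal vectors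
  are the solutions of \<open>T y' = A y\<close>.\<close>

primrec cov_deriv ::
    "nat \<Rightarrow> 'a::idom poly \<Rightarrow> (nat \<Rightarrow> nat \<Rightarrow> 'a poly) \<Rightarrow> (nat \<Rightarrow> 'a poly) \<Rightarrow> nat \<Rightarrow> nat \<Rightarrow> 'a poly" where
  "cov_deriv n T A v 0 = v"
| "cov_deriv n T A v (Suc k) = (\<lambda>i. T * pderiv (cov_deriv n T A v k i)
     - of_nat k * pderiv T * cov_deriv n T A v k i - (\<Sum>j<n. A i j * cov_deriv n T A v k j))"

text \<open>The last term, which comes from differentiating \<open>T^k\<close>, is the origin of the
  summand with \<open>of_nat k * pderiv T\<close> in \<open>cov_deriv\<close>.\<close>

lemma fps_mult_deriv_power:
  fixes T g :: "'a::comm_ring_1 fps"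
  shows "T * fps_deriv (T ^ k * g) = T ^ Suc k * fps_deriv g + of_nat k * fps_deriv T * (T ^ k * g)"
proof -
  have "T * fps_deriv (T ^ k) = of_nat k * fps_deriv T * T ^ k"
    by (induction k) (simp_all add: algebra_simps)
  then have "T * (fps_deriv (T ^ k) * g) = of_nat k * fps_deriv T * (T ^ k * g)"
    by (metis mult.assoc)
  then show ?thesis by (simp add: distrib_left mult.assoc)
qed

lemma fps_of_poly_of_nat: "fps_of_poly (of_nat k :: 'a::comm_ring_1 poly) = of_nat k"
  by (simp add: of_nat_poly fps_of_poly_const fps_of_nat)

text \<open>As \<open>Z\<close> solves the dual system, the derivative of the pairing of
  \<open>Z\<close> with \<open>v\<close> is the pairing of \<open>Z\<close> with
  \<open>\<nabla>v\<close>. Iterating turns scalar derivatives into covariant ones, with powers of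
  \<open>T\<close> clearing denominators.\<close>

lemma fps_deriv_power_times_dual_pairing:
  fixes T :: "'a::field_char_0 poly" and Z :: "nat \<Rightarrow> 'a fps"
  assumes Z: "\<And>j. j < n \<Longrightarrow> fps_of_poly T * fps_deriv (Z j) = - (\<Sum>i<n. Z i * fps_of_poly (A i j))"
  shows "fps_of_poly T ^ k * (fps_deriv ^^ k) (\<Sum>j<n. Z j * fps_of_poly (v j)) =
           (\<Sum>j<n. Z j * fps_of_poly (cov_deriv n T A v k j))"
proof (induction k)
  case (Suc k)
  let ?T = "fps_of_poly T" and ?u = "\<Sum>j<n. Z j * fps_of_poly (v j)"
  define W where "W j = cov_deriv n T A v k j" for j
  define w where "w j = fps_of_poly (W j)" for j
  define S where "S = (\<Sum>j<n. Z j * w j)"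
  have IH: "?T ^ k * (fps_deriv ^^ k) ?u = S" using Suc by (simp add: S_def w_def W_def)
  have "(\<Sum>j<n. (?T * fps_deriv (Z j)) * w j) = (\<Sum>j<n. - (\<Sum>i<n. Z i * fps_of_poly (A i j)) * w j)"
    by (intro sum.cong) (simp_all add: Z)
  also have "\<dots> = - (\<Sum>j<n. \<Sum>i<n. Z i * (fps_of_poly (A i j) * w j))"
    by (simp add: sum_distrib_right sum_negf mult.assoc)
  also have "\<dots> = - (\<Sum>i<n. Z i * (\<Sum>j<n. fps_of_poly (A i j) * w j))"
    by (subst sum.swap) (simp add: sum_distrib_left)
  finally have swap: "(\<Sum>j<n. (?T * fps_deriv (Z j)) * w j) =
      - (\<Sum>i<n. Z i * (\<Sum>j<n. fps_of_poly (A i j) * w j))" .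
  have "?T ^ Suc k * (fps_deriv ^^ Suc k) ?u =
      ?T * fps_deriv (?T ^ k * (fps_deriv ^^ k) ?u) - of_nat k * fps_deriv ?T * (?T ^ k * (fps_deriv ^^ k) ?u)"
    unfolding fps_mult_deriv_power by simp
  also have "\<dots> = ?T * fps_deriv S - of_nat k * fps_deriv ?T * S" by (simp add: IH)
  also have "?T * fps_deriv S = (\<Sum>j<n. (?T * fps_deriv (Z j)) * w j) + (\<Sum>j<n. Z j * (?T * fps_deriv (w j)))"
    unfolding S_def fps_deriv_sum fps_deriv_mult sum_distrib_left sum.distrib[symmetric]
    by (intro sum.cong) (simp_all add: algebra_simps)
  also have "\<dots> - of_nat k * fps_deriv ?T * S = (\<Sum>j<n. Z j * (?T * fps_deriv (w j)
      - of_nat k * fps_deriv ?T * w j - (\<Sum>i<n. fps_of_poly (A j i) * w i)))"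
    unfolding swap S_def
    by (simp add: sum_subtractf sum_distrib_left right_diff_distrib mult.left_commute mult.assoc)
  also have "\<dots> = (\<Sum>j<n. Z j * fps_of_poly (cov_deriv n T A v (Suc k) j))"
    by (simp add: w_def W_def fps_of_poly_diff fps_of_poly_mult fps_of_poly_pderiv fps_of_poly_sum
        fps_of_poly_of_nat)
  finally show ?case .
qed simp

text \<open>Shidlovskii's argument. Let \<open>Z\<^sub>r\<close> be a basis of solutions of the dual system. If the
  \<open>T\<^sup>k \<nabla>\<^sup>k v\<close> are dependent, the functions \<open>Z\<^sub>r \<cdot> v\<close> satisfy a common equation of order less than
  \<open>n\<close>, so some constant combination of them vanishes. Expanding the \<open>Z\<^sub>r\<close>, which do not depend on
  \<open>v\<close>, in a maximal family that is independent over the polynomials turns this into a polynomial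
  relation for \<open>v\<close> of bounded degree.\<close>

lemma bounded_annihilator_at_ordinary_point:
  fixes T :: "'a::field_char_0 poly"
  assumes T0: "coeff T 0 \<noteq> 0"
  shows "\<exists>D. \<forall>v. (\<exists>\<alpha>. (\<exists>k<n. \<alpha> k \<noteq> 0) \<and> (\<forall>i<n. (\<Sum>k<n. \<alpha> k * cov_deriv n T A v k i) = 0)) \<longrightarrow>
           (\<exists>l. (\<exists>i<n. l i \<noteq> 0) \<and> (\<forall>i<n. degree (l i) \<le> D) \<and> (\<Sum>i<n. l i * v i) = 0)"
proof -
  let ?T = "fps_of_poly T"
  \<comment> \<open>The matrix of the dual system, with entries \<open>- A i j / T\<close>, consists
    of power series because \<open>T\<close> is a unit at 0.\<close>
  define B where "B i j = - fps_of_poly (A i j) * inverse ?T" for i j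
  have Tinv: "?T * inverse ?T = 1" using T0 by (metis fps_of_poly_nth inverse_mult_eq_1')
  have "T \<noteq> 0" using T0 by auto
  \<comment> \<open>The initial values form the identity matrix, so a constant combination of the
    \<open>Z r\<close> can be read off at 0.\<close>
  have "\<forall>r. \<exists>Z. (\<forall>j. fps_nth (Z j) 0 = (if j = r then 1 else 0 :: 'a)) \<and>
      (\<forall>j. fps_deriv (Z j) = (\<Sum>i<n. Z i * B i j))"
    by (intro allI linear_system_solution)
  from choice[OF this] obtain Z where Z0: "\<And>r j. fps_nth (Z r j) 0 = (if j = r then 1 else 0 :: 'a)"
    and Z': "\<And>r j. fps_deriv (Z r j) = (\<Sum>i<n. Z r i * B i j)" by blast
  have Z: "?T * fps_deriv (Z r j) = - (\<Sum>i<n. Z r i * fps_of_poly (A i j))" for r j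
  proof -
    have "?T * fps_deriv (Z r j) = (\<Sum>i<n. - (Z r i * fps_of_poly (A i j)) * (?T * inverse ?T))"
      unfolding Z' B_def sum_distrib_left by (intro sum.cong) (simp_all add: mult_ac)
    then show ?thesis by (simp add: Tinv sum_negf)
  qed
  have "finite ((\<lambda>(r, j). Z r j) ` ({..<n} \<times> {..<n}))" by simp
  from poly_independent_spanning[OF this] obtain P b \<delta> \<rho> where b: "poly_independent P b" "\<delta> \<noteq> 0"
    and "\<forall>z\<in>(\<lambda>(r, j). Z r j) ` ({..<n} \<times> {..<n}).
           fps_of_poly \<delta> * z = (\<Sum>p<P. fps_of_poly (\<rho> z p) * b p)" by (elim exE conjE)
  then have \<rho>: "fps_of_poly \<delta> * Z r j = (\<Sum>p<P. fps_of_poly (\<rho> (Z r j) p) * b p)"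
    if "r < n" "j < n" for r j using that by auto
  \<comment> \<open>\<open>D\<close> comes from the expansions of the dual solutions alone, so it is
    fixed before \<open>v\<close>.\<close>
  define D where "D = (\<Sum>r<n. \<Sum>j<n. \<Sum>p<P. degree (\<rho> (Z r j) p))"
  have D: "degree (\<rho> (Z r j) p) \<le> D" if "r < n" "j < n" "p < P" for r j p
  proof -
    have "degree (\<rho> (Z r j) p) \<le> (\<Sum>p<P. degree (\<rho> (Z r j) p))"
      using that by (intro member_le_sum) auto
    also have "\<dots> \<le> (\<Sum>j<n. \<Sum>p<P. degree (\<rho> (Z r j) p))"
      using that by (intro member_le_sum[of j "{..<n}" "\<lambda>j. \<Sum>p<P. degree (\<rho> (Z r j) p)"]) auto
    also have "\<dots> \<le> D" unfolding D_def
      using that by (intro member_le_sum[of r "{..<n}" "\<lambda>r. \<Sum>j<n. \<Sum>p<P. degree (\<rho> (Z r j) p)"]) auto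
    finally show ?thesis .
  qed
  show ?thesis
  proof (intro exI[of _ D] allI impI)
    fix v assume "\<exists>\<alpha>. (\<exists>k<n. \<alpha> k \<noteq> 0) \<and> (\<forall>i<n. (\<Sum>k<n. \<alpha> k * cov_deriv n T A v k i) = 0)"
    then obtain \<alpha> where \<alpha>: "\<exists>k<n. \<alpha> k \<noteq> 0"
      and rel: "\<And>i. i < n \<Longrightarrow> (\<Sum>k<n. \<alpha> k * cov_deriv n T A v k i) = 0" by blast
    define u where "u r = (\<Sum>j<n. Z r j * fps_of_poly (v j))" for r
    have ode: "(\<Sum>k<n. (fps_of_poly (\<alpha> k) * ?T ^ k) * (fps_deriv ^^ k) (u r)) = 0" for r
    proof -
      have "(\<Sum>k<n. (fps_of_poly (\<alpha> k) * ?T ^ k) * (fps_deriv ^^ k) (u r)) =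
          (\<Sum>k<n. fps_of_poly (\<alpha> k) * (\<Sum>j<n. Z r j * fps_of_poly (cov_deriv n T A v k j)))"
        by (simp add: mult.assoc u_def fps_deriv_power_times_dual_pairing[OF Z])
      also have "\<dots> = (\<Sum>k<n. \<Sum>j<n. Z r j * fps_of_poly (\<alpha> k * cov_deriv n T A v k j))"
        by (simp add: sum_distrib_left fps_of_poly_mult mult_ac)
      also have "\<dots> = (\<Sum>j<n. Z r j * fps_of_poly (\<Sum>k<n. \<alpha> k * cov_deriv n T A v k j))"
        by (subst sum.swap) (simp add: sum_distrib_left fps_of_poly_sum)
      also have "\<dots> = 0" by (simp add: rel)
      finally show ?thesis .
    qed
    have "\<exists>k<n. fps_of_poly (\<alpha> k) * ?T ^ k \<noteq> 0" using \<alpha> \<open>T \<noteq> 0\<close> by simp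
    from ode_solutions_dependent[where u = u, OF this ode] obtain c where c: "\<exists>r<n. c r \<noteq> 0"
      and cu: "(\<Sum>r<n. fps_const (c r) * u r) = 0" by blast
    define l where "l p j = (\<Sum>r<n. Polynomial.smult (c r) (\<rho> (Z r j) p))" for p j
    have l: "fps_of_poly \<delta> * (\<Sum>r<n. fps_const (c r) * Z r j) = (\<Sum>p<P. fps_of_poly (l p j) * b p)"
      if "j < n" for j
    proof -
      have "fps_of_poly \<delta> * (\<Sum>r<n. fps_const (c r) * Z r j) =
          (\<Sum>r<n. fps_const (c r) * (fps_of_poly \<delta> * Z r j))"
        by (simp add: sum_distrib_left mult_ac)
      also have "\<dots> = (\<Sum>r<n. \<Sum>p<P. fps_const (c r) * (fps_of_poly (\<rho> (Z r j) p) * b p))"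
        using that by (simp add: \<rho> sum_distrib_left)
      also have "\<dots> = (\<Sum>p<P. fps_of_poly (l p j) * b p)"
        by (subst sum.swap)
           (simp add: l_def fps_of_poly_sum fps_of_poly_smult sum_distrib_right mult.assoc)
      finally show ?thesis .
    qed
    have "(\<Sum>p<P. fps_of_poly (\<Sum>j<n. l p j * v j) * b p) =
        (\<Sum>j<n. fps_of_poly (v j) * (\<Sum>p<P. fps_of_poly (l p j) * b p))"
    proof -
      have "(\<Sum>p<P. fps_of_poly (\<Sum>j<n. l p j * v j) * b p) =
          (\<Sum>p<P. \<Sum>j<n. fps_of_poly (v j) * (fps_of_poly (l p j) * b p))"
        by (simp add: sum_distrib_left sum_distrib_right fps_of_poly_sum fps_of_poly_mult mult_ac)
      then show ?thesis by (subst (asm) sum.swap) (simp add: sum_distrib_left)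
    qed
    also have "\<dots> = (\<Sum>j<n. fps_of_poly (v j) * (fps_of_poly \<delta> * (\<Sum>r<n. fps_const (c r) * Z r j)))"
      by (simp add: l)
    also have "\<dots> = (\<Sum>j<n. \<Sum>r<n. fps_of_poly \<delta> * (fps_const (c r) * (Z r j * fps_of_poly (v j))))"
      by (simp add: sum_distrib_left mult_ac)
    also have "\<dots> = fps_of_poly \<delta> * (\<Sum>r<n. fps_const (c r) * u r)"
      by (subst sum.swap) (simp add: u_def sum_distrib_left)
    finally have "(\<Sum>p<P. fps_of_poly (\<Sum>j<n. l p j * v j) * b p) = 0" by (simp add: cu)
    \<comment> \<open>Comparing coefficients of the independent \<open>b p\<close> splits the
      vanishing of the pairing into one polynomial relation for each \<open>p\<close>.\<close>
    then have ann: "(\<Sum>j<n. l p j * v j) = 0" if "p < P" for p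
      by (rule poly_independentD[OF b(1), of "\<lambda>p. \<Sum>j<n. l p j * v j"]) (rule that)
    \<comment> \<open>If every relation were trivial, the combination of the \<open>Z r\<close>
      would vanish, and its value at 0 would give \<open>c = 0\<close>.\<close>
    have "\<exists>p<P. \<exists>j<n. l p j \<noteq> 0"
    proof (rule ccontr)
      assume "\<not> (\<exists>p<P. \<exists>j<n. l p j \<noteq> 0)"
      then have "(\<Sum>r<n. fps_const (c r) * Z r j) = 0" if "j < n" for j
        using l[OF that] that b(2) by simp
      then have "fps_nth (\<Sum>r<n. fps_const (c r) * Z r j) 0 = 0" if "j < n" for j
        using that by simp
      then have "c j = 0" if "j < n" for j using that
        by (simp add: fps_sum_nth Z0 if_distrib cong: if_cong)
      then show False using c by blast
    qed
    then obtain p where p: "p < P" "\<exists>j<n. l p j \<noteq> 0" by blast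
    have "degree (l p j) \<le> D" if "j < n" for j
      unfolding l_def
    proof (rule degree_sum_le)
      fix r assume "r \<in> {..<n}"
      then show "degree (Polynomial.smult (c r) (\<rho> (Z r j) p)) \<le> D"
        using order.trans[OF degree_smult_le D] that p(1) by blast
    qed simp
    then show "\<exists>l. (\<exists>i<n. l i \<noteq> 0) \<and> (\<forall>i<n. degree (l i) \<le> D) \<and> (\<Sum>i<n. l i * v i) = 0"
      using p ann[OF p(1)] by (intro exI[of _ "l p"] conjI) simp_all
  qed
qed

lemma cov_deriv_pcompose_shift:
  fixes T :: "'a::field_char_0 poly"
  shows "cov_deriv n (pcompose T [:z, 1:]) (\<lambda>i j. pcompose (A i j) [:z, 1:]) (\<lambda>i. pcompose (v i) [:z, 1:]) k i =
           pcompose (cov_deriv n T A v k i) [:z, 1:]"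
  by (induction k arbitrary: i)
     (simp_all add: pcompose_diff pcompose_mult pcompose_sum pderiv_pcompose pderiv_pCons of_nat_poly
        pcompose_smult)

text \<open>A translation moves a point with \<open>T \<noteq> 0\<close> to the origin. It commutes
  with \<open>cov_deriv\<close> and preserves degrees, so the bound from an ordinary point carries
  back unchanged.\<close>

lemma bounded_annihilator:
  fixes T :: "'a::field_char_0 poly"
  assumes "T \<noteq> 0"
  shows "\<exists>D. \<forall>v. (\<exists>\<alpha>. (\<exists>k<n. \<alpha> k \<noteq> 0) \<and> (\<forall>i<n. (\<Sum>k<n. \<alpha> k * cov_deriv n T A v k i) = 0)) \<longrightarrow>
           (\<exists>l. (\<exists>i<n. l i \<noteq> 0) \<and> (\<forall>i<n. degree (l i) \<le> D) \<and> (\<Sum>i<n. l i * v i) = 0)"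
proof -
  have "finite {z. poly T z = 0}" by (rule poly_roots_finite[OF assms])
  then obtain z where z: "poly T z \<noteq> 0"
    using ex_new_if_finite[OF infinite_UNIV_char_0] by blast
  define s where "s p = pcompose p [:z, 1:]" for p
  define s' where "s' p = pcompose p [:- z, 1:]" for p
  have s's: "s (s' p) = p" for p
    unfolding s_def s'_def pcompose_assoc[symmetric] by (simp add: pcompose_pCons)
  have s0: "s p = 0 \<longleftrightarrow> p = 0" and s'0: "s' p = 0 \<longleftrightarrow> p = 0" for p
    unfolding s_def s'_def by (auto simp: pcompose_eq_0_iff)
  have s_sum: "s (sum f X) = (\<Sum>x\<in>X. s (f x))" for f and X :: "nat set"
    by (simp add: s_def pcompose_sum)
  have s_mult: "s (p * q) = s p * s q" for p q by (simp add: s_def pcompose_mult)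
  have "coeff (s T) 0 \<noteq> 0" using z by (simp add: s_def poly_pcompose flip: poly_0_coeff_0)
  from bounded_annihilator_at_ordinary_point[OF this, of n "\<lambda>i j. s (A i j)"] obtain D where
    D: "\<forall>v. (\<exists>\<alpha>. (\<exists>k<n. \<alpha> k \<noteq> 0) \<and>
              (\<forall>i<n. (\<Sum>k<n. \<alpha> k * cov_deriv n (s T) (\<lambda>i j. s (A i j)) v k i) = 0)) \<longrightarrow>
           (\<exists>l. (\<exists>i<n. l i \<noteq> 0) \<and> (\<forall>i<n. degree (l i) \<le> D) \<and> (\<Sum>i<n. l i * v i) = 0)"
    by (elim exE)
  show ?thesis
  proof (intro exI[of _ D] allI impI)
    fix v assume "\<exists>\<alpha>. (\<exists>k<n. \<alpha> k \<noteq> 0) \<and> (\<forall>i<n. (\<Sum>k<n. \<alpha> k * cov_deriv n T A v k i) = 0)"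
    then obtain \<alpha> where \<alpha>: "\<exists>k<n. \<alpha> k \<noteq> 0"
      and rel: "\<And>i. i < n \<Longrightarrow> (\<Sum>k<n. \<alpha> k * cov_deriv n T A v k i) = 0" by blast
    have "(\<Sum>k<n. s (\<alpha> k) * cov_deriv n (s T) (\<lambda>i j. s (A i j)) (\<lambda>i. s (v i)) k i) = 0" if "i < n" for i
    proof -
      have "s (\<Sum>k<n. \<alpha> k * cov_deriv n T A v k i) = 0" using rel[OF that] s0 by simp
      then show ?thesis
        unfolding s_sum s_mult by (simp add: s_def cov_deriv_pcompose_shift)
    qed
    moreover have "\<exists>k<n. s (\<alpha> k) \<noteq> 0" using \<alpha> s0 by simp
    ultimately have "\<exists>\<alpha>. (\<exists>k<n. \<alpha> k \<noteq> 0) \<and>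
        (\<forall>i<n. (\<Sum>k<n. \<alpha> k * cov_deriv n (s T) (\<lambda>i j. s (A i j)) (\<lambda>i. s (v i)) k i) = 0)"
      by (intro exI[of _ "\<lambda>k. s (\<alpha> k)"] conjI allI impI)
    from mp[OF spec[OF D] this] obtain l where l: "\<exists>i<n. l i \<noteq> 0" "\<forall>i<n. degree (l i) \<le> D"
      "(\<Sum>i<n. l i * s (v i)) = 0" by blast
    have "s (\<Sum>i<n. s' (l i) * v i) = 0" unfolding s_sum s_mult s's by (rule l(3))
    then have "(\<Sum>i<n. s' (l i) * v i) = 0" using s0 by blast
    moreover have "\<exists>i<n. s' (l i) \<noteq> 0" using l(1) s'0 by simp
    moreover have "\<forall>i<n. degree (s' (l i)) \<le> D" using l(2) by (simp add: s'_def degree_pcompose)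
    ultimately have "(\<exists>i<n. s' (l i) \<noteq> 0) \<and> (\<forall>i<n. degree (s' (l i)) \<le> D) \<and>
        (\<Sum>i<n. s' (l i) * v i) = 0" by simp
    then show "\<exists>l. (\<exists>i<n. l i \<noteq> 0) \<and> (\<forall>i<n. degree (l i) \<le> D) \<and> (\<Sum>i<n. l i * v i) = 0"
      by (rule exI[of _ "\<lambda>i. s' (l i)"])
  qed
qed

section \<open>Zero estimate\<close>

lemma fps_nth_mult_eq_0:
  fixes f g :: "'a::comm_ring_1 fps"
  assumes "\<And>j. j \<le> m \<Longrightarrow> fps_nth g j = 0"
  shows "fps_nth (f * g) m = 0"
  using assms by (simp add: fps_mult_nth)

lemma fps_of_poly_eq_sum_monoms:
  fixes p :: "'a::comm_ring_1 poly"
  assumes "degree p \<le> D"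
  shows "fps_of_poly p = (\<Sum>d\<le>D. fps_const (coeff p d) * fps_X ^ d)"
proof (rule fps_ext)
  fix m
  have "(\<Sum>d\<le>D. fps_nth (fps_const (coeff p d) * fps_X ^ d) m) = (\<Sum>d\<le>D. if d = m then coeff p m else 0)"
    by (intro sum.cong) (auto simp: fps_X_power_nth)
  also have "\<dots> = coeff p m" using assms by (auto simp: coeff_eq_0)
  finally show "fps_nth (fps_of_poly p) m = fps_nth (\<Sum>d\<le>D. fps_const (coeff p d) * fps_X ^ d) m"
    by (simp add: fps_sum_nth)
qed

text \<open>Modelled on the vector \<open>1, f, f', ...\<close>: the entry 1 and the zero row of
  \<open>A\<close> let component 0 of the covariant derivatives act as a common denominator that
  evolves by itself.\<close>

locale differential_system =
  fixes n t :: nat and T :: "'a::field_char_0 poly" and A :: "nat \<Rightarrow> nat \<Rightarrow> 'a poly"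
    and y :: "nat \<Rightarrow> 'a fps"
  assumes n_pos: "0 < n" and T_nz: "T \<noteq> 0" and y_0: "y 0 = 1"
    and A_0: "\<And>j. j < n \<Longrightarrow> A 0 j = 0"
    and system: "\<And>i. i < n \<Longrightarrow> fps_of_poly T * fps_deriv (y i) = (\<Sum>j<n. fps_of_poly (A i j) * y j)"
    and degree_T: "degree T \<le> t" and degree_A: "\<And>i j. i < n \<Longrightarrow> j < n \<Longrightarrow> degree (A i j) \<le> t"
    and y_indep: "poly_independent n y"
begin

abbreviation W :: "(nat \<Rightarrow> 'a poly) \<Rightarrow> nat \<Rightarrow> nat \<Rightarrow> 'a poly" where
  "W v \<equiv> cov_deriv n T A v"

text \<open>Remainder of the simultaneous approximation with common denominator
  \<open>W v k 0\<close> and numerators \<open>W v k i\<close>.\<close>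

definition R :: "(nat \<Rightarrow> 'a poly) \<Rightarrow> nat \<Rightarrow> nat \<Rightarrow> 'a fps" where
  "R v k i = fps_of_poly (W v k 0) * y i - fps_of_poly (W v k i)"

section \<open>Degrees of the covariant derivatives and orders of the remainders\<close>

lemma W_Suc_0: "W v (Suc k) 0 = T * pderiv (W v k 0) - of_nat k * pderiv T * W v k 0"
  using A_0 by simp

lemma W_0: "W v k 0 = T ^ k * (pderiv ^^ k) (v 0)"
proof (induction k)
  case (Suc k)
  have "T * pderiv (T ^ k) = of_nat k * pderiv T * T ^ k"
    by (induction k) (simp_all add: pderiv_mult algebra_simps)
  then have "T * (pderiv (T ^ k) * (pderiv ^^ k) (v 0)) = of_nat k * pderiv T * (T ^ k * (pderiv ^^ k) (v 0))"
    by (metis mult.assoc)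
  then show ?case unfolding W_Suc_0 Suc by (simp add: pderiv_mult algebra_simps)
qed simp

lemma degree_W_step:
  assumes "degree p \<le> d"
  shows "degree (T * pderiv p - of_nat k * pderiv T * p) \<le> d + t"
proof -
  have "degree (T * pderiv p) \<le> t + d"
    using degree_mult_le[of T "pderiv p"] degree_T degree_pderiv[of p] assms by linarith
  moreover have "degree (of_nat k * pderiv T) \<le> t"
    using degree_mult_le[of "of_nat k :: 'a poly" "pderiv T"] degree_T degree_pderiv[of T] by simp
  then have "degree (of_nat k * pderiv T * p) \<le> t + d"
    using degree_mult_le[of "of_nat k * pderiv T" p] assms by linarith
  ultimately show ?thesis by (simp add: degree_diff_le add.commute)
qed

lemma degree_W:
  assumes "\<And>i. i < n \<Longrightarrow> degree (v i) \<le> K" and "i < n"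
  shows "degree (W v k i) \<le> K + t * k"
  using assms(2)
proof (induction k arbitrary: i)
  case (Suc k)
  have "degree (T * pderiv (W v k i) - of_nat k * pderiv T * W v k i) \<le> K + t * k + t"
    by (rule degree_W_step) (rule Suc)+
  moreover have "degree (\<Sum>j<n. A i j * W v k j) \<le> K + t * k + t"
  proof (rule degree_sum_le)
    fix j assume "j \<in> {..<n}"
    then have "degree (W v k j) \<le> K + t * k" "degree (A i j) \<le> t"
      using Suc.IH degree_A Suc.prems by auto
    then show "degree (A i j * W v k j) \<le> K + t * k + t"
      using degree_mult_le[of "A i j" "W v k j"] by linarith
  qed simp
  ultimately have "degree (W v (Suc k) i) \<le> K + t * k + t"
    by (simp add: degree_diff_le)
  then show ?case by (simp add: add.commute)
qed (simp add: assms)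

text \<open>Component 0 never meets the others, so it keeps the small degree of the initial
  denominator up to \<open>t\<close> per step.\<close>

lemma degree_W_0: "degree (W v k 0) \<le> degree (v 0) + t * k"
proof (induction k)
  case (Suc k)
  show ?case using degree_W_step[OF Suc, of k] unfolding W_Suc_0 by (simp add: add.commute add.left_commute)
qed simp

text \<open>\<open>y\<close> is horizontal for the connection, so the remainder vector obeys the
  same recursion as the approximants.\<close>

lemma R_Suc:
  assumes "i < n"
  shows "R v (Suc k) i = fps_of_poly T * fps_deriv (R v k i) - of_nat k * fps_deriv (fps_of_poly T) * R v k i
           - (\<Sum>j<n. fps_of_poly (A i j) * R v k j)"
proof -
  define q where "q = fps_of_poly (W v k 0)"
  define w where "w j = fps_of_poly (W v k j)" for j
  have h1: "(\<Sum>j<n. fps_of_poly (A i j) * R v k j) =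
      q * (fps_of_poly T * fps_deriv (y i)) - (\<Sum>j<n. fps_of_poly (A i j) * w j)"
    unfolding system[OF assms]
    by (simp add: R_def q_def w_def right_diff_distrib sum_subtractf sum_distrib_left mult_ac)
  have h2: "fps_of_poly (W v (Suc k) 0) = fps_of_poly T * fps_deriv q - of_nat k * fps_deriv (fps_of_poly T) * q"
    unfolding W_Suc_0 q_def
    by (simp add: fps_of_poly_diff fps_of_poly_mult fps_of_poly_pderiv fps_of_poly_of_nat)
  have h3: "fps_of_poly (W v (Suc k) i) = fps_of_poly T * fps_deriv (w i)
      - of_nat k * fps_deriv (fps_of_poly T) * w i - (\<Sum>j<n. fps_of_poly (A i j) * w j)"
    by (simp add: w_def fps_of_poly_diff fps_of_poly_mult fps_of_poly_pderiv fps_of_poly_sum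
        fps_of_poly_of_nat)
  have h4: "R v k i = q * y i - w i" by (simp add: R_def q_def w_def)
  show ?thesis
    unfolding R_def[of v "Suc k"] h1 h2 h3 unfolding h4 by (simp add: algebra_simps)
qed

text \<open>Only the derivative in the recursion lowers the order of vanishing, and by at most one
  per step.\<close>

lemma R_nth_eq_0:
  assumes "\<And>i m. i < n \<Longrightarrow> m < N \<Longrightarrow> fps_nth (R v 0 i) m = 0" and "i < n" and "m + k < N"
  shows "fps_nth (R v k i) m = 0"
  using assms(2,3)
proof (induction k arbitrary: i m)
  case (Suc k)
  have "fps_nth (fps_of_poly T * fps_deriv (R v k i)) m = 0"
    by (rule fps_nth_mult_eq_0) (use Suc in simp)
  moreover have "fps_nth (of_nat k * fps_deriv (fps_of_poly T) * R v k i) m = 0"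
    by (rule fps_nth_mult_eq_0) (use Suc in simp)
  moreover have "fps_nth (fps_of_poly (A i j) * R v k j) m = 0" if "j < n" for j
    by (rule fps_nth_mult_eq_0) (use Suc that in simp)
  ultimately show ?case unfolding R_Suc[OF Suc.prems(1)] by (simp add: fps_sum_nth)
qed (simp add: assms(1))

text \<open>The determinant has degree at most \<open>L + (n - 1) K + t n^2\<close> and, after a
  column operation, is seen to be divisible by \<open>z^((n - 1)(N - n))\<close>. The remaining
  degree bounds the order at any \<open>x \<noteq> 0\<close>.\<close>

lemma order_fdet_W_le:
  assumes R0: "\<And>i m. i < n \<Longrightarrow> m < N \<Longrightarrow> fps_nth (R v 0 i) m = 0"
    and deg_v: "degree (v 0) \<le> L" "\<And>i. i < n \<Longrightarrow> degree (v i) \<le> K"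
    and w_nz: "fdet n (W v) \<noteq> 0" and x: "x \<noteq> 0"
  shows "order x (fdet n (W v)) + (n - 1) * (N - n) \<le> L + (n - 1) * K + t * n * n"
proof -
  define w where "w = fdet n (W v)"
  have "degree w \<le> (\<Sum>i<n. (if i = 0 then L else K) + t * n)"
    unfolding w_def
  proof (rule degree_fdet_le)
    fix k i assume ki: "k < n" "i < n"
    then have tk: "t * k \<le> t * n" by simp
    moreover have "degree (W v k 0) \<le> L + t * k" using degree_W_0[of v k] deg_v(1) by linarith
    moreover have "degree (W v k i) \<le> K + t * k" using degree_W deg_v(2) ki(2) by blast
    ultimately have "degree (W v k 0) \<le> L + t * n" "degree (W v k i) \<le> K + t * n"
      by linarith+
    then show "degree (W v k i) \<le> (if i = 0 then L else K) + t * n" by (cases "i = 0") simp_all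
  qed
  also have "\<dots> = L + (n - 1) * K + t * n * n"
  proof -
    obtain n' where n': "n = Suc n'" using n_pos gr0_implies_Suc by blast
    have "(\<Sum>i<n. (if i = 0 then L else K)) = L + n' * K"
      unfolding n' sum.lessThan_Suc_shift by simp
    then show ?thesis by (simp add: sum.distrib n')
  qed
  finally have deg_w: "degree w \<le> L + (n - 1) * K + t * n * n" .
  \<comment> \<open>Truncation keeps the column operation inside the polynomials and leaves all
    coefficients below \<open>N\<close> intact.\<close>
  define yy where "yy i = truncate_fps N (y i)" for i
  \<comment> \<open>Fewer than \<open>n\<close> derivatives are taken, so every remainder still
    vanishes to order \<open>N - n\<close>.\<close>
  have "(\<Prod>i<n. monom 1 (if i = 0 then 0 else N - n) :: 'a poly) dvd
      fdet n (\<lambda>k i. if i = 0 then W v k 0 else W v k i - W v k 0 * yy i)"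
  proof (rule prod_dvd_fdet)
    fix k i assume ki: "k < n" "i < n"
    have "coeff (W v k i - W v k 0 * yy i) m = 0" if "m < N - n" for m
    proof -
      have "fps_of_poly (W v k i - W v k 0 * yy i) =
          - R v k i + fps_of_poly (W v k 0) * (y i - fps_of_poly (yy i))"
        by (simp add: R_def fps_of_poly_diff fps_of_poly_mult algebra_simps)
      moreover have "fps_nth (R v k i) m = 0" using R_nth_eq_0[OF R0] ki that by simp
      moreover have "fps_nth (fps_of_poly (W v k 0) * (y i - fps_of_poly (yy i))) m = 0"
        by (rule fps_nth_mult_eq_0) (use that in \<open>simp add: yy_def\<close>)
      ultimately have "fps_nth (fps_of_poly (W v k i - W v k 0 * yy i)) m = 0" by simp
      then show ?thesis by simp
    qed
    then show "monom 1 (if i = 0 then 0 else N - n) dvd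
        (if i = 0 then W v k 0 else W v k i - W v k 0 * yy i)"
      by (auto simp: monom_1_dvd_iff')
  qed
  moreover have "(\<Prod>i<n. monom 1 (if i = 0 then 0 else N - n) :: 'a poly) = monom 1 ((n - 1) * (N - n))"
  proof -
    obtain n' where n': "n = Suc n'" using n_pos gr0_implies_Suc by blast
    show ?thesis unfolding n' prod.lessThan_Suc_shift by (simp add: monom_power mult.commute)
  qed
  ultimately have "monom 1 ((n - 1) * (N - n)) dvd w"
    unfolding w_def fdet_column_operation[OF n_pos] by simp
  then obtain E where E: "w = monom 1 ((n - 1) * (N - n)) * E" by blast
  have "E \<noteq> 0" using w_nz E w_def by auto
  have "order x w = order x (monom 1 ((n - 1) * (N - n))) + order x E"
    using w_nz E w_def by (metis order_mult)
  also have "order x (monom 1 ((n - 1) * (N - n)) :: 'a poly) = 0"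
    using x by (intro order_0I) (simp add: poly_monom)
  finally have "order x w \<le> degree E" using order_degree[OF \<open>E \<noteq> 0\<close>] by simp
  moreover have "degree w = (n - 1) * (N - n) + degree E"
    unfolding E using \<open>E \<noteq> 0\<close> by (simp add: degree_mult_eq degree_monom_eq)
  ultimately show ?thesis using deg_w unfolding w_def[symmetric] by linarith
qed

text \<open>Passing from a multiplier \<open>g\<close> to \<open>T g'\<close> costs one more covariant derivative and lowers the order
  at a regular point by one.\<close>

definition multiplier :: "(nat \<Rightarrow> 'a poly) \<Rightarrow> nat \<Rightarrow> 'a poly \<Rightarrow> bool" where
  "multiplier v k g \<longleftrightarrow>
     (\<forall>i<n. \<exists>c. \<forall>j<n. (\<Sum>l\<le>k. c l * W v l j) = (if j = i then g else 0))"

text \<open>Apply \<open>T d/dz\<close> to the relation for unit vector \<open>i\<close> and replace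
  \<open>T W_l'\<close> by \<open>W_(l+1) + l T' W_l + A W_l\<close>. The part with \<open>A\<close>
  is \<open>g\<close> times column \<open>i\<close> of \<open>A\<close>, itself a combination of the
  relations for all unit vectors; hence the sum of \<open>A m i * c m l\<close> in
  \<open>d\<close>.\<close>

lemma multiplier_deriv:
  assumes "multiplier v k g"
  shows "multiplier v (Suc k) (T * pderiv g)"
  unfolding multiplier_def
proof (intro allI impI)
  fix i assume "i < n"
  have "\<forall>i. \<exists>c. i < n \<longrightarrow> (\<forall>j<n. (\<Sum>l\<le>k. c l * W v l j) = (if j = i then g else 0))"
    using assms unfolding multiplier_def by blast
  from choice[OF this] obtain c where
    c: "\<And>i j. i < n \<Longrightarrow> j < n \<Longrightarrow> (\<Sum>l\<le>k. c i l * W v l j) = (if j = i then g else 0)" by blast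
  define d where "d l = (if l \<le> k then T * pderiv (c i l) + of_nat l * pderiv T * c i l
      + (\<Sum>m<n. A m i * c m l) else 0) + (if l = 0 then 0 else c i (l - 1))" for l
  have "(\<Sum>l\<le>Suc k. d l * W v l j) = (if j = i then T * pderiv g else 0)" if j: "j < n" for j
  proof -
    have pd: "T * pderiv (\<Sum>l\<le>k. c i l * W v l j) = (if j = i then T * pderiv g else 0)"
      using c[OF \<open>i < n\<close> j] by simp
    have "(\<Sum>l\<le>k. (\<Sum>m<n. A m i * c m l) * W v l j) = (\<Sum>l\<le>k. \<Sum>m<n. A m i * (c m l * W v l j))"
      by (simp add: sum_distrib_right mult.assoc)
    also have "\<dots> = (\<Sum>m<n. A m i * (\<Sum>l\<le>k. c m l * W v l j))"
      by (subst sum.swap) (simp add: sum_distrib_left)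
    also have "\<dots> = (\<Sum>m<n. if m = j then A j i * g else 0)"
      by (intro sum.cong) (auto simp: c j)
    also have "\<dots> = A j i * g" using j by simp
    finally have s1: "(\<Sum>l\<le>k. (\<Sum>m<n. A m i * c m l) * W v l j) = A j i * g" .
    have "(\<Sum>l\<le>k. c i l * (\<Sum>m<n. A j m * W v l m)) = (\<Sum>l\<le>k. \<Sum>m<n. A j m * (c i l * W v l m))"
      by (simp add: sum_distrib_left mult.left_commute)
    also have "\<dots> = (\<Sum>m<n. A j m * (\<Sum>l\<le>k. c i l * W v l m))"
      by (subst sum.swap) (simp add: sum_distrib_left)
    also have "\<dots> = (\<Sum>m<n. if m = i then A j i * g else 0)"
      by (intro sum.cong) (auto simp: c \<open>i < n\<close>)
    also have "\<dots> = A j i * g" using \<open>i < n\<close> by simp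
    finally have s2: "(\<Sum>l\<le>k. c i l * (\<Sum>m<n. A j m * W v l m)) = A j i * g" .
    have "(\<Sum>l\<le>Suc k. d l * W v l j) =
        (\<Sum>l\<le>Suc k. (if l \<le> k then T * pderiv (c i l) + of_nat l * pderiv T * c i l
           + (\<Sum>m<n. A m i * c m l) else 0) * W v l j)
        + (\<Sum>l\<le>Suc k. (if l = 0 then 0 else c i (l - 1)) * W v l j)"
      unfolding d_def distrib_right sum.distrib ..
    also have "(\<Sum>l\<le>Suc k. (if l = 0 then 0 else c i (l - 1)) * W v l j) = (\<Sum>l\<le>k. c i l * W v (Suc l) j)"
      by (subst sum.atMost_Suc_shift) simp
    also have "(\<Sum>l\<le>Suc k. (if l \<le> k then T * pderiv (c i l) + of_nat l * pderiv T * c i l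
           + (\<Sum>m<n. A m i * c m l) else 0) * W v l j) =
        (\<Sum>l\<le>k. (T * pderiv (c i l) + of_nat l * pderiv T * c i l) * W v l j) + A j i * g"
      by (simp add: distrib_right sum.distrib s1)
    also have "(\<Sum>l\<le>k. c i l * W v (Suc l) j) =
        (\<Sum>l\<le>k. c i l * (T * pderiv (W v l j) - of_nat l * pderiv T * W v l j)) - A j i * g"
      by (simp add: right_diff_distrib sum_subtractf s2)
    also have "(\<Sum>l\<le>k. (T * pderiv (c i l) + of_nat l * pderiv T * c i l) * W v l j) + A j i * g
        + ((\<Sum>l\<le>k. c i l * (T * pderiv (W v l j) - of_nat l * pderiv T * W v l j)) - A j i * g)
        = (\<Sum>l\<le>k. (T * pderiv (c i l) + of_nat l * pderiv T * c i l) * W v l j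
            + c i l * (T * pderiv (W v l j) - of_nat l * pderiv T * W v l j))"
      by (simp add: sum.distrib)
    also have "\<dots> = (\<Sum>l\<le>k. T * pderiv (c i l * W v l j))"
      by (intro sum.cong) (simp_all add: pderiv_mult algebra_simps)
    also have "\<dots> = T * pderiv (\<Sum>l\<le>k. c i l * W v l j)"
      by (simp add: higher_pderiv_sum[of 1, simplified] sum_distrib_left)
    finally show ?thesis using pd by simp
  qed
  then show "\<exists>c. \<forall>j<n. (\<Sum>l\<le>Suc k. c l * W v l j) = (if j = i then T * pderiv g else 0)"
    by (intro exI[of _ d]) blast
qed

lemma multiplier_eventually_nonzero:
  assumes "multiplier v k g" and "g \<noteq> 0" and "poly T x \<noteq> 0"
  shows "\<exists>g'. multiplier v (k + order x g) g' \<and> poly g' x \<noteq> 0"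
  using assms(1,2)
proof (induction "order x g" arbitrary: g k)
  case 0
  then have "poly g x \<noteq> 0" by (simp add: order_root)
  then show ?case using 0 by auto
next
  case (Suc r)
  then have root: "poly g x = 0" by (metis order_root nat.distinct(1))
  have "pderiv g \<noteq> 0"
  proof
    assume "pderiv g = 0"
    then obtain c where "g = [:c:]" using pderiv_iszero by blast
    then show False using root Suc.prems by simp
  qed
  have "order x (pderiv g) = r"
    using order_pderiv[OF \<open>g \<noteq> 0\<close>, of x] Suc.hyps root by (simp add: order_root)
  moreover have "order x T = 0" using assms(3) by (rule order_0I)
  moreover have Tg: "T * pderiv g \<noteq> 0" using T_nz \<open>pderiv g \<noteq> 0\<close> by simp
  ultimately have ord: "order x (T * pderiv g) = r" by (simp add: order_mult)
  from Suc.hyps(1)[OF ord[symmetric] multiplier_deriv[OF Suc.prems(1)] Tg] ord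
  show ?case using Suc.hyps(2) by (metis add_Suc add_Suc_right)
qed

text \<open>Starting from the determinant, a multiplier that is nonzero at \<open>x\<close> is
  reached after \<open>order x\<close> further derivatives. A form annihilating all vectors in this
  range at \<open>x\<close> would annihilate every unit vector and so be trivial.\<close>

lemma nonvanishing_form:
  assumes w: "fdet n (W v) \<noteq> 0" and x: "poly T x \<noteq> 0" and lam: "\<exists>i<n. lam i \<noteq> 0"
  shows "\<exists>k \<le> n - 1 + order x (fdet n (W v)). (\<Sum>i<n. lam i * poly (W v k i) x) \<noteq> 0"
proof (rule ccontr)
  assume "\<not> ?thesis"
  then have van: "(\<Sum>i<n. lam i * poly (W v k i) x) = 0" if "k \<le> n - 1 + order x (fdet n (W v))" for k
    using that by blast
  have "multiplier v (n - 1) (fdet n (W v))"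
    unfolding multiplier_def
  proof (intro allI impI)
    fix i assume "i < n"
    have "{..n - 1} = {..<n}" using n_pos by auto
    then show "\<exists>c. \<forall>j<n. (\<Sum>l\<le>n - 1. c l * W v l j) = (if j = i then fdet n (W v) else 0)"
      using fdet_Cramer[OF \<open>i < n\<close>, of "W v"] by simp
  qed
  from multiplier_eventually_nonzero[OF this w x] obtain g where
    g: "multiplier v (n - 1 + order x (fdet n (W v))) g" "poly g x \<noteq> 0" by blast
  obtain i where i: "i < n" "lam i \<noteq> 0" using lam by blast
  define k where "k = n - 1 + order x (fdet n (W v))"
  obtain c where c: "\<And>j. j < n \<Longrightarrow> (\<Sum>l\<le>k. c l * W v l j) = (if j = i then g else 0)"
    using g(1) i(1) unfolding multiplier_def k_def by blast
  have "lam i * poly g x = (\<Sum>j<n. if j = i then lam i * poly g x else 0)" using i by simp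
  also have "\<dots> = (\<Sum>j<n. lam j * poly (\<Sum>l\<le>k. c l * W v l j) x)"
    by (intro sum.cong) (auto simp: c)
  also have "\<dots> = (\<Sum>j<n. \<Sum>l\<le>k. poly (c l) x * (lam j * poly (W v l j) x))"
    by (simp add: poly_sum sum_distrib_left mult_ac)
  also have "\<dots> = (\<Sum>l\<le>k. poly (c l) x * (\<Sum>j<n. lam j * poly (W v l j) x))"
    by (subst sum.swap) (simp add: sum_distrib_left)
  also have "\<dots> = 0" using van by (simp add: k_def)
  finally show False using i g(2) by simp
qed

text \<open>Forms of degree at most \<open>D\<close> are constant combinations of the finitely many
  series \<open>z^d y_i\<close>, which are independent over the constants because \<open>y\<close>
  is independent over the polynomials.\<close>

lemma order_of_linear_form_bounded:
  "\<exists>N. \<forall>l. (\<forall>i<n. degree (l i) \<le> D) \<longrightarrow> (\<exists>i<n. l i \<noteq> 0) \<longrightarrow>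
     (\<exists>m<N. fps_nth (\<Sum>i<n. fps_of_poly (l i) * y i) m \<noteq> 0)"
proof -
  define S where "S = {..<n} \<times> {..D}"
  define u where "u = (\<lambda>(i, d). fps_X ^ d * y i)"
  have form: "(\<Sum>s\<in>S. fps_const (c s) * u s) = (\<Sum>i<n. (\<Sum>d\<le>D. fps_const (c (i, d)) * fps_X ^ d) * y i)" for c
  proof -
    have "(\<Sum>s\<in>S. fps_const (c s) * u s) = (\<Sum>(i, d)\<in>S. fps_const (c (i, d)) * (fps_X ^ d * y i))"
      by (intro sum.cong) (auto simp: u_def)
    then show ?thesis
      unfolding S_def sum.cartesian_product[symmetric] by (simp add: sum_distrib_right mult.assoc)
  qed
  have "\<forall>s\<in>S. c s = 0" if "(\<Sum>s\<in>S. fps_const (c s) * u s) = 0" for c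
  proof -
    define l where "l i = (\<Sum>d\<le>D. monom (c (i, d)) d)" for i
    have "(\<Sum>i<n. fps_of_poly (l i) * y i) = 0"
      using that unfolding form l_def by (simp add: fps_of_poly_sum fps_of_poly_monom)
    then have l0: "l i = 0" if "i < n" for i
      by (rule poly_independentD[OF y_indep]) (rule that)
    have "coeff (l i) d = c (i, d)" if "d \<le> D" for i d
      using that by (simp add: l_def coeff_sum)
    then have "c (i, d) = 0" if "i < n" "d \<le> D" for i d using l0[OF that(1)] that(2) by (metis coeff_0)
    then show ?thesis by (auto simp: S_def)
  qed
  moreover have "finite S" by (simp add: S_def)
  ultimately have "\<exists>N. \<forall>c. (\<forall>m<N. fps_nth (\<Sum>s\<in>S. fps_const (c s) * u s) m = 0) \<longrightarrow> (\<forall>s\<in>S. c s = 0)"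
    by (intro independent_order_bounded)
  then obtain N where
    N: "\<And>c. (\<forall>m<N. fps_nth (\<Sum>s\<in>S. fps_const (c s) * u s) m = 0) \<Longrightarrow> (\<forall>s\<in>S. c s = 0)"
    by blast
  show ?thesis
  proof (rule exI[of _ N], intro allI impI)
    fix l :: "nat \<Rightarrow> 'a poly" assume l: "\<forall>i<n. degree (l i) \<le> D" "\<exists>i<n. l i \<noteq> 0"
    define c where "c = (\<lambda>(i, d). coeff (l i) d)"
    have eq: "(\<Sum>s\<in>S. fps_const (c s) * u s) = (\<Sum>i<n. fps_of_poly (l i) * y i)"
      unfolding form using l(1) by (intro sum.cong) (auto simp: c_def fps_of_poly_eq_sum_monoms)
    obtain i where i: "i < n" "l i \<noteq> 0" using l(2) by blast
    then have "(i, degree (l i)) \<in> S" "c (i, degree (l i)) \<noteq> 0" using l(1) by (auto simp: S_def c_def)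
    then show "\<exists>m<N. fps_nth (\<Sum>i<n. fps_of_poly (l i) * y i) m \<noteq> 0"
      using N[of c] unfolding eq by blast
  qed
qed

text \<open>If the determinant vanished, \<open>v\<close> would have an annihilator \<open>l\<close>
  of degree at most \<open>D\<close>. Then \<open>v 0\<close> times the form \<open>g\<close> with
  coefficients \<open>l\<close> in \<open>y\<close> is a combination of remainders and vanishes to
  order \<open>N\<close>, but \<open>g\<close> has order below \<open>N0\<close> and
  \<open>v 0\<close> has order at most its degree.\<close>

lemma fdet_W_nonzero:
  "\<exists>N0. \<forall>v N. v 0 \<noteq> 0 \<longrightarrow> degree (v 0) + N0 \<le> N \<longrightarrow>
     (\<forall>i<n. \<forall>m<N. fps_nth (R v 0 i) m = 0) \<longrightarrow> fdet n (W v) \<noteq> 0"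
proof -
  obtain D where D: "\<forall>v. (\<exists>\<alpha>. (\<exists>k<n. \<alpha> k \<noteq> 0) \<and> (\<forall>i<n. (\<Sum>k<n. \<alpha> k * W v k i) = 0)) \<longrightarrow>
     (\<exists>l. (\<exists>i<n. l i \<noteq> 0) \<and> (\<forall>i<n. degree (l i) \<le> D) \<and> (\<Sum>i<n. l i * v i) = 0)"
    using bounded_annihilator[OF T_nz, of n A] by (elim exE)
  obtain N0 where N0: "\<forall>l. (\<forall>i<n. degree (l i) \<le> D) \<longrightarrow> (\<exists>i<n. l i \<noteq> 0) \<longrightarrow>
     (\<exists>m<N0. fps_nth (\<Sum>i<n. fps_of_poly (l i) * y i) m \<noteq> 0)"
    using order_of_linear_form_bounded[of D] by (elim exE)
  show ?thesis
  proof (rule exI[of _ N0], intro allI impI notI)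
    fix v N assume v0: "v 0 \<noteq> 0" and N: "degree (v 0) + N0 \<le> N"
      and R0: "\<forall>i<n. \<forall>m<N. fps_nth (R v 0 i) m = 0" and "fdet n (W v) = 0"
    from mp[OF spec[OF D] fdet_eq_0_imp_dependent[OF this(4)]] obtain l where
      l: "\<exists>i<n. l i \<noteq> 0" "\<forall>i<n. degree (l i) \<le> D" "(\<Sum>i<n. l i * v i) = 0" by blast
    define g where "g = (\<Sum>i<n. fps_of_poly (l i) * y i)"
    obtain m where m: "m < N0" "fps_nth g m \<noteq> 0" using N0 l unfolding g_def by blast
    have "g \<noteq> 0" using m by auto
    have "subdegree g \<le> m" using m by (intro subdegree_leI)
    have "fps_of_poly (v 0) * g = (\<Sum>i<n. fps_of_poly (l i) * R v 0 i) + fps_of_poly (\<Sum>i<n. l i * v i)"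
      by (simp add: g_def R_def fps_of_poly_sum fps_of_poly_mult sum_distrib_left right_diff_distrib
          sum_subtractf mult_ac)
    then have eq: "fps_of_poly (v 0) * g = (\<Sum>i<n. fps_of_poly (l i) * R v 0 i)" using l(3) by simp
    have "fps_nth (fps_of_poly (v 0) * g) m = 0" if "m < N" for m
      unfolding eq fps_sum_nth using R0 that by (intro sum.neutral ballI fps_nth_mult_eq_0) auto
    then have "N \<le> subdegree (fps_of_poly (v 0) * g)"
      using v0 \<open>g \<noteq> 0\<close> by (intro subdegree_geI) auto
    also have "\<dots> = subdegree (fps_of_poly (v 0)) + subdegree g"
      using v0 \<open>g \<noteq> 0\<close> by simp
    also have "subdegree (fps_of_poly (v 0)) \<le> degree (v 0)"
      using v0 by (intro subdegree_leI) simp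
    finally show False using N \<open>subdegree g \<le> m\<close> m(1) by linarith
  qed
qed

text \<open>The constant \<open>c0\<close> is fixed before all other data; when
  \<open>(n - 1) N\<close> nearly reaches \<open>L + (n - 1) K\<close>, only few derivatives have to
  be tried.\<close>

lemma zero_estimate:
  "\<exists>c0. \<forall>v L K N x lam. v 0 \<noteq> 0 \<longrightarrow> degree (v 0) \<le> L \<longrightarrow> (\<forall>i<n. degree (v i) \<le> K) \<longrightarrow>
     (\<forall>i<n. \<forall>m<N. fps_nth (R v 0 i) m = 0) \<longrightarrow> L + c0 \<le> N \<longrightarrow> x \<noteq> 0 \<longrightarrow> poly T x \<noteq> 0 \<longrightarrow>
     (\<exists>i<n. lam i \<noteq> 0) \<longrightarrow>
     (\<exists>k. k + (n - 1) * N \<le> L + (n - 1) * K + c0 \<and> (\<Sum>i<n. lam i * poly (W v k i) x) \<noteq> 0)"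
proof -
  obtain N0 where N0: "\<forall>v N. v 0 \<noteq> 0 \<longrightarrow> degree (v 0) + N0 \<le> N \<longrightarrow>
     (\<forall>i<n. \<forall>m<N. fps_nth (R v 0 i) m = 0) \<longrightarrow> fdet n (W v) \<noteq> 0"
    using fdet_W_nonzero by (elim exE)
  \<comment> \<open>Beyond \<open>N0\<close>, the terms pay for the initial \<open>n - 1\<close>
    derivatives, the degree growth \<open>t n^2\<close> and the replacement of \<open>N - n\<close>
    by \<open>N\<close>.\<close>
  define c0 where "c0 = N0 + n + t * n * n + n * n"
  show ?thesis
  proof (rule exI[of _ c0], intro allI impI)
    fix v L K N x lam
    assume v0: "v 0 \<noteq> 0" and degs: "degree (v 0) \<le> L" "\<forall>i<n. degree (v i) \<le> K"
      and R0: "\<forall>i<n. \<forall>m<N. fps_nth (R v 0 i) m = 0" and N: "L + c0 \<le> N"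
      and x: "x \<noteq> 0" "poly T x \<noteq> 0" and lam: "\<exists>i<n. lam i \<noteq> (0::'a)"
    have "degree (v 0) + N0 \<le> N" using degs(1) N unfolding c0_def by linarith
    then have w: "fdet n (W v) \<noteq> 0" using N0 v0 R0 by blast
    obtain k where k: "k \<le> n - 1 + order x (fdet n (W v))" "(\<Sum>i<n. lam i * poly (W v k i) x) \<noteq> 0"
      using nonvanishing_form[OF w x(2) lam] by blast
    have "order x (fdet n (W v)) + (n - 1) * (N - n) \<le> L + (n - 1) * K + t * n * n"
      using order_fdet_W_le[of N v L K x] R0 degs w x by blast
    moreover have "(n - 1) * N \<le> (n - 1) * (N - n) + n * n"
    proof -
      have "(n - 1) * N \<le> (n - 1) * ((N - n) + n)" by (intro mult_le_mono) auto
      also have "\<dots> = (n - 1) * (N - n) + (n - 1) * n" by (rule distrib_left)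
      also have "(n - 1) * n \<le> n * n" by simp
      finally show ?thesis by simp
    qed
    ultimately have "k + (n - 1) * N \<le> L + (n - 1) * K + c0" using k(1) unfolding c0_def by linarith
    then show "\<exists>k. k + (n - 1) * N \<le> L + (n - 1) * K + c0 \<and> (\<Sum>i<n. lam i * poly (W v k i) x) \<noteq> 0"
      using k(2) by blast
  qed
qed

end

section \<open>The differential system attached to the series\<close>

text \<open>The field is a vector space over the rationals, and the assignment of 1 to
  \<open>c\<close> on the independent set \<open>{c}\<close> extends linearly.\<close>

lemma ex_rat_linear_functional:
  fixes c :: "'a::field_char_0"
  assumes "c \<noteq> 0"
  shows "\<exists>\<phi> :: 'a \<Rightarrow> rat. (\<forall>x y. \<phi> (x + y) = \<phi> x + \<phi> y) \<and> (\<forall>x r. \<phi> (x * of_rat r) = \<phi> x * r) \<and> \<phi> c = 1"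
proof -
  interpret vs: vector_space_pair "\<lambda>r (x::'a). of_rat r * x" "\<lambda>r (x::rat). r * x"
    by unfold_locales (auto simp: algebra_simps of_rat_add of_rat_mult)
  have "vs.vs1.independent {c}" using assms by simp
  from vs.linear_independent_extend[OF this, of "\<lambda>_. 1"] obtain \<phi> where
    \<phi>: "Vector_Spaces.linear (\<lambda>r (x::'a). of_rat r * x) (\<lambda>r (x::rat). r * x) \<phi>" "\<phi> c = 1" by auto
  have "\<phi> (x + y) = \<phi> x + \<phi> y" for x y using vs.linear_add[OF \<phi>(1)] .
  moreover have "\<phi> (x * of_rat r) = \<phi> x * r" for x r
    using vs.linear_scale[OF \<phi>(1), of r x] by (simp add: mult.commute)
  ultimately show ?thesis using \<phi>(2) by blast
qed

lemma fps_higher_deriv_of_rat_nth: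
  "fps_nth ((fps_deriv ^^ k) (Abs_fps (\<lambda>n. of_rat (a n) :: 'a::field_char_0))) j =
     of_rat (fps_nth ((fps_deriv ^^ k) (Abs_fps a)) j)"
  unfolding fps_nth_higher_deriv_prod of_rat_mult of_rat_prod of_rat_of_nat_eq by simp

text \<open>Applying a \<open>\<rat>\<close>-linear functional to all coefficients of the polynomials in a relation
  between power series with rational coefficients gives a relation over \<open>\<rat>\<close>.\<close>

lemma rational_differential_equation:
  fixes P :: "nat \<Rightarrow> 'a::field_char_0 poly" and a :: "nat \<Rightarrow> rat"
  assumes rel: "(\<Sum>k\<le>m. fps_of_poly (P k) * (fps_deriv ^^ k) (Abs_fps (\<lambda>n. of_rat (a n)))) = 0"
    and nz: "\<exists>k\<le>m. P k \<noteq> 0"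
  shows "\<exists>p :: nat \<Rightarrow> rat poly. (\<exists>k\<le>m. p k \<noteq> 0) \<and>
           (\<Sum>k\<le>m. fps_of_poly (p k) * (fps_deriv ^^ k) (Abs_fps a)) = 0"
proof -
  obtain k0 where k0: "k0 \<le> m" "P k0 \<noteq> 0" using nz by blast
  then have "lead_coeff (P k0) \<noteq> 0" by simp
  from ex_rat_linear_functional[OF this] obtain \<phi> :: "'a \<Rightarrow> rat" where
    add: "\<And>x y. \<phi> (x + y) = \<phi> x + \<phi> y" and scale: "\<And>x r. \<phi> (x * of_rat r) = \<phi> x * r"
    and one: "\<phi> (lead_coeff (P k0)) = 1" by blast
  have zero: "\<phi> 0 = 0" using add[of 0 0] by simp
  have \<phi>_sum: "\<phi> (sum g S) = (\<Sum>x\<in>S. \<phi> (g x))" if "finite S" for g and S :: "nat set"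
    using that by (induction S rule: finite_induct) (simp_all add: zero add)
  define p where "p k = map_poly \<phi> (P k)" for k
  have coeff_p: "coeff (p k) i = \<phi> (coeff (P k) i)" for k i
    by (simp add: p_def coeff_map_poly zero)
  \<comment> \<open>The functional was normalised at a leading coefficient so that this polynomial
    stays nonzero.\<close>
  have "coeff (p k0) (degree (P k0)) = 1" by (simp add: coeff_p one)
  then have "p k0 \<noteq> 0" by auto
  moreover have "(\<Sum>k\<le>m. fps_of_poly (p k) * (fps_deriv ^^ k) (Abs_fps a)) = 0"
  proof (rule fps_ext)
    fix j
    have "0 = \<phi> (fps_nth (\<Sum>k\<le>m. fps_of_poly (P k) * (fps_deriv ^^ k) (Abs_fps (\<lambda>n. of_rat (a n)))) j)"
      by (simp add: rel zero)
    also have "\<dots> = (\<Sum>k\<le>m. \<Sum>i=0..j. \<phi> (coeff (P k) i * of_rat (fps_nth ((fps_deriv ^^ k) (Abs_fps a)) (j - i))))"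
      by (simp add: fps_sum_nth fps_mult_nth fps_higher_deriv_of_rat_nth \<phi>_sum)
    also have "\<dots> = fps_nth (\<Sum>k\<le>m. fps_of_poly (p k) * (fps_deriv ^^ k) (Abs_fps a)) j"
      by (simp add: scale fps_sum_nth fps_mult_nth coeff_p)
    finally show "fps_nth (\<Sum>k\<le>m. fps_of_poly (p k) * (fps_deriv ^^ k) (Abs_fps a)) j = fps_nth 0 j"
      by simp
  qed
  ultimately show ?thesis using k0(1) by blast
qed

lemma ex_integer_multiple_poly:
  fixes p :: "rat poly"
  shows "\<exists>(d::int) q. d \<noteq> 0 \<and> Polynomial.smult (of_int d) p = map_poly of_int q"
proof (induction p)
  case 0
  have "Polynomial.smult (of_int 1) (0 :: rat poly) = map_poly of_int (0 :: int poly)" by simp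
  then show ?case by (metis zero_neq_one)
next
  case (pCons a p)
  then obtain d q where d: "d \<noteq> 0" "Polynomial.smult (of_int d) p = map_poly of_int q" by blast
  obtain r s :: int where rs: "a = of_int r / of_int s" "s \<noteq> 0"
    by (metis Fract_of_int_quotient Rat_cases less_irrefl)
  have "Polynomial.smult (of_int (d * s)) (pCons a p) =
      pCons (of_int (d * r)) (Polynomial.smult (of_int s) (Polynomial.smult (of_int d) p))"
    using rs by (simp add: mult.commute)
  also have "\<dots> = map_poly of_int (pCons (d * r) (Polynomial.smult s q))"
    unfolding d(2) by (intro poly_eqI) (auto simp: coeff_map_poly coeff_pCons split: nat.splits)
  finally show ?case using d(1) rs(2) by (metis mult_eq_0_iff)
qed

definition deriv_tuple :: "'a::comm_ring_1 fps \<Rightarrow> nat \<Rightarrow> 'a fps" where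
  "deriv_tuple f i = (if i = 0 then 1 else (fps_deriv ^^ (i - 1)) f)"

text \<open>The first dependent initial segment of \<open>1, f, f', ...\<close> expresses its
  highest derivative through the rest and gives a companion system with independent vector.
  Irrationality of \<open>f\<close> gives \<open>2 \<le> n\<close>. \<open>T\<close> is made
  integral because its powers later enter integer polynomials.\<close>

lemma ex_differential_system:
  fixes f :: "rat fps"
  assumes de: "(\<Sum>k\<le>m. fps_of_poly (p k) * (fps_deriv ^^ k) f) = 0" "\<exists>k\<le>m. p k \<noteq> 0"
    and irr: "\<And>r s. s \<noteq> 0 \<Longrightarrow> fps_of_poly s * f \<noteq> fps_of_poly r"
  shows "\<exists>n t Tz A. 2 \<le> n \<and> differential_system n t (map_poly of_int (Tz :: int poly)) A (deriv_tuple f)"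
proof -
  let ?Y = "deriv_tuple f"
  have "\<not> poly_independent (m + 2) ?Y"
  proof
    assume ind: "poly_independent (m + 2) ?Y"
    \<comment> \<open>Index 0 belongs to the constant 1, which is absent from the homogeneous
      equation.\<close>
    define c where "c i = (if i = 0 then 0 else p (i - 1))" for i
    have "(\<Sum>i<m + 2. fps_of_poly (c i) * ?Y i) = (\<Sum>k\<le>m. fps_of_poly (p k) * (fps_deriv ^^ k) f)"
      unfolding add_2_eq_Suc' by (subst sum.lessThan_Suc_shift)
        (simp add: c_def deriv_tuple_def lessThan_Suc_atMost del: sum.lessThan_Suc)
    then have "(\<Sum>i<m + 2. fps_of_poly (c i) * ?Y i) = 0" using de by simp
    then have "c i = 0" if "i < m + 2" for i by (rule poly_independentD[OF ind]) (rule that)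
    then have "p k = 0" if "k \<le> m" for k using that by (force simp: c_def dest: spec[of _ "Suc k"])
    then show False using de(2) by blast
  qed
  define n1 where "n1 = (LEAST n. \<not> poly_independent n ?Y)"
  have n1: "\<not> poly_independent n1 ?Y"
    unfolding n1_def by (rule LeastI) (fact \<open>\<not> poly_independent (m + 2) ?Y\<close>)
  have below: "poly_independent k ?Y" if "k < n1" for k
    using that not_less_Least unfolding n1_def by blast
  have ind_le: "poly_independent 2 ?Y"
    unfolding poly_independent_def
  proof (intro allI impI)
    fix c i assume c: "(\<Sum>i<2. fps_of_poly (c i) * ?Y i) = 0" and i: "i < (2::nat)"
    have "fps_of_poly (c 0) + fps_of_poly (c 1) * f = 0"
      using c by (simp add: deriv_tuple_def numeral_2_eq_2)
    then have eq: "fps_of_poly (c 1) * f = fps_of_poly (- c 0)"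
      by (simp add: fps_of_poly_uminus eq_neg_iff_add_eq_0 add.commute)
    have c1: "c 1 = 0" using irr eq by blast
    then have "c 0 = 0" using eq by (simp add: fps_of_poly_uminus)
    then show "c i = 0" using c1 i by (cases "i = 0") (auto simp: less_2_cases_iff)
  qed
  have mono: "poly_independent k ?Y" if "poly_independent l ?Y" "k \<le> l" for k l
    unfolding poly_independent_def
  proof (intro allI impI)
    fix c i assume c: "(\<Sum>i<k. fps_of_poly (c i) * ?Y i) = 0" and i: "i < k"
    define c' where "c' i = (if i < k then c i else 0)" for i
    have "(\<Sum>i<l. fps_of_poly (c' i) * ?Y i) = (\<Sum>i<k. fps_of_poly (c' i) * ?Y i)"
      using that(2) by (intro sum.mono_neutral_right) (auto simp: c'_def)
    also have "\<dots> = 0" using c by (simp add: c'_def)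
    finally have "c' i = 0" by (rule poly_independentD[OF that(1)]) (use i that in simp)
    then show "c i = 0" using i by (simp add: c'_def)
  qed
  have "2 < n1" using mono[OF ind_le] n1 by (meson not_le_imp_less)
  define n where "n = n1 - 1"
  have n: "2 \<le> n" "n1 = Suc n" using \<open>2 < n1\<close> by (auto simp: n_def)
  have ind: "poly_independent n ?Y" using below n by simp
  obtain c j where c: "(\<Sum>i<Suc n. fps_of_poly (c i) * ?Y i) = 0" "j < Suc n" "c j \<noteq> 0"
    using n1 unfolding n poly_independent_def by blast
  have "c n \<noteq> 0"
  proof
    assume "c n = 0"
    then have "(\<Sum>i<n. fps_of_poly (c i) * ?Y i) = 0" using c(1) by simp
    then have "c i = 0" if "i < n" for i by (rule poly_independentD[OF ind]) (rule that)
    then show False using c \<open>c n = 0\<close> by (cases "j = n") auto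
  qed
  obtain d :: int and Tz where d: "d \<noteq> 0" "Polynomial.smult (of_int d) (c n) = map_poly of_int Tz"
    using ex_integer_multiple_poly by blast
  define T where "T = (map_poly of_int Tz :: rat poly)"
  have T: "T = Polynomial.smult (of_int d) (c n)" by (simp add: T_def d)
  \<comment> \<open>The last row is the relation solved for the highest derivative; the rows in
    between say that each entry differentiates to the next.\<close>
  define A where "A i j = (if i = 0 then 0 else if i = n - 1 then - Polynomial.smult (of_int d) (c j)
      else if j = i + 1 then T else 0)" for i j :: nat
  define t where "t = degree T + (\<Sum>i<n. \<Sum>j<n. degree (A i j))"
  have "differential_system n t T A ?Y"
  proof
    show "0 < n" using n by simp
    show "T \<noteq> 0" unfolding T using \<open>c n \<noteq> 0\<close> d(1) by simp
    show "?Y 0 = 1" by (simp add: deriv_tuple_def)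
    show "A 0 j = 0" for j by (simp add: A_def)
    show "degree T \<le> t" by (simp add: t_def)
    show "degree (A i j) \<le> t" if "i < n" "j < n" for i j
    proof -
      have "degree (A i j) \<le> (\<Sum>j<n. degree (A i j))" using that by (intro member_le_sum) auto
      also have "\<dots> \<le> (\<Sum>i<n. \<Sum>j<n. degree (A i j))"
        using that by (intro member_le_sum[of i "{..<n}" "\<lambda>i. \<Sum>j<n. degree (A i j)"]) auto
      finally show ?thesis by (simp add: t_def)
    qed
    show "poly_independent n ?Y" by (rule ind)
    show "fps_of_poly T * fps_deriv (?Y i) = (\<Sum>j<n. fps_of_poly (A i j) * ?Y j)" if "i < n" for i
    proof -
      have dY: "fps_deriv (?Y i) = (if i = 0 then 0 else ?Y (Suc i))"
        by (cases i) (simp_all add: deriv_tuple_def)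
      consider "i = 0" | "i \<noteq> 0" "i = n - 1" | "i \<noteq> 0" "i \<noteq> n - 1" by blast
      then show ?thesis
      proof cases
        case 1
        then show ?thesis unfolding dY by (simp add: A_def)
      next
        case 2
        then have "Suc i = n" using n by simp
        then have "fps_of_poly T * fps_deriv (?Y i) = fps_const (of_int d) * (fps_of_poly (c n) * ?Y n)"
          unfolding dY T using 2 by (simp add: fps_of_poly_smult mult.assoc)
        also have "fps_of_poly (c n) * ?Y n = - (\<Sum>i<n. fps_of_poly (c i) * ?Y i)"
          using c(1) by (simp add: eq_neg_iff_add_eq_0 add.commute)
        also have "fps_const (of_int d) * \<dots> = (\<Sum>j<n. fps_of_poly (A i j) * ?Y j)"
          using 2 by (simp add: A_def fps_of_poly_uminus fps_of_poly_smult sum_negf sum_distrib_left mult.assoc)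
        finally show ?thesis .
      next
        case 3
        have "(\<Sum>j<n. fps_of_poly (A i j) * ?Y j) = (\<Sum>j<n. if j = Suc i then fps_of_poly T * ?Y (Suc i) else 0)"
          using 3 by (intro sum.cong) (auto simp: A_def)
        also have "\<dots> = fps_of_poly T * ?Y (Suc i)" using 3 that by simp
        finally show ?thesis using 3 by (simp add: dY)
      qed
    qed
  qed
  then show ?thesis using n(1) unfolding T_def by blast
qed

section \<open>Siegel's lemma\<close>

text \<open>By \<open>big\<close>, the box of vectors with entries in \<open>{0..X}\<close> has more
  points than there are possible value vectors; the difference of two points with equal values is a
  solution.\<close>

lemma Siegel_pigeonhole:
  fixes a :: "nat \<Rightarrow> nat \<Rightarrow> int" and M N B X :: nat
  assumes a: "\<And>i j. i < M \<Longrightarrow> j < N \<Longrightarrow> \<bar>a i j\<bar> \<le> int B"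
    and big: "(2 * N * B * X + 1) ^ M < (X + 1) ^ N"
  shows "\<exists>x. (\<exists>j<N. x j \<noteq> 0) \<and> (\<forall>j<N. \<bar>x j\<bar> \<le> int X) \<and> (\<forall>i<M. (\<Sum>j<N. a i j * x j) = 0)"
proof -
  define S where "S = ({..<N} \<rightarrow>\<^sub>E {0..int X})"
  define g where "g x = (\<lambda>i\<in>{..<M}. \<Sum>j<N. a i j * x j)" for x :: "nat \<Rightarrow> int"
  define V where "V = ({..<M} \<rightarrow>\<^sub>E {- int (N * B * X)..int (N * B * X)})"
  have card_S: "card S = (X + 1) ^ N" by (simp add: S_def card_PiE nat_add_distrib)
  have card_V: "card V = (2 * N * B * X + 1) ^ M"
  proof -
    have "card {- int (N * B * X)..int (N * B * X)} = 2 * N * B * X + 1"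
      unfolding card_atLeastAtMost_int by (simp add: nat_eq_iff)
    then show ?thesis by (simp add: V_def card_PiE del: card_atLeastAtMost_int)
  qed
  have "finite V" by (simp add: V_def finite_PiE)
  have "g ` S \<subseteq> V"
  proof
    fix z assume "z \<in> g ` S"
    then obtain x where x: "x \<in> S" "z = g x" by blast
    have "\<bar>\<Sum>j<N. a i j * x j\<bar> \<le> int (N * B * X)" if "i < M" for i
    proof -
      have "\<bar>\<Sum>j<N. a i j * x j\<bar> \<le> (\<Sum>j<N. \<bar>a i j * x j\<bar>)" by (rule sum_abs)
      also have "\<dots> \<le> (\<Sum>j<N. int B * int X)"
      proof (rule sum_mono)
        fix j assume "j \<in> {..<N}"
        then have "\<bar>x j\<bar> \<le> int X" "\<bar>a i j\<bar> \<le> int B"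
          using x(1) a[OF that] unfolding S_def by (auto simp: PiE_iff)
        then show "\<bar>a i j * x j\<bar> \<le> int B * int X" unfolding abs_mult by (intro mult_mono) auto
      qed
      also have "\<dots> = int (N * B * X)" by simp
      finally show ?thesis .
    qed
    then have "(\<Sum>j<N. a i j * x j) \<in> {- int (N * B * X)..int (N * B * X)}" if "i < M" for i
      using that by (fastforce simp: abs_le_iff)
    then show "z \<in> V" unfolding x(2) g_def V_def by (intro restrict_PiE_iff[THEN iffD2]) auto
  qed
  then have "card (g ` S) < card S"
    using card_mono[OF \<open>finite V\<close>] big unfolding card_S card_V by (meson le_less_trans)
  from pigeonhole[OF this] obtain x x' where xx: "x \<in> S" "x' \<in> S" "x \<noteq> x'" "g x = g x'"
    unfolding inj_on_def by blast
  have "\<exists>j<N. x j - x' j \<noteq> 0"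
  proof (rule ccontr)
    assume "\<not> ?thesis"
    then have "x = x'" using xx(1,2) unfolding S_def by (intro PiE_ext) auto
    then show False using xx(3) by simp
  qed
  moreover have "\<forall>j<N. \<bar>x j - x' j\<bar> \<le> int X"
    using xx(1,2) unfolding S_def by (force simp: PiE_iff abs_le_iff)
  moreover have "\<forall>i<M. (\<Sum>j<N. a i j * (x j - x' j)) = 0"
  proof (intro allI impI)
    fix i assume "i < M"
    then have "(\<Sum>j<N. a i j * x j) = (\<Sum>j<N. a i j * x' j)"
      using fun_cong[OF xx(4), of i] by (simp add: g_def)
    then show "(\<Sum>j<N. a i j * (x j - x' j)) = 0" by (simp add: right_diff_distrib sum_subtractf)
  qed
  ultimately show ?thesis by (rule_tac x = "\<lambda>j. x j - x' j" in exI) blast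
qed

text \<open>With \<open>h\<close> more unknowns than equations, the usual exponent
  \<open>M / h\<close> is at most the integer \<open>E\<close>.\<close>

lemma Siegel:
  fixes a :: "nat \<Rightarrow> nat \<Rightarrow> int" and M h B E :: nat
  assumes a: "\<And>i j. i < M \<Longrightarrow> j < M + h \<Longrightarrow> \<bar>a i j\<bar> \<le> int B"
    and "0 < h" "0 < B" "M \<le> E * h"
  shows "\<exists>x. (\<exists>j<M + h. x j \<noteq> 0) \<and> (\<forall>j<M + h. \<bar>x j\<bar> \<le> int ((2 * (M + h) * B) ^ E)) \<and>
           (\<forall>i<M. (\<Sum>j<M + h. a i j * x j) = 0)"
proof (rule Siegel_pigeonhole[OF a])
  define b where "b = 2 * (M + h) * B"
  have b: "1 \<le> b" using assms by (simp add: b_def)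
  let ?X = "b ^ E"
  have "(b * ?X + 1) ^ M \<le> (b * (?X + 1)) ^ M" using b by (intro power_mono) auto
  also have "\<dots> = b ^ M * (?X + 1) ^ M" by (rule power_mult_distrib)
  also have "b ^ M \<le> b ^ (E * h)" using b assms by (intro power_increasing) auto
  also have "\<dots> = ?X ^ h" by (rule power_mult)
  also have "?X ^ h < (?X + 1) ^ h" using assms by (intro power_strict_mono) auto
  finally have "(b * ?X + 1) ^ M < (?X + 1) ^ h * (?X + 1) ^ M" by simp
  also have "\<dots> = (?X + 1) ^ (M + h)" by (simp add: power_add mult.commute)
  finally show "(2 * (M + h) * B * (2 * (M + h) * B) ^ E + 1) ^ M < ((2 * (M + h) * B) ^ E + 1) ^ (M + h)"
    unfolding b_def .
qed

section \<open>Approximants\<close>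

text \<open>Differentiation shifts indices by fewer than \<open>q\<close> places, so
  \<open>d (m + q)\<close> clears all denominators up to \<open>m\<close>. The exponent
  \<open>m + 1\<close> leaves room for the value at index 0.\<close>

lemma G_function_derivative_bounds:
  fixes F :: "nat \<Rightarrow> rat" and C :: real and d :: "nat \<Rightarrow> int" and q :: nat
  assumes F: "\<And>n. 1 \<le> n \<Longrightarrow> \<bar>real_of_rat (F n)\<bar> \<le> C ^ n"
    and d: "\<And>n. 1 \<le> n \<Longrightarrow> d n \<noteq> 0 \<and> real_of_int \<bar>d n\<bar> \<le> C ^ n \<and> (\<forall>m\<le>n. of_int (d n) * F m \<in> \<int>)"
    and q: "1 \<le> q"
  shows "\<exists>(C1::nat) (D::nat \<Rightarrow> int). 1 \<le> C1 \<and> (\<forall>m. 0 < D m \<and> D m \<le> int (C1 ^ (m + 1))) \<and>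
     (\<forall>j<q. \<forall>m. \<bar>real_of_rat (fps_nth ((fps_deriv ^^ j) (Abs_fps F)) m)\<bar> \<le> real (C1 ^ (m + 1))) \<and>
     (\<forall>j<q. \<forall>m. \<forall>l\<le>m. of_int (D m) * fps_nth ((fps_deriv ^^ j) (Abs_fps F)) l \<in> \<int>)"
proof -
  obtain c :: nat where c: "max 1 (max C \<bar>real_of_rat (F 0)\<bar>) \<le> real c" using real_arch_simple by blast
  then have c1: "1 \<le> c" and cC: "C \<le> real c" and c0: "\<bar>real_of_rat (F 0)\<bar> \<le> real c" by auto
  have "0 \<le> C" using order.trans[OF abs_ge_zero F[of 1]] by simp
  have F': "\<bar>real_of_rat (F n)\<bar> \<le> real c ^ (n + 1)" for n
  proof (cases "n = 0")
    case False
    then have "\<bar>real_of_rat (F n)\<bar> \<le> C ^ n" using F by simp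
    also have "\<dots> \<le> real c ^ n" using cC \<open>0 \<le> C\<close> by (intro power_mono)
    also have "\<dots> \<le> real c ^ (n + 1)" using c1 by (intro power_increasing) auto
    finally show ?thesis .
  qed (use c0 in simp)
  \<comment> \<open>Each of the fewer than \<open>q\<close> integer factors created by
    differentiation is at most \<open>2^(m + q)\<close>, which accounts for \<open>2 ^ q\<close>;
    the power \<open>q + 1\<close> in \<open>C1\<close> absorbs \<open>m + q + 1\<close>.\<close>
  define b where "b = 2 ^ q * c"
  have b1: "1 \<le> b" and cb: "c \<le> b" using c1 by (simp_all add: b_def)
  define C1 where "C1 = b ^ (q + 1)"
  have exp_le: "m + q \<le> (q + 1) * (m + 1)" and exp_le': "m + q + 1 \<le> (q + 1) * (m + 1)" for m
    by (simp_all add: algebra_simps)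
  have C1: "1 \<le> C1" using b1 by (simp add: C1_def)
  define D where "D m = \<bar>d (m + q)\<bar>" for m
  have "0 < D m \<and> D m \<le> int (C1 ^ (m + 1))" for m
  proof
    show "0 < D m" using d[of "m + q"] q by (simp add: D_def)
    have "real_of_int (D m) \<le> C ^ (m + q)" using d[of "m + q"] q by (simp add: D_def)
    also have "\<dots> \<le> real c ^ (m + q)" using cC \<open>0 \<le> C\<close> by (intro power_mono)
    also have "\<dots> \<le> real b ^ (m + q)" using cb by (intro power_mono) auto
    also have "\<dots> \<le> real b ^ ((q + 1) * (m + 1))"
      using b1 exp_le by (intro power_increasing) auto
    also have "\<dots> = real_of_int (int (C1 ^ (m + 1)))"
      by (simp only: C1_def power_mult of_nat_power of_int_power of_int_of_nat_eq)
    finally show "D m \<le> int (C1 ^ (m + 1))" by linarith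
  qed
  moreover have "\<bar>real_of_rat (fps_nth ((fps_deriv ^^ j) (Abs_fps F)) m)\<bar> \<le> real (C1 ^ (m + 1))"
    if "j < q" for j m
  proof -
    have "\<bar>real_of_rat (fps_nth ((fps_deriv ^^ j) (Abs_fps F)) m)\<bar> =
        (\<Prod>i<j. real (m + j - i)) * \<bar>real_of_rat (F (m + j))\<bar>"
      unfolding fps_nth_higher_deriv_prod of_rat_mult of_rat_prod of_rat_of_nat_eq abs_mult
      by (simp add: abs_prod)
    also have "\<dots> \<le> (\<Prod>i<j. 2 ^ (m + q)) * real c ^ (m + j + 1)"
    proof (intro mult_mono prod_mono conjI F')
      fix i assume "i \<in> {..<j}"
      have "real (m + j - i) \<le> real (m + q)" using that by simp
      also have "\<dots> \<le> 2 ^ (m + q)" using less_exp[of "m + q"]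
        by (metis less_imp_le of_nat_le_iff of_nat_numeral of_nat_power)
      finally show "real (m + j - i) \<le> 2 ^ (m + q)" .
    qed (auto intro: prod_nonneg)
    also have "(\<Prod>i<j. 2 ^ (m + q)) = (2 ^ j :: real) ^ (m + q)"
      by (simp add: power_mult[symmetric] mult.commute)
    also have "\<dots> * real c ^ (m + j + 1) \<le> (2 ^ q) ^ (m + q + 1) * real c ^ (m + q + 1)"
    proof (intro mult_mono)
      have "(2 ^ j :: real) ^ (m + q) \<le> (2 ^ q) ^ (m + q)" using that by (intro power_mono power_increasing) auto
      also have "\<dots> \<le> (2 ^ q) ^ (m + q + 1)" by (intro power_increasing) auto
      finally show "(2 ^ j :: real) ^ (m + q) \<le> (2 ^ q) ^ (m + q + 1)" .
      show "real c ^ (m + j + 1) \<le> real c ^ (m + q + 1)" using c1 that by (intro power_increasing) auto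
    qed auto
    also have "\<dots> = real b ^ (m + q + 1)" by (simp add: b_def power_mult_distrib)
    also have "\<dots> \<le> real b ^ ((q + 1) * (m + 1))"
      using b1 exp_le'[of m] by (intro power_increasing) auto
    also have "\<dots> = real (C1 ^ (m + 1))" by (simp only: C1_def power_mult of_nat_power)
    finally show ?thesis .
  qed
  moreover have "of_int (D m) * fps_nth ((fps_deriv ^^ j) (Abs_fps F)) l \<in> \<int>" if "j < q" "l \<le> m" for j m l
  proof -
    have "of_int (d (m + q)) * F (l + j) \<in> \<int>" using d[of "m + q"] q that by simp
    moreover have "of_int (D m) * F (l + j) =
        of_int (sgn (d (m + q))) * (of_int (d (m + q)) * F (l + j))"
      unfolding mult.assoc[symmetric] of_int_mult[symmetric] by (simp add: D_def linordered_idom_class.abs_sgn mult.commute)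
    ultimately have "of_int (D m) * F (l + j) \<in> \<int>" by (metis Ints_mult Ints_of_int)
    moreover have "(\<Prod>i<j. of_nat (l + j - i) :: rat) \<in> \<int>" by (intro Ints_prod) auto
    ultimately have "(\<Prod>i<j. of_nat (l + j - i)) * (of_int (D m) * F (l + j)) \<in> \<int>"
      using Ints_mult by blast
    then show ?thesis unfolding fps_nth_higher_deriv_prod by (simp add: mult_ac)
  qed
  ultimately show ?thesis using C1 by blast
qed

lemma coeff_sum_monom_lessThan:
  "coeff (\<Sum>l<N. monom (x l) l) i = (if i < N then x i else 0)"
  by (simp add: coeff_sum)

text \<open>There are \<open>q e h\<close> conditions on \<open>(q e + 1) h\<close> coefficients, so
  Siegel's lemma applies with \<open>h\<close> spare unknowns and an exponent independent of
  \<open>h\<close>. Hence the solution grows only exponentially in \<open>h\<close>.\<close>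

lemma simultaneous_approximants:
  fixes F :: "nat \<Rightarrow> rat" and C1 q e \<kappa> :: nat and D :: "nat \<Rightarrow> int"
  assumes C1: "1 \<le> C1" and D: "\<And>m. 0 < D m" "\<And>m. D m \<le> int (C1 ^ (m + 1))"
    and bound: "\<And>j m. j < q \<Longrightarrow> \<bar>real_of_rat (fps_nth ((fps_deriv ^^ j) (Abs_fps F)) m)\<bar> \<le> real (C1 ^ (m + 1))"
    and den: "\<And>j m l. j < q \<Longrightarrow> l \<le> m \<Longrightarrow> of_int (D m) * fps_nth ((fps_deriv ^^ j) (Abs_fps F)) l \<in> \<int>"
    and \<kappa>: "q * e + 1 \<le> \<kappa>"
  shows "\<exists>c::nat. 1 \<le> c \<and> (\<forall>h\<ge>1. \<exists>Q :: int poly. Q \<noteq> 0 \<and> degree Q < (q * e + 1) * h \<and>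
     (\<forall>i. \<bar>coeff Q i\<bar> \<le> int (c ^ h)) \<and>
     (\<forall>j<q. \<forall>m. \<kappa> * h < m \<longrightarrow> m \<le> (\<kappa> + e) * h \<longrightarrow>
        fps_nth (fps_of_poly (map_poly of_int Q) * (fps_deriv ^^ j) (Abs_fps F)) m = 0))"
proof -
  define c where "c = (2 * 2 ^ (q * e + 1) * C1 ^ (2 * (\<kappa> + e) + 2)) ^ (q * e)"
  have "1 \<le> c" using C1 by (simp add: c_def)
  moreover have "\<exists>Q :: int poly. Q \<noteq> 0 \<and> degree Q < (q * e + 1) * h \<and>
     (\<forall>i. \<bar>coeff Q i\<bar> \<le> int (c ^ h)) \<and>
     (\<forall>j<q. \<forall>m. \<kappa> * h < m \<longrightarrow> m \<le> (\<kappa> + e) * h \<longrightarrow>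
        fps_nth (fps_of_poly (map_poly of_int Q) * (fps_deriv ^^ j) (Abs_fps F)) m = 0)" if h: "1 \<le> h" for h
  proof -
    define M where "M = q * (e * h)"
    \<comment> \<open>Condition \<open>i\<close> encodes a pair: \<open>i div (e * h)\<close> is the
      order of the derivative, and the residue selects one of the \<open>e * h\<close> exponents
      just above \<open>\<kappa> * h\<close>.\<close>
    define m where "m i = \<kappa> * h + 1 + i mod (e * h)" for i
    define G where "G = (\<kappa> + e) * h"
    \<comment> \<open>The floor is exact for \<open>i < M\<close>: multiplication by
      \<open>D G\<close> makes the coefficients up to index \<open>G\<close> integral.\<close>
    define a where "a i l = \<lfloor>of_int (D G) * fps_nth ((fps_deriv ^^ (i div (e * h))) (Abs_fps F)) (m i - l)\<rfloor>" for i l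
    define B where "B = C1 ^ (2 * G + 2)"
    have N: "M + h = (q * e + 1) * h" by (simp add: M_def algebra_simps)
    have m_le: "m i \<le> G" and div: "i div (e * h) < q" if "i < M" for i
    proof -
      have "0 < e * h" using that by (auto simp: M_def intro: Nat.gr0I)
      then have "i mod (e * h) < e * h" by simp
      then show "m i \<le> G" by (simp add: m_def G_def algebra_simps)
      show "i div (e * h) < q" using that by (simp add: M_def less_mult_imp_div_less)
    qed
    have a_eq: "of_int (a i l) = of_int (D G) * fps_nth ((fps_deriv ^^ (i div (e * h))) (Abs_fps F)) (m i - l)"
      if "i < M" for i l
      unfolding a_def using den[OF div[OF that], of "m i - l" G] m_le[OF that]
      by (metis (no_types, lifting) diff_le_self floor_of_int Ints_cases le_trans)
    have "\<bar>a i l\<bar> \<le> int B" if "i < M" for i l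
    proof -
      have "real_of_int \<bar>a i l\<bar> = \<bar>real_of_rat (of_int (a i l))\<bar>" by simp
      also have "\<dots> = real_of_int (D G) * \<bar>real_of_rat (fps_nth ((fps_deriv ^^ (i div (e * h))) (Abs_fps F)) (m i - l))\<bar>"
        unfolding a_eq[OF that] using D(1)[of G] by (simp add: of_rat_mult abs_mult)
      also have "\<dots> \<le> real (C1 ^ (G + 1)) * real (C1 ^ (m i - l + 1))"
      proof (intro mult_mono bound div that)
        show "real_of_int (D G) \<le> real (C1 ^ (G + 1))" using D(2)[of G] by linarith
      qed auto
      also have "\<dots> \<le> real (C1 ^ (G + 1)) * real (C1 ^ (G + 1))"
        using C1 m_le[OF that] by (intro mult_left_mono of_nat_mono power_increasing) auto
      also have "\<dots> = real B" by (simp add: B_def power_add[symmetric] mult_2 flip: of_nat_mult of_nat_power)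
      finally show ?thesis by linarith
    qed
    moreover have "0 < B" using C1 by (simp add: B_def)
    moreover have "M \<le> (q * e) * h" by (simp add: M_def)
    ultimately obtain x where x: "\<exists>j<M + h. x j \<noteq> 0" "\<forall>j<M + h. \<bar>x j\<bar> \<le> int ((2 * (M + h) * B) ^ (q * e))"
      "\<forall>i<M. (\<Sum>j<M + h. a i j * x j) = 0"
      using Siegel[of M h a B "q * e"] h by auto
    define Q where "Q = (\<Sum>l<M + h. monom (x l) l)"
    have coeff_Q: "coeff Q i = (if i < M + h then x i else 0)" for i
      unfolding Q_def by (rule coeff_sum_monom_lessThan)
    have "Q \<noteq> 0"
    proof
      assume "Q = 0"
      then have "x j = 0" if "j < M + h" for j using coeff_Q[of j] that by simp
      then show False using x(1) by blast
    qed
    moreover have "degree Q < (q * e + 1) * h"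
      unfolding N[symmetric] using \<open>Q \<noteq> 0\<close> coeff_Q[of "degree Q"] by (metis leading_coeff_0_iff)
    moreover have "\<bar>coeff Q i\<bar> \<le> int (c ^ h)" for i
    proof -
      have "2 * (M + h) * B \<le> 2 ^ h * 2 ^ ((q * e + 1) * h) * C1 ^ ((2 * (\<kappa> + e) + 2) * h)"
      proof (intro mult_le_mono)
        show "2 \<le> (2::nat) ^ h" using h self_le_power[of "2::nat" h] by simp
        show "M + h \<le> 2 ^ ((q * e + 1) * h)" unfolding N by (rule less_imp_le[OF less_exp])
        have "2 * G + 2 \<le> (2 * (\<kappa> + e) + 2) * h" using h by (simp add: G_def algebra_simps)
        then show "B \<le> C1 ^ ((2 * (\<kappa> + e) + 2) * h)" unfolding B_def using C1 by (intro power_increasing)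
      qed
      also have "\<dots> = (2 * 2 ^ (q * e + 1) * C1 ^ (2 * (\<kappa> + e) + 2)) ^ h"
        by (simp only: power_mult power_mult_distrib)
      finally have "(2 * (M + h) * B) ^ (q * e) \<le> ((2 * 2 ^ (q * e + 1) * C1 ^ (2 * (\<kappa> + e) + 2)) ^ h) ^ (q * e)"
        by (intro power_mono) auto
      also have "\<dots> = c ^ h" unfolding c_def by (simp only: power_mult[symmetric] mult.commute)
      finally have "int ((2 * (M + h) * B) ^ (q * e)) \<le> int (c ^ h)" by (rule of_nat_mono)
      then have "\<bar>x i\<bar> \<le> int (c ^ h)" if "i < M + h" using x(2) that by (meson order.trans)
      then show ?thesis by (simp add: coeff_Q)
    qed
    moreover have "fps_nth (fps_of_poly (map_poly of_int Q) * (fps_deriv ^^ j) (Abs_fps F)) k = 0"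
      if j: "j < q" and k: "\<kappa> * h < k" "k \<le> (\<kappa> + e) * h" for j k
    proof -
      let ?g = "(fps_deriv ^^ j) (Abs_fps F)"
      define i where "i = j * (e * h) + (k - \<kappa> * h - 1)"
      have lt: "k - \<kappa> * h - 1 < e * h" using k by (simp add: algebra_simps)
      have "0 < e * h" using lt by linarith
      have i_div: "i div (e * h) = j" and i_mod: "i mod (e * h) = k - \<kappa> * h - 1"
        using lt \<open>0 < e * h\<close> by (simp_all add: i_def)
      have "i < M"
      proof -
        have "i < (j + 1) * (e * h)" using lt by (simp add: i_def)
        also have "\<dots> \<le> M" unfolding M_def using j by (intro mult_le_mono1) simp
        finally show ?thesis .
      qed
      have mi: "m i = k" using k by (simp add: m_def i_mod)
      \<comment> \<open>All exponents of \<open>Q\<close> lie below \<open>k\<close>, so every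
        unknown occurs in the convolution and the subtraction \<open>k - l\<close> is
        genuine.\<close>
      have "M + h \<le> \<kappa> * h" unfolding N using \<kappa> by (intro mult_le_mono1)
      then have Nk: "M + h \<le> k" using k by simp
      have "of_int (D G) * fps_nth (fps_of_poly (map_poly of_int Q) * ?g) k =
          (\<Sum>l\<in>{0..k}. of_int (coeff Q l) * (of_int (D G) * fps_nth ?g (k - l)))"
        by (simp add: fps_mult_nth coeff_map_poly sum_distrib_left mult_ac)
      also have "\<dots> = (\<Sum>l<M + h. of_int (coeff Q l) * (of_int (D G) * fps_nth ?g (k - l)))"
        using Nk by (intro sum.mono_neutral_right) (auto simp: coeff_Q)
      also have "\<dots> = (\<Sum>l<M + h. of_int (x l) * of_int (a i l))"
        by (intro sum.cong) (auto simp: coeff_Q a_eq[OF \<open>i < M\<close>] i_div mi)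
      also have "\<dots> = of_int (\<Sum>l<M + h. a i l * x l)" by (simp add: mult.commute)
      also have "\<dots> = 0" using x(3) \<open>i < M\<close> by simp
      finally show ?thesis using D(1)[of G] by simp
    qed
    ultimately show ?thesis by blast
  qed
  ultimately show ?thesis by blast
qed

section \<open>Divided derivatives and coefficient sizes\<close>

definition hasse_deriv :: "nat \<Rightarrow> int poly \<Rightarrow> int poly" where
  "hasse_deriv k Q = (\<Sum>i<degree Q + 1. monom (int ((i + k) choose k) * coeff Q (i + k)) i)"

lemma coeff_hasse_deriv: "coeff (hasse_deriv k Q) i = int ((i + k) choose k) * coeff Q (i + k)"
proof (cases "i < degree Q + 1")
  case False
  then have "coeff Q (i + k) = 0" by (intro coeff_eq_0) simp
  then show ?thesis using False unfolding hasse_deriv_def coeff_sum_monom_lessThan by simp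
qed (simp add: hasse_deriv_def coeff_sum_monom_lessThan del: sum.lessThan_Suc)

text \<open>Splitting off \<open>fact k\<close> keeps the coefficients integral and replaces
  factorial growth by binomial coefficients.\<close>

lemma higher_pderiv_eq_hasse_deriv:
  "(pderiv ^^ k) (map_poly of_int Q) =
     Polynomial.smult (fact k) (map_poly of_int (hasse_deriv k Q) :: rat poly)"
proof (rule poly_eqI)
  fix i
  have "pochhammer (of_nat (Suc i)) k * fact i = (fact (i + k) :: rat)"
    using pochhammer_product[of i "i + k" "1::rat"] by (simp add: pochhammer_fact mult.commute add.commute)
  moreover have "of_nat ((i + k) choose k) * fact k * fact i = (fact (i + k) :: rat)"
  proof -
    have "((i + k) choose k) * fact k * fact i = (fact (i + k) :: nat)"
      using binomial_fact_lemma[of k "i + k"] by (simp add: mult_ac)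
    then have "of_nat (((i + k) choose k) * fact k * fact i) = (of_nat (fact (i + k)) :: rat)" by (rule arg_cong)
    then show ?thesis by simp
  qed
  ultimately have "pochhammer (of_nat (Suc i)) k * fact i = (fact k * of_nat ((i + k) choose k)) * (fact i :: rat)"
    by (simp only: mult_ac)
  then have "pochhammer (of_nat (Suc i)) k = (fact k * of_nat ((i + k) choose k) :: rat)"
    by (rule mult_right_cancel[THEN iffD1, rotated]) simp
  then show "coeff ((pderiv ^^ k) (map_poly of_int Q)) i =
      coeff (Polynomial.smult (fact k) (map_poly of_int (hasse_deriv k Q) :: rat poly)) i"
    by (simp add: coeff_higher_pderiv coeff_map_poly coeff_hasse_deriv)
qed

lemma abs_coeff_mult_le:
  fixes p q :: "int poly"
  assumes "\<And>j. \<bar>coeff q j\<bar> \<le> B" and "0 \<le> B"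
  shows "\<bar>coeff (p * q) i\<bar> \<le> (\<Sum>j\<le>degree p. \<bar>coeff p j\<bar>) * B"
proof -
  have "\<bar>coeff (p * q) i\<bar> \<le> (\<Sum>j\<le>i. \<bar>coeff p j * coeff q (i - j)\<bar>)"
    unfolding coeff_mult by (rule sum_abs)
  also have "\<dots> \<le> (\<Sum>j\<le>i. \<bar>coeff p j\<bar> * B)"
    unfolding abs_mult by (intro sum_mono mult_left_mono assms) auto
  also have "\<dots> \<le> (\<Sum>j\<le>max i (degree p). \<bar>coeff p j\<bar> * B)"
    using assms(2) by (intro sum_mono2) auto
  also have "\<dots> = (\<Sum>j\<le>degree p. \<bar>coeff p j\<bar> * B)"
    by (intro sum.mono_neutral_right) (auto simp: coeff_eq_0)
  finally show ?thesis by (simp add: sum_distrib_right)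
qed

lemma abs_coeff_power_mult_le:
  fixes p q :: "int poly"
  assumes "\<And>j. \<bar>coeff q j\<bar> \<le> B" and "0 \<le> B" and "(\<Sum>j\<le>degree p. \<bar>coeff p j\<bar>) \<le> S"
  shows "\<bar>coeff (p ^ k * q) i\<bar> \<le> S ^ k * B"
proof (induction k arbitrary: i)
  case (Suc k)
  have "0 \<le> (\<Sum>j\<le>degree p. \<bar>coeff p j\<bar>)" by (intro sum_nonneg) auto
  then have S: "0 \<le> S" using assms(3) by linarith
  have "\<bar>coeff (p * (p ^ k * q)) i\<bar> \<le> (\<Sum>j\<le>degree p. \<bar>coeff p j\<bar>) * (S ^ k * B)"
    using Suc assms(2) S by (intro abs_coeff_mult_le) auto
  also have "\<dots> \<le> S * (S ^ k * B)" using assms(2,3) S by (intro mult_right_mono) auto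
  finally show ?case by (simp add: mult_ac)
qed (use assms in simp)

lemma poly_nonzero_near_0:
  fixes T :: "rat poly"
  assumes "T \<noteq> 0"
  shows "\<exists>r>0. \<forall>x. 0 < \<bar>x\<bar> \<longrightarrow> \<bar>x\<bar> < r \<longrightarrow> poly T x \<noteq> 0"
proof -
  \<comment> \<open>Inserting 1 keeps the set nonempty when \<open>T\<close> has no root other than
    0.\<close>
  define Z where "Z = insert 1 (abs ` ({x. poly T x = 0} - {0}))"
  have fin: "finite Z" using poly_roots_finite[OF assms] by (simp add: Z_def)
  have "Min Z \<in> Z" using fin by (intro Min_in) (auto simp: Z_def)
  then have "0 < Min Z" by (auto simp: Z_def)
  moreover have "poly T x \<noteq> 0" if "0 < \<bar>x\<bar>" "\<bar>x\<bar> < Min Z" for x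
  proof
    assume "poly T x = 0"
    then have "\<bar>x\<bar> \<in> Z" using that by (auto simp: Z_def)
    then have "Min Z \<le> \<bar>x\<bar>" using fin by (intro Min_le)
    then show False using that by simp
  qed
  ultimately show ?thesis by blast
qed

lemma map_poly_of_int_mult:
  "map_poly of_int (p * q) = (map_poly of_int p * map_poly of_int q :: 'a::comm_ring_1 poly)"
  by (rule poly_eqI) (simp add: coeff_map_poly coeff_mult)

lemma map_poly_of_int_power:
  "map_poly of_int (p ^ k) = (map_poly of_int p ^ k :: 'a::comm_ring_1 poly)"
  by (induction k) (simp_all add: map_poly_of_int_mult)

text \<open>For every \<open>\<theta>\<close> some covariant derivative of Siegel's solution has a
  nonzero form at \<open>x\<close>. The choice of \<open>p\<close> may depend on \<open>x\<close>
  and \<open>\<theta>\<close>; the bounds on degree, size and gap do not.\<close>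

lemma nonvanishing_approximants:
  fixes F :: "nat \<Rightarrow> rat"
  assumes sys: "differential_system n t (map_poly of_int (Tz :: int poly)) A (deriv_tuple (Abs_fps F))"
    and n: "2 \<le> n"
    and C1: "1 \<le> (C1::nat)" and D: "\<And>m. 0 < D m" "\<And>m. D m \<le> int (C1 ^ (m + 1))"
    and bound: "\<And>j m. j < n - 1 \<Longrightarrow> \<bar>real_of_rat (fps_nth ((fps_deriv ^^ j) (Abs_fps F)) m)\<bar> \<le> real (C1 ^ (m + 1))"
    and den: "\<And>j m l. j < n - 1 \<Longrightarrow> l \<le> m \<Longrightarrow> of_int (D m) * fps_nth ((fps_deriv ^^ j) (Abs_fps F)) l \<in> \<int>"
    and g_def: "g = (n - 1) * (2 * t + 4) + 1 + 2 * t" and \<kappa>: "g \<le> \<kappa>"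
  shows "\<exists>(c::nat) h0 r. 1 \<le> c \<and> 0 < r \<and> (\<forall>h\<ge>h0. \<forall>(x::rat) \<theta>. 0 < \<bar>x\<bar> \<longrightarrow> \<bar>x\<bar> < r \<longrightarrow>
     (\<exists>p :: int poly. degree p \<le> g * h \<and> (\<forall>i. \<bar>coeff p i\<bar> \<le> int (c ^ h)) \<and>
        (\<forall>m. (\<kappa> + 2 * t) * h < m \<longrightarrow> m \<le> (\<kappa> + 2 * t + 2) * h \<longrightarrow>
           fps_nth (fps_of_poly (map_poly of_int p) * Abs_fps F) m = 0) \<and>
        poly (map_poly of_int p) x * \<theta> \<noteq>
          (\<Sum>m\<le>(\<kappa> + 2 * t) * h. fps_nth (fps_of_poly (map_poly of_int p) * Abs_fps F) m * x ^ m)))"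
proof -
  define f where "f = Abs_fps F"
  define q where "q = n - 1"
  \<comment> \<open>Of these \<open>e h\<close> extra orders, \<open>2 t h\<close> may be consumed
    by degree growth and \<open>2 h\<close> by differentiation, and \<open>2 h\<close> remain as the
    gap.\<close>
  define e where "e = 2 * t + 4"
  define T where "T = (map_poly of_int Tz :: rat poly)"
  interpret differential_system n t T A "deriv_tuple f" using sys by (simp add: T_def f_def)
  have nq: "n = q + 1" "1 \<le> q" using n by (auto simp: q_def)
  have g: "g = q * e + 1 + 2 * t" by (simp add: g_def q_def e_def)
  have "q * e + 1 \<le> \<kappa>" using \<kappa> g by simp
  from simultaneous_approximants[where F = F and q = q and e = e and \<kappa> = \<kappa>, OF C1 D bound den this]
  obtain c1 :: nat where c1: "1 \<le> c1"
    and Q_ex: "\<And>h. 1 \<le> h \<Longrightarrow> \<exists>Q :: int poly. Q \<noteq> 0 \<and> degree Q < (q * e + 1) * h \<and>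
     (\<forall>i. \<bar>coeff Q i\<bar> \<le> int (c1 ^ h)) \<and>
     (\<forall>j<q. \<forall>m. \<kappa> * h < m \<longrightarrow> m \<le> (\<kappa> + e) * h \<longrightarrow>
        fps_nth (fps_of_poly (map_poly of_int Q) * (fps_deriv ^^ j) f) m = 0)"
    unfolding q_def f_def by blast
  obtain c0 where c0: "\<forall>v L K N x lam. v 0 \<noteq> 0 \<longrightarrow> degree (v 0) \<le> L \<longrightarrow> (\<forall>i<n. degree (v i) \<le> K) \<longrightarrow>
     (\<forall>i<n. \<forall>m<N. fps_nth (R v 0 i) m = 0) \<longrightarrow> L + c0 \<le> N \<longrightarrow> x \<noteq> 0 \<longrightarrow> poly T x \<noteq> 0 \<longrightarrow>
     (\<exists>i<n. lam i \<noteq> 0) \<longrightarrow>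
     (\<exists>k. k + (n - 1) * N \<le> L + (n - 1) * K + c0 \<and> (\<Sum>i<n. lam i * poly (W v k i) x) \<noteq> 0)"
    using zero_estimate by (elim exE)
  obtain r where r: "r > 0" "\<And>x. 0 < \<bar>x\<bar> \<Longrightarrow> \<bar>x\<bar> < r \<Longrightarrow> poly T x \<noteq> 0"
    using poly_nonzero_near_0[OF T_nz] by blast
  define S where "S = nat (\<Sum>j\<le>degree Tz. \<bar>coeff Tz j\<bar>) + 1"
  have S: "(\<Sum>j\<le>degree Tz. \<bar>coeff Tz j\<bar>) \<le> int S" "1 \<le> S" unfolding S_def by auto
  define c where "c = S ^ 2 * 2 ^ (q * e + 1) * c1"
  have "1 \<le> c" using c1 S by (simp add: c_def)
  have main: "\<exists>p :: int poly. degree p \<le> g * h \<and> (\<forall>i. \<bar>coeff p i\<bar> \<le> int (c ^ h)) \<and>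
        (\<forall>m. (\<kappa> + 2 * t) * h < m \<longrightarrow> m \<le> (\<kappa> + 2 * t + 2) * h \<longrightarrow>
           fps_nth (fps_of_poly (map_poly of_int p) * f) m = 0) \<and>
        poly (map_poly of_int p) x * \<theta> \<noteq>
          (\<Sum>m\<le>(\<kappa> + 2 * t) * h. fps_nth (fps_of_poly (map_poly of_int p) * f) m * x ^ m)"
    if h: "c0 + 1 \<le> h" and x: "0 < \<bar>x\<bar>" "\<bar>x\<bar> < r" for h x \<theta>
  proof -
    obtain Q :: "int poly" where Q: "Q \<noteq> 0" "degree Q < (q * e + 1) * h" "\<And>i. \<bar>coeff Q i\<bar> \<le> int (c1 ^ h)"
      "\<And>j m. j < q \<Longrightarrow> \<kappa> * h < m \<Longrightarrow> m \<le> (\<kappa> + e) * h \<Longrightarrow>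
        fps_nth (fps_of_poly (map_poly of_int Q) * (fps_deriv ^^ j) f) m = 0"
      using Q_ex[of h] h by auto
    define Qr where "Qr = (map_poly of_int Q :: rat poly)"
    have deg_Qr: "degree Qr = degree Q" unfolding Qr_def by (intro degree_map_poly) auto
    have "coeff Qr (degree Q) \<noteq> 0" using Q(1) by (simp add: Qr_def coeff_map_poly)
    then have "Qr \<noteq> 0" by auto
    define K where "K = \<kappa> * h"
    define N where "N = K + e * h + 1"
    \<comment> \<open>The numerators are the truncations at \<open>K\<close>; by the choice of
      \<open>Q\<close>, the next \<open>e * h\<close> coefficients of each product vanish.\<close>
    define v where "v i = (if i = 0 then Qr else truncate_fps (K + 1) (fps_of_poly Qr * deriv_tuple f i))" for i
    have le_K: "(q * e + 1) * h \<le> K" unfolding K_def using \<open>q * e + 1 \<le> \<kappa>\<close> by (rule mult_le_mono1)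
    have deg_v: "degree (v i) \<le> K" for i
    proof (cases "i = 0")
      case True
      then show ?thesis using Q(2) le_K deg_Qr by (simp add: v_def)
    next
      case False
      then show ?thesis
        using degree_truncate_fps[of "K + 1" "fps_of_poly Qr * deriv_tuple f i"] by (simp add: v_def)
    qed
    have R0: "fps_nth (R v 0 i) m = 0" if "i < n" "m < N" for i m
    proof (cases "i = 0")
      case True
      then show ?thesis by (simp add: R_def v_def y_0)
    next
      case False
      then have R: "R v 0 i = fps_of_poly Qr * deriv_tuple f i - fps_of_poly (v i)"
        by (simp add: R_def v_def)
      show ?thesis
      proof (cases "m \<le> K")
        case True
        then show ?thesis using False unfolding R by (simp add: v_def)
      next
        case mK: False
        have "fps_nth (fps_of_poly Qr * (fps_deriv ^^ (i - 1)) f) m = 0"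
          unfolding Qr_def using that mK False nq by (intro Q(4)) (auto simp: K_def N_def algebra_simps)
        then show ?thesis using False mK unfolding R by (simp add: v_def deriv_tuple_def)
      qed
    qed
    have LN: "(q * e + 1) * h + c0 \<le> N"
    proof -
      have "h \<le> e * h" by (simp add: e_def)
      then show ?thesis using le_K h unfolding N_def by linarith
    qed
    have x0: "x \<noteq> 0" "poly T x \<noteq> 0" using x r(2) by auto
    have v0: "v 0 \<noteq> 0" "degree (v 0) \<le> (q * e + 1) * h" using \<open>Qr \<noteq> 0\<close> deg_Qr Q(2) by (simp_all add: v_def)
    \<comment> \<open>This form evaluates to \<open>\<theta> W_0(x) - W_1(x)\<close>, where index 1
      belongs to \<open>f\<close> itself.\<close>
    define lam where "lam i = (if i = 0 then \<theta> else if i = 1 then - 1 else 0)" for i :: nat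
    have lam_nz: "\<exists>i<n. lam i \<noteq> 0" using n by (intro exI[of _ 1]) (simp add: lam_def)
    have "\<exists>k. k + (n - 1) * N \<le> (q * e + 1) * h + (n - 1) * K + c0 \<and>
        (\<Sum>i<n. lam i * poly (W v k i) x) \<noteq> 0"
      using c0[THEN spec[of _ v], THEN spec[of _ "(q * e + 1) * h"], THEN spec[of _ K], THEN spec[of _ N],
          THEN spec[of _ x], THEN spec[of _ lam]] v0 deg_v R0 LN x0 lam_nz by (simp del: cov_deriv.simps)
    then obtain k where k: "k + (n - 1) * N \<le> (q * e + 1) * h + (n - 1) * K + c0"
      and nz: "(\<Sum>i<n. lam i * poly (W v k i) x) \<noteq> 0" by blast
    \<comment> \<open>The terms of size \<open>q e h\<close> cancel in the zero estimate, leaving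
      \<open>k \<le> h + c0\<close> with \<open>c0 < h\<close>.\<close>
    have k2: "k \<le> 2 * h"
    proof -
      have "(n - 1) * N = q * K + q * (e * h) + q" by (simp add: q_def N_def algebra_simps)
      moreover have "(q * e + 1) * h = q * (e * h) + h" by (simp add: algebra_simps)
      ultimately have "k \<le> h + c0" using k unfolding q_def[symmetric] by linarith
      then show ?thesis using h by linarith
    qed
    have tk: "t * k \<le> 2 * t * h" using mult_le_mono2[OF k2, of t] by (simp add: mult_ac)
    have "(\<Sum>i<n. lam i * poly (W v k i) x) = \<theta> * poly (W v k 0) x - poly (W v k 1) x"
    proof -
      obtain n' where n': "n = Suc (Suc n')" using le_Suc_ex[OF n] by auto
      show ?thesis unfolding n' sum.lessThan_Suc_shift by (simp add: lam_def)
    qed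
    then have nz': "\<theta> * poly (W v k 0) x \<noteq> poly (W v k 1) x" using nz by simp
    define p where "p = Tz ^ k * hasse_deriv k Q"
    have Wk0: "W v k 0 = Polynomial.smult (fact k) (map_poly of_int p)"
      unfolding W_0 p_def map_poly_of_int_mult map_poly_of_int_power
      by (simp add: v_def Qr_def higher_pderiv_eq_hasse_deriv T_def)
    define pf where "pf = fps_of_poly (map_poly of_int p) * f"
    \<comment> \<open>The remainder vanishes in this range, so up to \<open>fact k\<close> component
      1 agrees with the product series there. Above the degree of component 1 this creates the
      gap.\<close>
    have Wk1: "coeff (W v k 1) m = fact k * fps_nth pf m" if "m + k < N" for m
    proof -
      have "fps_nth (R v k 1) m = 0" by (rule R_nth_eq_0[OF R0]) (use n that in auto)
      then show ?thesis
        unfolding R_def Wk0 by (simp add: pf_def fps_of_poly_smult deriv_tuple_def mult.assoc)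
    qed
    have deg1: "degree (W v k 1) \<le> (\<kappa> + 2 * t) * h"
    proof -
      have "degree (W v k 1) \<le> K + t * k" using deg_v n by (intro degree_W) auto
      also have "\<dots> \<le> (\<kappa> + 2 * t) * h" using tk by (simp add: K_def algebra_simps)
      finally show ?thesis .
    qed
    have mN: "m + k < N" if "m \<le> (\<kappa> + 2 * t + 2) * h" for m
      using that k2 by (simp add: N_def K_def e_def algebra_simps)
    have gap: "fps_nth pf m = 0" if "(\<kappa> + 2 * t) * h < m" "m \<le> (\<kappa> + 2 * t + 2) * h" for m
    proof -
      have "coeff (W v k 1) m = 0" using deg1 that by (intro coeff_eq_0) simp
      then show ?thesis using Wk1[OF mN[OF that(2)]] by simp
    qed
    have nv: "poly (map_poly of_int p) x * \<theta> \<noteq> (\<Sum>m\<le>(\<kappa> + 2 * t) * h. fps_nth pf m * x ^ m)"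
    proof
      assume eq: "poly (map_poly of_int p) x * \<theta> = (\<Sum>m\<le>(\<kappa> + 2 * t) * h. fps_nth pf m * x ^ m)"
      have "poly (W v k 1) x = (\<Sum>m\<le>(\<kappa> + 2 * t) * h. coeff (W v k 1) m * x ^ m)"
        unfolding poly_altdef using deg1 by (intro sum.mono_neutral_left) (auto simp: coeff_eq_0)
      also have "\<dots> = (\<Sum>m\<le>(\<kappa> + 2 * t) * h. fact k * (fps_nth pf m * x ^ m))"
      proof (intro sum.cong refl)
        fix m assume "m \<in> {..(\<kappa> + 2 * t) * h}"
        then have "m \<le> (\<kappa> + 2 * t + 2) * h" by (simp add: algebra_simps)
        then show "coeff (W v k 1) m * x ^ m = fact k * (fps_nth pf m * x ^ m)"
          using Wk1[OF mN] by (simp only: mult.assoc)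
      qed
      also have "\<dots> = fact k * (poly (map_poly of_int p) x * \<theta>)" by (simp add: eq sum_distrib_left)
      also have "\<dots> = \<theta> * poly (W v k 0) x" unfolding Wk0 by simp
      finally show False using nz' by simp
    qed
    have dp: "degree p \<le> g * h"
    proof -
      have "degree Tz \<le> t"
        using degree_T unfolding T_def by (simp add: degree_map_poly)
      then have "degree (Tz ^ k) \<le> t * k"
        using order.trans[OF degree_power_le[of Tz k] mult_le_mono1] by blast
      moreover have "degree (hasse_deriv k Q) \<le> degree Q"
        by (rule degree_le) (auto simp: coeff_hasse_deriv coeff_eq_0)
      ultimately have "degree p \<le> 2 * t * h + (q * e + 1) * h"
        using degree_mult_le[of "Tz ^ k" "hasse_deriv k Q"] tk Q(2) unfolding p_def by linarith
      then show ?thesis by (simp add: g algebra_simps)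
    qed
    have cp: "\<bar>coeff p i\<bar> \<le> int (c ^ h)" for i
    proof -
      have "\<bar>coeff (hasse_deriv k Q) j\<bar> \<le> int (2 ^ ((q * e + 1) * h) * c1 ^ h)" for j
      proof (cases "j + k \<le> degree Q")
        case True
        have "(j + k) choose k \<le> 2 ^ (j + k)" by (rule binomial_le_pow2)
        also have "\<dots> \<le> 2 ^ ((q * e + 1) * h)" using True Q(2) by (intro power_increasing) auto
        finally have "int ((j + k) choose k) \<le> int (2 ^ ((q * e + 1) * h))" by (rule of_nat_mono)
        then show ?thesis unfolding coeff_hasse_deriv abs_mult of_nat_mult
          using Q(3)[of "j + k"] by (intro mult_mono) auto
      qed (simp add: coeff_hasse_deriv coeff_eq_0)
      then have "\<bar>coeff p i\<bar> \<le> int S ^ k * int (2 ^ ((q * e + 1) * h) * c1 ^ h)"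
        unfolding p_def by (rule abs_coeff_power_mult_le) (use S in auto)
      also have "\<dots> \<le> int S ^ (2 * h) * int (2 ^ ((q * e + 1) * h) * c1 ^ h)"
        using k2 S by (intro mult_right_mono power_increasing) auto
      also have "\<dots> = int (c ^ h)"
        by (simp only: c_def of_nat_power of_nat_mult power_mult_distrib power_mult mult.assoc)
      finally show ?thesis .
    qed
    show ?thesis
      by (rule exI[of _ p], intro conjI allI impI)
         (fact dp, fact cp, fact gap[unfolded pf_def], fact nv[unfolded pf_def])
  qed
  show ?thesis
    by (rule exI[of _ c], rule exI[of _ "c0 + 1"], rule exI[of _ r], intro conjI allI impI)
       (fact, fact r(1), fact main[unfolded f_def])
qed

section \<open>Lower bounds for rational approximations\<close>

lemma Suc_le_two_power: "n + 1 \<le> (2::nat) ^ n"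
  using Suc_leI[OF less_exp[of n]] by simp

text \<open>With \<open>\<theta>\<close> the fraction and \<open>P\<close> the truncated product at
  \<open>x\<close>, the number \<open>p(x) \<theta> - P\<close> is nonzero with denominator at most
  \<open>Y\<close>, while \<open>p(x) \<xi> - P\<close> is at most half of \<open>1 / Y\<close>. So
  \<open>p(x) (\<xi> - \<theta>)\<close> cannot be smaller than \<open>1 / (2 Y)\<close>.\<close>

lemma lower_bound_from_approximant:
  fixes F :: "nat \<Rightarrow> rat" and a z :: int and p :: "int poly" and C1 c g U h \<beta> B m :: nat and d :: int
  defines "x \<equiv> real_of_int a / real \<beta>"
    and "\<xi> \<equiv> (\<Sum>n. real_of_rat (F n) * (real_of_int a / real \<beta>) ^ n)"
    and "pf \<equiv> fps_nth (fps_of_poly (map_poly of_int p) * Abs_fps F)"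
  assumes C1: "1 \<le> C1" and F: "\<And>n. \<bar>real_of_rat (F n)\<bar> \<le> real (C1 ^ (n + 1))"
    and d: "0 < d" "d \<le> int (C1 ^ (U * h + 1))" "\<And>l. l \<le> U * h \<Longrightarrow> of_int d * F l \<in> \<int>"
    and deg: "degree p \<le> g * h" and coeffs: "\<And>i. \<bar>coeff p i\<bar> \<le> int (c ^ h)"
    and gap: "\<And>m. U * h < m \<Longrightarrow> m \<le> (U + 2) * h \<Longrightarrow> pf m = 0"
    and nv: "poly (map_poly of_int p) (of_int a / of_nat \<beta>) * (of_int z / (of_nat B * of_nat \<beta> ^ m)) \<noteq>
               (\<Sum>k\<le>U * h. pf k * (of_int a / of_nat \<beta>) ^ k)"
    and c: "1 \<le> c" and h: "1 \<le> h" and B: "1 \<le> B" and a: "a \<noteq> 0"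
    and \<beta>: "1 \<le> \<beta>" "real C1 * (2 * \<bar>real_of_int a\<bar>) \<le> real \<beta>"
    and m: "g * h + m \<le> U * h"
    and \<beta>3: "real (C1 ^ U * C1 ^ 2 * (2 ^ g * c)) * (real C1 * \<bar>real_of_int a\<bar>) ^ (U + 2) \<le> real \<beta>"
    and \<beta>h: "2 * real B \<le> real \<beta> ^ h"
  shows "summable (\<lambda>n. real_of_rat (F n) * x ^ n)"
    and "1 / real \<beta> ^ ((U + 2) * h) \<le> \<bar>\<xi> - real_of_int z / (real B * real \<beta> ^ m)\<bar>"
proof -
  define aa where "aa = \<bar>real_of_int a\<bar>"
  have aa: "1 \<le> aa" using a by (simp add: aa_def)
  have \<beta>0: "0 < real \<beta>" using \<beta> by simp
  have absx: "\<bar>x\<bar> = aa / real \<beta>" by (simp add: x_def aa_def)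
  have rC: "1 \<le> real C1" using C1 by simp
  have C1x: "real C1 * \<bar>x\<bar> \<le> 1 / 2" using \<beta>(2) \<beta>0 by (simp add: absx aa_def field_simps)
  have x1: "\<bar>x\<bar> \<le> 1"
  proof -
    have "1 * \<bar>x\<bar> \<le> real C1 * \<bar>x\<bar>" using rC by (intro mult_right_mono) auto
    then show ?thesis using C1x by simp
  qed
  define y where "y = real C1 * \<bar>x\<bar>"
  have y: "0 \<le> y" "y \<le> 1 / 2" using C1x by (auto simp: y_def)
  have F_term: "norm (real_of_rat (F n) * x ^ n) \<le> real C1 * y ^ n" for n
  proof -
    have "norm (real_of_rat (F n) * x ^ n) = \<bar>real_of_rat (F n)\<bar> * \<bar>x\<bar> ^ n"
      by (simp add: abs_mult power_abs)
    also have "\<dots> \<le> real (C1 ^ (n + 1)) * \<bar>x\<bar> ^ n" by (intro mult_right_mono F) auto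
    also have "\<dots> = real C1 * y ^ n" by (simp add: y_def power_mult_distrib)
    finally show ?thesis .
  qed
  have geo: "summable (\<lambda>n. y ^ n)" using y by (intro summable_geometric) auto
  have abs_summable: "summable (\<lambda>n. norm (real_of_rat (F n) * x ^ n))"
    by (rule summable_comparison_test'[of "\<lambda>n. real C1 * y ^ n" 0])
       (use F_term geo in \<open>auto intro: summable_mult\<close>)
  then show "summable (\<lambda>n. real_of_rat (F n) * x ^ n)" by (rule summable_norm_cancel)
  define px where "px = (\<Sum>i\<le>degree p. real_of_int (coeff p i) * x ^ i)"
  define r where "r k = real_of_rat (pf k)" for k
  have pf_eq: "pf k = (\<Sum>i\<le>k. of_int (coeff p i) * F (k - i))" for k
    by (simp add: pf_def fps_mult_nth coeff_map_poly atLeast0AtMost)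
  have r_eq: "r k = (\<Sum>i\<le>k. real_of_int (coeff p i) * real_of_rat (F (k - i)))" for k
    by (simp add: r_def pf_eq of_rat_sum of_rat_mult)
  have sums: "(\<lambda>k. r k * x ^ k) sums (px * \<xi>)"
  proof -
    have fin: "real_of_int (coeff p i) * x ^ i = 0" if "i \<notin> {..degree p}" for i
      using that by (simp add: coeff_eq_0)
    have "summable (\<lambda>i. norm (real_of_int (coeff p i) * x ^ i))"
      using fin by (intro summable_finite[of "{..degree p}"]) auto
    from Cauchy_product_sums[OF this abs_summable]
    have "(\<lambda>k. \<Sum>i\<le>k. real_of_int (coeff p i) * x ^ i * (real_of_rat (F (k - i)) * x ^ (k - i))) sums
        ((\<Sum>i. real_of_int (coeff p i) * x ^ i) * \<xi>)" unfolding \<xi>_def x_def .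
    moreover have "(\<Sum>i. real_of_int (coeff p i) * x ^ i) = px"
      unfolding px_def using fin by (intro suminf_finite) auto
    moreover have "(\<Sum>i\<le>k. real_of_int (coeff p i) * x ^ i * (real_of_rat (F (k - i)) * x ^ (k - i))) = r k * x ^ k" for k
      unfolding r_eq sum_distrib_right
    proof (intro sum.cong refl)
      fix i assume "i \<in> {..k}"
      then have "x ^ k = x ^ i * x ^ (k - i)" by (simp flip: power_add)
      then show "real_of_int (coeff p i) * x ^ i * (real_of_rat (F (k - i)) * x ^ (k - i)) =
          real_of_int (coeff p i) * real_of_rat (F (k - i)) * x ^ k" by simp
    qed
    ultimately show ?thesis by simp
  qed
  \<comment> \<open>\<open>G\<close> bounds the sum of the absolute coefficients of
    \<open>p\<close>; the factor \<open>2 ^ g\<close> absorbs their number.\<close>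
  define G where "G = real (2 ^ g * c) ^ h"
  have G: "real (g * h + 1) * real (c ^ h) \<le> G"
  proof -
    have "real (g * h + 1) \<le> real (2 ^ (g * h))" by (rule of_nat_mono[OF Suc_le_two_power])
    then have "real (g * h + 1) * real (c ^ h) \<le> real (2 ^ (g * h)) * real (c ^ h)"
      by (intro mult_right_mono) auto
    also have "\<dots> = G" by (simp only: G_def of_nat_power of_nat_mult power_mult_distrib power_mult)
    finally show ?thesis .
  qed
  have coeffs': "\<bar>real_of_int (coeff p i)\<bar> \<le> real (c ^ h)" for i
  proof -
    have "real_of_int \<bar>coeff p i\<bar> \<le> real_of_int (int (c ^ h))" using coeffs[of i] by (simp only: of_int_le_iff)
    then show ?thesis by simp
  qed
  have px_le: "\<bar>px\<bar> \<le> G"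
  proof -
    have "\<bar>px\<bar> \<le> (\<Sum>i\<le>degree p. \<bar>real_of_int (coeff p i) * x ^ i\<bar>)" unfolding px_def by (rule sum_abs)
    also have "\<dots> \<le> (\<Sum>i\<le>degree p. real (c ^ h) * 1)"
      unfolding abs_mult power_abs using x1 by (intro sum_mono mult_mono coeffs' power_le_one) auto
    also have "\<dots> = real (degree p + 1) * real (c ^ h)" by simp
    also have "\<dots> \<le> real (g * h + 1) * real (c ^ h)" using deg by (intro mult_right_mono of_nat_mono) auto
    finally show ?thesis using G by linarith
  qed
  have r_le: "\<bar>r k\<bar> \<le> G * real C1 ^ (k + 1)" for k
  proof -
    have "\<bar>r k\<bar> \<le> (\<Sum>i\<le>k. \<bar>real_of_int (coeff p i) * real_of_rat (F (k - i))\<bar>)"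
      unfolding r_eq by (rule sum_abs)
    also have "\<dots> \<le> (\<Sum>i\<le>k. if i \<le> g * h then real (c ^ h) * real C1 ^ (k + 1) else 0)"
    proof (rule sum_mono)
      fix i assume "i \<in> {..k}"
      show "\<bar>real_of_int (coeff p i) * real_of_rat (F (k - i))\<bar> \<le>
          (if i \<le> g * h then real (c ^ h) * real C1 ^ (k + 1) else 0)"
      proof (cases "i \<le> g * h")
        case True
        have "\<bar>real_of_rat (F (k - i))\<bar> \<le> real C1 ^ (k - i + 1)" using F[of "k - i"] by simp
        also have "\<dots> \<le> real C1 ^ (k + 1)" using rC by (intro power_increasing) auto
        finally show ?thesis using True coeffs'[of i] by (simp add: abs_mult mult_mono)
      next
        case False
        then have "coeff p i = 0" using deg by (intro coeff_eq_0) simp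
        then show ?thesis using False by simp
      qed
    qed
    also have "\<dots> = (\<Sum>i\<in>{..k} \<inter> {..g * h}. real (c ^ h) * real C1 ^ (k + 1))"
      by (subst sum.inter_restrict) auto
    also have "\<dots> \<le> (\<Sum>i\<in>{..g * h}. real (c ^ h) * real C1 ^ (k + 1))" by (intro sum_mono2) auto
    also have "\<dots> = (real (g * h + 1) * real (c ^ h)) * real C1 ^ (k + 1)" by simp
    also have "\<dots> \<le> G * real C1 ^ (k + 1)" by (intro mult_right_mono G) simp
    finally show ?thesis .
  qed
  define P where "P = (\<Sum>k\<le>U * h. r k * x ^ k)"
  \<comment> \<open>The tail starts just after the gap, which gains \<open>2 * h\<close> powers of
    \<open>x\<close> over the truncation at \<open>U * h\<close>.\<close>
  define N where "N = (U + 2) * h + 1"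
  have tail: "\<bar>px * \<xi> - P\<bar> \<le> G * real C1 * y ^ ((U + 2) * h)"
  proof -
    have "(\<Sum>k<N. r k * x ^ k) = P"
      unfolding P_def
    proof (rule sum.mono_neutral_right)
      show "{..U * h} \<subseteq> {..<N}" by (auto simp: N_def algebra_simps)
      show "\<forall>k\<in>{..<N} - {..U * h}. r k * x ^ k = 0" using gap by (auto simp: N_def r_def)
    qed simp
    then have "(\<lambda>k. r (k + N) * x ^ (k + N)) sums (px * \<xi> - P)"
      using sums_split_initial_segment[OF sums, of N] by simp
    moreover have "(\<lambda>k. G * real C1 * y ^ N * y ^ k) sums (G * real C1 * y ^ N * (1 / (1 - y)))"
      using y by (intro sums_mult geometric_sums) auto
    moreover have "\<bar>r (k + N) * x ^ (k + N)\<bar> \<le> G * real C1 * y ^ N * y ^ k" for k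
    proof -
      have "\<bar>r (k + N) * x ^ (k + N)\<bar> \<le> (G * real C1 ^ (k + N + 1)) * \<bar>x\<bar> ^ (k + N)"
        unfolding abs_mult power_abs by (intro mult_right_mono r_le) simp
      also have "\<dots> = G * real C1 * y ^ N * y ^ k"
        by (simp add: y_def power_mult_distrib power_add mult_ac)
      finally show ?thesis .
    qed
    ultimately have "\<bar>px * \<xi> - P\<bar> \<le> G * real C1 * y ^ N * (1 / (1 - y))"
      using norm_suminf_le[of "\<lambda>k. r (k + N) * x ^ (k + N)" "\<lambda>k. G * real C1 * y ^ N * y ^ k"]
      by (simp add: sums_iff)
    also have "\<dots> \<le> G * real C1 * y ^ N * 2"
      using y by (intro mult_left_mono) (auto simp: G_def field_simps)
    also have "\<dots> = G * real C1 * y ^ ((U + 2) * h) * (2 * y)" by (simp add: N_def)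
    also have "\<dots> \<le> G * real C1 * y ^ ((U + 2) * h) * 1"
      using y by (intro mult_left_mono) (auto simp: G_def)
    finally show ?thesis by simp
  qed
  define \<theta> where "\<theta> = real_of_int z / (real B * real \<beta> ^ m)"
  \<comment> \<open>\<open>d\<close> clears the Taylor coefficients, \<open>B\<close> the extra
    denominator and \<open>\<beta>^(U h)\<close> the powers of \<open>\<beta>\<close>; for
    \<open>p(x) \<theta>\<close> this uses \<open>g h + m \<le> U h\<close>.\<close>
  define X where "X = real_of_int d * real B * real \<beta> ^ (U * h)"
  have X0: "0 < X" using d(1) B \<beta>0 by (simp add: X_def)
  have "px * \<theta> - P \<noteq> 0"
  proof
    assume "px * \<theta> - P = 0"
    let ?x = "of_int a / of_nat \<beta> :: rat"
    have xr: "real_of_rat ?x = x" by (simp add: x_def of_rat_divide)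
    have hpx: "px = real_of_rat (poly (map_poly of_int p) ?x)"
      unfolding poly_altdef px_def
      by (simp add: of_rat_sum of_rat_mult of_rat_power xr coeff_map_poly degree_map_poly)
    have hP: "P = real_of_rat (\<Sum>k\<le>U * h. pf k * ?x ^ k)"
      unfolding P_def r_def by (simp add: of_rat_sum of_rat_mult of_rat_power xr)
    have ht: "\<theta> = real_of_rat (of_int z / (of_nat B * of_nat \<beta> ^ m))"
      by (simp add: \<theta>_def of_rat_divide of_rat_mult of_rat_power)
    have "real_of_rat (poly (map_poly of_int p) ?x * (of_int z / (of_nat B * of_nat \<beta> ^ m))) =
        real_of_rat (\<Sum>k\<le>U * h. pf k * ?x ^ k)"
      unfolding of_rat_mult hpx[symmetric] hP[symmetric] ht[symmetric]
      using \<open>px * \<theta> - P = 0\<close> by simp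
    then show False using nv by (simp only: of_rat_eq_iff)
  qed
  moreover have "X * (px * \<theta> - P) \<in> \<int>"
  proof -
    have bx: "real \<beta> ^ (k + j) * x ^ k = real_of_int (a ^ k) * real \<beta> ^ j" for k j
      using \<beta>0 by (simp add: x_def power_divide power_add)
    have "X * (px * \<theta>) = real_of_int d * real_of_int z *
        (\<Sum>i\<le>degree p. real_of_int (coeff p i) * (real \<beta> ^ (U * h - m) * x ^ i))"
    proof -
      have "real \<beta> ^ (U * h) = real \<beta> ^ (U * h - m) * real \<beta> ^ m" using m by (simp flip: power_add)
      then have "X * \<theta> = real_of_int d * real_of_int z * real \<beta> ^ (U * h - m)"
        using B \<beta>0 by (simp add: X_def \<theta>_def)
      moreover have "X * (px * \<theta>) = (X * \<theta>) * px" by (simp only: mult_ac)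
      ultimately have "X * (px * \<theta>) = (real_of_int d * real_of_int z * real \<beta> ^ (U * h - m)) * px"
        by (simp only:)
      then show ?thesis by (simp add: px_def sum_distrib_left mult_ac)
    qed
    also have "\<dots> \<in> \<int>"
    proof -
      have "real \<beta> ^ (U * h - m) * x ^ i \<in> \<int>" if "i \<in> {..degree p}" for i
      proof -
        have "i + (U * h - m - i) = U * h - m" using that deg m by simp
        then have "real \<beta> ^ (U * h - m) * x ^ i = real_of_int (a ^ i) * real \<beta> ^ (U * h - m - i)"
          using bx[of i "U * h - m - i"] by (simp only:)
        also have "\<dots> \<in> \<int>" by (intro Ints_mult Ints_power) auto
        finally show ?thesis .
      qed
      then have "(\<Sum>i\<le>degree p. real_of_int (coeff p i) * (real \<beta> ^ (U * h - m) * x ^ i)) \<in> \<int>"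
        by (intro Ints_sum Ints_mult[OF Ints_of_int]) auto
      then show ?thesis by (intro Ints_mult[OF Ints_mult[OF Ints_of_int Ints_of_int]])
    qed
    finally have 1: "X * (px * \<theta>) \<in> \<int>" .
    have "X * P = real B * (\<Sum>k\<le>U * h. (real_of_int d * r k) * (real \<beta> ^ (U * h) * x ^ k))"
      by (simp add: X_def P_def sum_distrib_left mult_ac)
    also have "\<dots> \<in> \<int>"
    proof -
      have dr: "real_of_int d * r k \<in> \<int>" if k: "k \<in> {..U * h}" for k
      proof -
        have "real_of_int d * r k = (\<Sum>i\<le>k. real_of_int (coeff p i) * real_of_rat (of_int d * F (k - i)))"
          unfolding r_eq sum_distrib_left by (intro sum.cong) (simp_all add: of_rat_mult)
        also have "\<dots> \<in> \<int>"
        proof (intro Ints_sum Ints_mult[OF Ints_of_int])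
          fix i assume "i \<in> {..k}"
          then have "of_int d * F (k - i) \<in> \<int>" using k by (intro d(3)) simp
          then obtain w where "of_int d * F (k - i) = of_int w" by (rule Ints_cases)
          then show "real_of_rat (of_int d * F (k - i)) \<in> \<int>" by simp
        qed
        finally show ?thesis .
      qed
      have "real \<beta> ^ (U * h) * x ^ k \<in> \<int>" if k: "k \<in> {..U * h}" for k
      proof -
        have "k + (U * h - k) = U * h" using k by simp
        then have "real \<beta> ^ (U * h) * x ^ k = real_of_int (a ^ k) * real \<beta> ^ (U * h - k)"
          using bx[of k "U * h - k"] by (simp only:)
        also have "\<dots> \<in> \<int>" by (intro Ints_mult Ints_power) auto
        finally show ?thesis .
      qed
      then have "(\<Sum>k\<le>U * h. (real_of_int d * r k) * (real \<beta> ^ (U * h) * x ^ k)) \<in> \<int>"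
        by (intro Ints_sum Ints_mult[OF dr])
      then show ?thesis by (intro Ints_mult[OF Ints_of_nat])
    qed
    finally have "X * P \<in> \<int>" .
    with 1 show ?thesis by (simp add: right_diff_distrib Ints_diff)
  qed
  ultimately have "1 \<le> \<bar>X * (px * \<theta> - P)\<bar>"
    using X0 by (intro Ints_nonzero_abs_ge1) auto
  then have "1 \<le> X * \<bar>px * \<theta> - P\<bar>" unfolding abs_mult using X0 by simp
  then have low: "1 / X \<le> \<bar>px * \<theta> - P\<bar>" using X0 by (simp add: pos_divide_le_eq mult.commute)
  define Y where "Y = real C1 ^ (U * h + 1) * real B * real \<beta> ^ (U * h)"
  have Y0: "0 < Y" using rC B \<beta>0 by (simp add: Y_def)
  have "real_of_int d \<le> real_of_int (int (C1 ^ (U * h + 1)))" using d(2) by (simp only: of_int_le_iff)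
  then have "X \<le> Y" unfolding X_def Y_def by (intro mult_right_mono) auto
  then have low': "1 / Y \<le> \<bar>px * \<theta> - P\<bar>"
    using low X0 frac_le[of 1 1 X Y] by linarith
  \<comment> \<open>\<open>c3^h\<close> collects the constants exponential in \<open>h\<close>. Half
    of the gain \<open>\<beta>^(2 h)\<close> covers \<open>c3^h\<close> and the other half covers
    \<open>2 B\<close>, so a large \<open>h\<close> alone compensates for \<open>B\<close>.\<close>
  define c3 where "c3 = real (C1 ^ U * C1 ^ 2 * (2 ^ g * c)) * (real C1 * aa) ^ (U + 2)"
  have c3_le: "c3 ^ h * (2 * real B) \<le> real \<beta> ^ (2 * h)"
  proof -
    have "0 \<le> c3" unfolding c3_def using aa by (intro mult_nonneg_nonneg zero_le_power) auto
    moreover have "c3 \<le> real \<beta>" using \<beta>3 by (simp only: c3_def aa_def)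
    ultimately have "c3 ^ h \<le> real \<beta> ^ h" by (rule power_mono[rotated])
    then have "c3 ^ h * (2 * real B) \<le> real \<beta> ^ h * real \<beta> ^ h"
      using \<beta>h by (intro mult_mono) simp_all
    also have "\<dots> = real \<beta> ^ (2 * h)" unfolding mult_2 by (rule power_add[symmetric])
    finally show ?thesis .
  qed
  have c3_eq: "c3 ^ h = real C1 ^ (U * h) * (real C1 ^ 2) ^ h * G * (real C1 * aa) ^ ((U + 2) * h)"
    by (simp only: c3_def G_def of_nat_power of_nat_mult power_mult_distrib power_mult)
  have C1h: "real C1 ^ 2 \<le> (real C1 ^ 2) ^ h"
    using rC h by (intro self_le_power) auto
  have "1 \<le> 2 ^ g * c" using c by simp
  then have "1 \<le> real (2 ^ g * c)" using of_nat_mono[of 1 "2 ^ g * c"] by simp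
  then have G1: "1 \<le> G" unfolding G_def by (rule one_le_power)
  have y_eq: "y ^ ((U + 2) * h) = (real C1 * aa) ^ ((U + 2) * h) / (real \<beta> ^ (U * h) * real \<beta> ^ (2 * h))"
    unfolding y_def absx times_divide_eq_right power_divide power_add[symmetric] distrib_right ..
  have E1: "\<bar>px * \<xi> - P\<bar> \<le> 1 / (2 * Y)"
  proof -
    have "2 * Y * (G * real C1 * y ^ ((U + 2) * h)) =
        (real C1 ^ (U * h) * real C1 ^ 2 * G * (real C1 * aa) ^ ((U + 2) * h)) * (2 * real B) / real \<beta> ^ (2 * h)"
    proof -
      have alg: "2 * (K * C * b * v) * (g * C * (z / (v * w))) = (K * C\<^sup>2 * g * z) * (2 * b) / w"
        if "v \<noteq> 0" for K C b v g z w :: real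
        using that by (simp add: power2_eq_square)
      show ?thesis unfolding y_eq Y_def power_add power_one_right by (rule alg) (use \<beta>0 in simp)
    qed
    also have "\<dots> \<le> c3 ^ h * (2 * real B) / real \<beta> ^ (2 * h)"
      unfolding c3_eq using C1h G1 aa rC by (intro divide_right_mono mult_right_mono mult_left_mono) auto
    also have "\<dots> \<le> 1" using c3_le \<beta>0 by (simp add: divide_le_eq_1)
    finally have "G * real C1 * y ^ ((U + 2) * h) \<le> 1 / (2 * Y)" using Y0 by (simp add: field_simps)
    then show ?thesis using tail by linarith
  qed
  have "1 / (2 * Y) \<le> \<bar>px\<bar> * \<bar>\<xi> - \<theta>\<bar>"
  proof -
    have "\<bar>px * \<theta> - P\<bar> \<le> \<bar>px * \<xi> - P\<bar> + \<bar>px * (\<xi> - \<theta>)\<bar>"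
      by (simp add: right_diff_distrib)
    moreover have "1 / Y = 1 / (2 * Y) + 1 / (2 * Y)" by simp
    ultimately show ?thesis using low' E1 unfolding abs_mult by linarith
  qed
  also have "\<dots> \<le> G * \<bar>\<xi> - \<theta>\<bar>" by (intro mult_right_mono px_le) simp
  finally have fin: "1 / (2 * Y * G) \<le> \<bar>\<xi> - \<theta>\<bar>" using G1 Y0 by (simp add: field_simps)
  have YG: "2 * Y * G \<le> real \<beta> ^ ((U + 2) * h)"
  proof -
    have "real C1 ^ (U * h) * real C1 * G \<le> c3 ^ h"
    proof -
      have "real C1 \<le> real C1 ^ 2" using rC by (intro self_le_power) auto
      then have "real C1 \<le> (real C1 ^ 2) ^ h" using C1h by linarith
      moreover have "1 * 1 \<le> real C1 * aa" using rC aa by (intro mult_mono) auto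
      then have "1 \<le> (real C1 * aa) ^ ((U + 2) * h)" by (intro one_le_power) simp
      ultimately have "real C1 ^ (U * h) * real C1 * G * 1 \<le> c3 ^ h"
        unfolding c3_eq using G1 rC by (intro mult_mono) auto
      then show ?thesis by simp
    qed
    then have "(real C1 ^ (U * h) * real C1 * G) * (2 * real B) \<le> c3 ^ h * (2 * real B)"
      by (intro mult_right_mono) auto
    then have "(real C1 ^ (U * h) * real C1 * G) * (2 * real B) \<le> real \<beta> ^ (2 * h)"
      using c3_le by linarith
    then have "(real C1 ^ (U * h) * real C1 * G) * (2 * real B) * real \<beta> ^ (U * h) \<le> real \<beta> ^ (2 * h) * real \<beta> ^ (U * h)"
      by (intro mult_right_mono) auto
    also have "\<dots> = real \<beta> ^ ((U + 2) * h)"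
      unfolding distrib_right power_add by (rule mult.commute)
    finally show ?thesis by (simp add: Y_def mult_ac)
  qed
  have "0 < 2 * Y * G" using Y0 G1 by (intro mult_pos_pos) auto
  have "1 / real \<beta> ^ ((U + 2) * h) \<le> 1 / (2 * Y * G)"
    by (rule frac_le[OF zero_le_one order.refl \<open>0 < 2 * Y * G\<close> YG])
  with fin show "1 / real \<beta> ^ ((U + 2) * h) \<le> \<bar>\<xi> - real_of_int z / (real B * real \<beta> ^ m)\<bar>"
    unfolding \<theta>_def by linarith
qed

text \<open>With \<open>\<sigma> = U - g\<close> and \<open>h\<close> about
  \<open>m / \<sigma>\<close>, the exponent \<open>(U + 2) h\<close> is about
  \<open>(1 + (g + 2) / \<sigma>) m\<close>. Since \<open>g\<close> does not depend on
  \<open>\<kappa>\<close>, a large \<open>\<kappa>\<close> makes the excess small. \<open>M\<close>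
  is fixed before \<open>B\<close>; only \<open>m0\<close> varies with \<open>B\<close>.\<close>

lemma rational_approximation_lower_bound:
  fixes F :: "nat \<Rightarrow> rat" and \<epsilon> :: real and a :: int
  assumes G: "rat_G_function F" and irr: "\<not> rat_fps_is_rational_function F"
    and \<epsilon>: "0 < \<epsilon>" and a: "a \<noteq> 0"
  shows "\<exists>M::real. \<forall>\<beta>::nat. M \<le> real \<beta> \<longrightarrow>
     summable (\<lambda>n. real_of_rat (F n) * (real_of_int a / real \<beta>) ^ n) \<and>
     (\<forall>B::nat. 1 \<le> B \<longrightarrow> (\<exists>m0. \<forall>m\<ge>m0. \<forall>z::int.
        real \<beta> powr (- ((1 + \<epsilon>) * real m)) \<le>
          \<bar>(\<Sum>n. real_of_rat (F n) * (real_of_int a / real \<beta>) ^ n) - real_of_int z / (real B * real \<beta> ^ m)\<bar>))"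
proof -
  obtain C :: real where "0 < C \<and> (\<forall>n\<ge>1. \<bar>real_of_rat (F n)\<bar> \<le> C ^ n) \<and>
        (\<exists>d :: nat \<Rightarrow> int. \<forall>n\<ge>1. d n \<noteq> 0 \<and> real_of_int \<bar>d n\<bar> \<le> C ^ n \<and>
             (\<forall>m\<le>n. of_int (d n) * F m \<in> \<int>)) \<and>
        (\<exists>(m::nat) (P :: nat \<Rightarrow> complex poly).
             (\<forall>k\<le>m. \<forall>i. algebraic (coeff (P k) i)) \<and> (\<exists>k\<le>m. P k \<noteq> 0) \<and>
             (\<Sum>k\<le>m. fps_of_poly (P k) * (fps_deriv ^^ k) (Abs_fps (\<lambda>n. of_rat (F n) :: complex))) = 0)"
    using G unfolding rat_G_function_def by (elim exE)
  then have CF: "\<And>n. 1 \<le> n \<Longrightarrow> \<bar>real_of_rat (F n)\<bar> \<le> C ^ n"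
    and d_ex: "\<exists>d :: nat \<Rightarrow> int. \<forall>n\<ge>1. d n \<noteq> 0 \<and> real_of_int \<bar>d n\<bar> \<le> C ^ n \<and>
             (\<forall>m\<le>n. of_int (d n) * F m \<in> \<int>)"
    and P_ex: "\<exists>(m::nat) (P :: nat \<Rightarrow> complex poly).
             (\<forall>k\<le>m. \<forall>i. algebraic (coeff (P k) i)) \<and> (\<exists>k\<le>m. P k \<noteq> 0) \<and>
             (\<Sum>k\<le>m. fps_of_poly (P k) * (fps_deriv ^^ k) (Abs_fps (\<lambda>n. of_rat (F n) :: complex))) = 0"
    by simp_all
  obtain d :: "nat \<Rightarrow> int" where "\<forall>n\<ge>1. d n \<noteq> 0 \<and> real_of_int \<bar>d n\<bar> \<le> C ^ n \<and>
             (\<forall>m\<le>n. of_int (d n) * F m \<in> \<int>)" using d_ex by (elim exE)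
  then have Cd: "\<And>n. 1 \<le> n \<Longrightarrow> d n \<noteq> 0 \<and> real_of_int \<bar>d n\<bar> \<le> C ^ n \<and> (\<forall>m\<le>n. of_int (d n) * F m \<in> \<int>)"
    by blast
  obtain mm P where P: "(\<forall>k\<le>mm. \<forall>i. algebraic (coeff (P k) i)) \<and> (\<exists>k\<le>mm. P k \<noteq> 0) \<and>
      (\<Sum>k\<le>mm. fps_of_poly (P k) * (fps_deriv ^^ k) (Abs_fps (\<lambda>n. of_rat (F n) :: complex))) = 0"
    using P_ex by (elim exE)
  obtain p :: "nat \<Rightarrow> rat poly" where p: "(\<exists>k\<le>mm. p k \<noteq> 0) \<and>
      (\<Sum>k\<le>mm. fps_of_poly (p k) * (fps_deriv ^^ k) (Abs_fps F)) = 0"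
    using rational_differential_equation[OF conjunct2[OF conjunct2[OF P]] conjunct1[OF conjunct2[OF P]]]
    by (elim exE)
  have irr': "fps_of_poly s * Abs_fps F \<noteq> fps_of_poly r" if "s \<noteq> 0" for r s
    using irr that unfolding rat_fps_is_rational_function_def by blast
  have "\<exists>n t Tz A. 2 \<le> n \<and> differential_system n t (map_poly of_int (Tz :: int poly)) A (deriv_tuple (Abs_fps F))"
    by (rule ex_differential_system[OF conjunct2[OF p] conjunct1[OF p]]) (rule irr')
  then obtain n t and Tz :: "int poly" and A where
    n: "2 \<le> n" and sys: "differential_system n t (map_poly of_int Tz) A (deriv_tuple (Abs_fps F))"
    by (elim exE conjE)
  have "1 \<le> n - 1" using n by simp
  from G_function_derivative_bounds[OF CF Cd this] obtain C1 :: nat and D :: "nat \<Rightarrow> int" where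
    C1: "1 \<le> C1" and D: "\<And>m. 0 < D m" "\<And>m. D m \<le> int (C1 ^ (m + 1))"
    and bound: "\<And>j m. j < n - 1 \<Longrightarrow> \<bar>real_of_rat (fps_nth ((fps_deriv ^^ j) (Abs_fps F)) m)\<bar> \<le> real (C1 ^ (m + 1))"
    and den: "\<And>j m l. j < n - 1 \<Longrightarrow> l \<le> m \<Longrightarrow> of_int (D m) * fps_nth ((fps_deriv ^^ j) (Abs_fps F)) l \<in> \<int>"
    by blast
  have F_bound: "\<bar>real_of_rat (F k)\<bar> \<le> real (C1 ^ (k + 1))" for k
    using bound[of 0 k] n by simp
  have F_den: "of_int (D m) * F l \<in> \<int>" if "l \<le> m" for l m
    using den[of 0 l m] n that by simp
  define g where "g = (n - 1) * (2 * t + 4) + 1 + 2 * t"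
  \<comment> \<open>This makes \<open>(g + 2) / \<sigma>\<close> at most
    \<open>\<epsilon> / 2\<close>; the other half of \<open>\<epsilon>\<close> pays for rounding
    \<open>m / \<sigma>\<close> up.\<close>
  define \<kappa> where "\<kappa> = g + nat \<lceil>2 * (real g + 2) / \<epsilon>\<rceil> + 1"
  define U where "U = \<kappa> + 2 * t"
  define \<sigma> where "\<sigma> = U - g"
  have \<sigma>: "U = g + \<sigma>" "1 \<le> \<sigma>" by (auto simp: \<sigma>_def U_def \<kappa>_def)
  have \<sigma>_ge: "real g + 2 \<le> real \<sigma> * (\<epsilon> / 2)"
  proof -
    have "2 * (real g + 2) / \<epsilon> \<le> real (nat \<lceil>2 * (real g + 2) / \<epsilon>\<rceil>)" by (rule real_nat_ceiling_ge)
    also have "\<dots> \<le> real \<sigma>" by (simp add: \<sigma>_def U_def \<kappa>_def)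
    finally show ?thesis using \<epsilon> by (simp add: field_simps)
  qed
  have "g \<le> \<kappa>" by (simp add: \<kappa>_def)
  have "\<exists>(c::nat) h0 r. 1 \<le> c \<and> 0 < r \<and> (\<forall>h\<ge>h0. \<forall>(x::rat) \<theta>. 0 < \<bar>x\<bar> \<longrightarrow> \<bar>x\<bar> < r \<longrightarrow>
     (\<exists>p :: int poly. degree p \<le> g * h \<and> (\<forall>i. \<bar>coeff p i\<bar> \<le> int (c ^ h)) \<and>
        (\<forall>m. U * h < m \<longrightarrow> m \<le> (U + 2) * h \<longrightarrow>
           fps_nth (fps_of_poly (map_poly of_int p) * Abs_fps F) m = 0) \<and>
        poly (map_poly of_int p) x * \<theta> \<noteq>
          (\<Sum>m\<le>U * h. fps_nth (fps_of_poly (map_poly of_int p) * Abs_fps F) m * x ^ m)))"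
    unfolding U_def by (rule nonvanishing_approximants[OF sys n C1 D _ _ g_def \<open>g \<le> \<kappa>\<close>]) (fact bound, fact den)
  then obtain c h0 r where c: "1 \<le> c" and r: "0 < r"
    and approx: "\<forall>h\<ge>h0. \<forall>(x::rat) \<theta>. 0 < \<bar>x\<bar> \<longrightarrow> \<bar>x\<bar> < r \<longrightarrow>
     (\<exists>p :: int poly. degree p \<le> g * h \<and> (\<forall>i. \<bar>coeff p i\<bar> \<le> int (c ^ h)) \<and>
        (\<forall>m. U * h < m \<longrightarrow> m \<le> (U + 2) * h \<longrightarrow>
           fps_nth (fps_of_poly (map_poly of_int p) * Abs_fps F) m = 0) \<and>
        poly (map_poly of_int p) x * \<theta> \<noteq>
          (\<Sum>m\<le>U * h. fps_nth (fps_of_poly (map_poly of_int p) * Abs_fps F) m * x ^ m))"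
    by (elim exE conjE)
  define aa where "aa = \<bar>real_of_int a\<bar>"
  \<comment> \<open>\<open>\<beta>\<close> must ensure convergence, absorb the constants of the
    approximants and bring \<open>a / \<beta>\<close> within \<open>r\<close> of 0.\<close>
  define M where "M = max (max 2 (real C1 * (2 * aa)))
      (max (real (C1 ^ U * C1 ^ 2 * (2 ^ g * c)) * (real C1 * aa) ^ (U + 2)) (aa / real_of_rat r + 1))"
  show ?thesis
  proof (intro exI[of _ M] allI impI)
    fix \<beta> :: nat assume \<beta>: "M \<le> real \<beta>"
    let ?\<xi> = "\<Sum>n. real_of_rat (F n) * (real_of_int a / real \<beta>) ^ n"
    have \<beta>2: "2 \<le> real \<beta>" and \<beta>a: "real C1 * (2 * \<bar>real_of_int a\<bar>) \<le> real \<beta>"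
      and \<beta>3: "real (C1 ^ U * C1 ^ 2 * (2 ^ g * c)) * (real C1 * \<bar>real_of_int a\<bar>) ^ (U + 2) \<le> real \<beta>"
      and \<beta>r: "aa / real_of_rat r + 1 \<le> real \<beta>"
      using \<beta> unfolding M_def aa_def by linarith+
    have \<beta>1: "1 \<le> \<beta>" using \<beta>2 by simp
    define x where "x = (of_int a / of_nat \<beta> :: rat)"
    have x: "0 < \<bar>x\<bar>" using a \<beta>1 by (simp add: x_def)
    have xr: "\<bar>x\<bar> < r"
    proof -
      have "0 < real_of_rat r" using r by simp
      have "aa / real_of_rat r < real \<beta>" using \<beta>r by linarith
      then have "aa / real \<beta> < real_of_rat r"
        using \<open>0 < real_of_rat r\<close> \<beta>2 by (simp add: field_simps)
      moreover have "real_of_rat \<bar>x\<bar> = aa / real \<beta>" by (simp add: x_def aa_def of_rat_divide flip: of_int_abs)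
      ultimately have "real_of_rat \<bar>x\<bar> < real_of_rat r" by simp
      then show ?thesis by (simp only: of_rat_less)
    qed
    have core: "summable (\<lambda>n. real_of_rat (F n) * (real_of_int a / real \<beta>) ^ n)"
      "1 / real \<beta> ^ ((U + 2) * h) \<le> \<bar>?\<xi> - real_of_int z / (real B * real \<beta> ^ m)\<bar>"
      if h: "h0 \<le> h" "1 \<le> h" and B: "1 \<le> B" and m: "g * h + m \<le> U * h" and Bh: "2 * real B \<le> real \<beta> ^ h"
      for h B m and z :: int
    proof -
      obtain p :: "int poly" where p: "degree p \<le> g * h" "\<And>i. \<bar>coeff p i\<bar> \<le> int (c ^ h)"
        "\<And>m. U * h < m \<Longrightarrow> m \<le> (U + 2) * h \<Longrightarrow>
           fps_nth (fps_of_poly (map_poly of_int p) * Abs_fps F) m = 0"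
        "poly (map_poly of_int p) x * (of_int z / (of_nat B * of_nat \<beta> ^ m)) \<noteq>
          (\<Sum>m\<le>U * h. fps_nth (fps_of_poly (map_poly of_int p) * Abs_fps F) m * x ^ m)"
        using approx[THEN spec, THEN mp, OF h(1), THEN spec, THEN spec, THEN mp, OF x, THEN mp, OF xr]
        by blast
      note core = lower_bound_from_approximant[where g = g and U = U and h = h and c = c and d = "D (U * h)",
          OF C1 F_bound D(1) D(2) F_den p(1,2,3) p(4)[unfolded x_def] c h(2) B a \<beta>1 \<beta>a m \<beta>3 Bh]
      show "summable (\<lambda>n. real_of_rat (F n) * (real_of_int a / real \<beta>) ^ n)" by (rule core(1))
      show "1 / real \<beta> ^ ((U + 2) * h) \<le> \<bar>?\<xi> - real_of_int z / (real B * real \<beta> ^ m)\<bar>" by (rule core(2))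
    qed
    have pow_ge: "2 * real B \<le> real \<beta> ^ h" if "2 * B \<le> h" for B h :: nat
    proof -
      have "2 * real B \<le> real h" using that by simp
      also have "\<dots> \<le> 2 ^ h" using of_nat_mono[OF less_imp_le[OF less_exp[of h]], where 'a = real] by simp
      also have "\<dots> \<le> real \<beta> ^ h" using \<beta>2 by (intro power_mono) auto
      finally show ?thesis .
    qed
    \<comment> \<open>Convergence does not involve \<open>h\<close>, \<open>B\<close> or
      \<open>m\<close>, so one admissible choice of them suffices.\<close>
    have summ: "summable (\<lambda>n. real_of_rat (F n) * (real_of_int a / real \<beta>) ^ n)"
      by (rule core(1)[of "h0 + 2" 1 0]) (use \<sigma> pow_ge[of 1 "h0 + 2"] in \<open>auto simp: algebra_simps\<close>)
    have "\<exists>m0. \<forall>m\<ge>m0. \<forall>z::int. real \<beta> powr (- ((1 + \<epsilon>) * real m)) \<le>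
          \<bar>?\<xi> - real_of_int z / (real B * real \<beta> ^ m)\<bar>" if B: "1 \<le> B" for B :: nat
    proof -
      \<comment> \<open>The first term forces \<open>h0 \<le> h\<close> and
        \<open>2 B \<le> h\<close>; the second makes the rounding error \<open>U + 2\<close> at most
        \<open>m \<epsilon> / 2\<close>.\<close>
      define m0 where "m0 = \<sigma> * (h0 + 2 * B) + nat \<lceil>2 * (real U + 2) / \<epsilon>\<rceil>"
      have "real \<beta> powr (- ((1 + \<epsilon>) * real m)) \<le> \<bar>?\<xi> - real_of_int z / (real B * real \<beta> ^ m)\<bar>"
        if m: "m0 \<le> m" for m and z :: int
      proof -
        define h where "h = m div \<sigma> + 1"
        have "\<sigma> * (h0 + 2 * B) \<le> m" using m by (simp add: m0_def)
        then have "h0 + 2 * B \<le> m div \<sigma>" using \<sigma>(2) by (simp add: less_eq_div_iff_mult_less_eq mult.commute)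
        then have h: "h0 \<le> h" "1 \<le> h" "2 * B \<le> h" by (auto simp: h_def)
        have "m \<le> \<sigma> * h"
        proof -
          have "m = \<sigma> * (m div \<sigma>) + m mod \<sigma>" by simp
          also have "m mod \<sigma> \<le> \<sigma>" using \<sigma>(2) by (intro less_imp_le mod_less_divisor) simp
          finally show ?thesis by (simp add: h_def)
        qed
        then have "g * h + m \<le> U * h" using \<sigma>(1) by (simp add: algebra_simps)
        from core(2)[OF h(1,2) B this pow_ge[OF h(3)]]
        have "1 / real \<beta> ^ ((U + 2) * h) \<le> \<bar>?\<xi> - real_of_int z / (real B * real \<beta> ^ m)\<bar>" .
        moreover have "real \<beta> powr (- ((1 + \<epsilon>) * real m)) \<le> 1 / real \<beta> ^ ((U + 2) * h)"
        proof -
          have "2 * (real U + 2) / \<epsilon> \<le> real m"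
          proof -
            have "2 * (real U + 2) / \<epsilon> \<le> real (nat \<lceil>2 * (real U + 2) / \<epsilon>\<rceil>)" by (rule real_nat_ceiling_ge)
            also have "\<dots> \<le> real m" by (intro of_nat_mono) (use m[unfolded m0_def] in linarith)
            finally show ?thesis .
          qed
          then have 1: "real U + 2 \<le> real m * (\<epsilon> / 2)" using \<epsilon> by (simp add: field_simps)
          have "(real U + 2) * real (m div \<sigma>) = real \<sigma> * real (m div \<sigma>) + (real g + 2) * real (m div \<sigma>)"
            by (simp add: \<sigma>(1) algebra_simps)
          also have "\<dots> \<le> real \<sigma> * real (m div \<sigma>) + (real \<sigma> * (\<epsilon> / 2)) * real (m div \<sigma>)"
            by (intro add_left_mono mult_right_mono \<sigma>_ge) simp
          also have "\<dots> = (1 + \<epsilon> / 2) * real (\<sigma> * (m div \<sigma>))" by (simp add: algebra_simps)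
          also have "\<dots> \<le> (1 + \<epsilon> / 2) * real m" using \<epsilon> by (intro mult_left_mono of_nat_mono) auto
          finally have "(real U + 2) * real (m div \<sigma>) \<le> (1 + \<epsilon> / 2) * real m" .
          then have "real ((U + 2) * h) \<le> (1 + \<epsilon>) * real m"
            using 1 by (simp add: h_def algebra_simps)
          then have "real \<beta> powr (- ((1 + \<epsilon>) * real m)) \<le> real \<beta> powr (- real ((U + 2) * h))"
            using \<beta>2 by (intro powr_mono) auto
          also have "\<dots> = 1 / real \<beta> ^ ((U + 2) * h)"
            using \<beta>2 by (simp only: powr_minus_divide powr_realpow)
          finally show ?thesis .
        qed
        ultimately show ?thesis by linarith
      qed
      then show ?thesis by blast
    qed
    with summ show "summable (\<lambda>n. real_of_rat (F n) * (real_of_int a / real \<beta>) ^ n) \<and>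
     (\<forall>B::nat. 1 \<le> B \<longrightarrow> (\<exists>m0. \<forall>m\<ge>m0. \<forall>z::int.
        real \<beta> powr (- ((1 + \<epsilon>) * real m)) \<le> \<bar>?\<xi> - real_of_int z / (real B * real \<beta> ^ m)\<bar>))"
      by blast
  qed
qed

section \<open>Repetitions of digits\<close>

lemma digit_eq_floor_diff:
  assumes "2 \<le> b" and "0 \<le> x" "x < 1"
  shows "int (nat \<lfloor>real b ^ Suc k * x\<rfloor> mod b) = \<lfloor>real b ^ Suc k * x\<rfloor> - int b * \<lfloor>real b ^ k * x\<rfloor>"
proof -
  define y where "y = real b ^ k * x"
  have y: "0 \<le> y" using assms by (simp add: y_def)
  have "\<lfloor>real b * y\<rfloor> div int b = \<lfloor>real b * y / real b\<rfloor>" using floor_divide_real_eq_div[of "int b" "real b * y"] by simp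
  then have "\<lfloor>real b * y\<rfloor> div int b = \<lfloor>y\<rfloor>" using assms by simp
  then have "\<lfloor>real b * y\<rfloor> mod int b = \<lfloor>real b * y\<rfloor> - int b * \<lfloor>y\<rfloor>"
    by (metis minus_div_mult_eq_mod mult.commute)
  moreover have "int (nat \<lfloor>real b * y\<rfloor> mod b) = \<lfloor>real b * y\<rfloor> mod int b"
    using y by (simp add: zmod_int)
  ultimately show ?thesis by (simp add: y_def mult.assoc)
qed

text \<open>While digits agree at distance \<open>t\<close>, the difference of the two prefixes read
  as integers is multiplied by \<open>b\<close> at each step. After \<open>L\<close> steps it is
  \<open>b^L z0\<close>, and the fractional parts change this by at most 1. Digits are counted from
  1, so \<open>k\<close> digits precede position \<open>Suc k\<close>.\<close>

lemma shifted_digits_agree: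
  fixes b t k L :: nat and \<xi> :: real
  assumes b: "2 \<le> b"
    and agree: "\<And>i. i < L \<Longrightarrow> digit b \<xi> (Suc k + i + t) = digit b \<xi> (Suc k + i)"
  shows "\<exists>z::int. \<bar>real b ^ k * (real b ^ t - 1) * \<xi> - real_of_int z\<bar> \<le> 1 / real b ^ L"
proof -
  define x where "x = frac \<xi>"
  have x: "0 \<le> x" "x < 1" by (auto simp: x_def frac_lt_1)
  define f where "f j = \<lfloor>real b ^ j * x\<rfloor>" for j
  have dig: "int (digit b \<xi> (Suc j)) = f (Suc j) - int b * f j" for j
    unfolding digit_def f_def x_def[symmetric] by (rule digit_eq_floor_diff[OF b x])
  have step: "f (k + i + t) - f (k + i) = int b ^ i * (f (k + t) - f k)" if "i \<le> L" for i
    using that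
  proof (induction i)
    case (Suc i)
    have "f (Suc (k + i + t)) - int b * f (k + i + t) = f (Suc (k + i)) - int b * f (k + i)"
      using agree[of i] Suc.prems dig[of "k + i + t"] dig[of "k + i"] by simp
    then have "f (k + Suc i + t) - f (k + Suc i) = int b * (f (k + i + t) - f (k + i))"
      by (simp add: algebra_simps)
    then show ?case using Suc by simp
  qed simp
  define z0 where "z0 = f (k + t) - f k"
  have bL: "0 < real b ^ L" using b by simp
  have fl: "real_of_int (f j) \<le> real b ^ j * x" "real b ^ j * x < real_of_int (f j) + 1" for j
    unfolding f_def by linarith+
  have "\<bar>(real b ^ (k + L + t) * x - real b ^ (k + L) * x) - real_of_int (f (k + L + t) - f (k + L))\<bar> \<le> 1"
    using fl[of "k + L + t"] fl[of "k + L"] by linarith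
  moreover have "real_of_int (f (k + L + t) - f (k + L)) = real b ^ L * real_of_int z0"
    using step[of L] by (simp add: z0_def)
  moreover have "real b ^ (k + L + t) * x - real b ^ (k + L) * x = real b ^ L * (real b ^ k * (real b ^ t - 1) * x)"
    by (simp add: power_add algebra_simps)
  ultimately have "\<bar>real b ^ L * (real b ^ k * (real b ^ t - 1) * x - real_of_int z0)\<bar> \<le> 1"
    by (simp add: right_diff_distrib)
  then have "real b ^ L * \<bar>real b ^ k * (real b ^ t - 1) * x - real_of_int z0\<bar> \<le> 1"
    unfolding abs_mult using bL by simp
  then have "\<bar>real b ^ k * (real b ^ t - 1) * x - real_of_int z0\<bar> \<le> 1 / real b ^ L"
    using bL by (simp add: pos_le_divide_eq mult.commute)
  moreover have "real b ^ k * (real b ^ t - 1) * x =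
      real b ^ k * (real b ^ t - 1) * \<xi> - real_of_int (int b ^ k * (int b ^ t - 1) * \<lfloor>\<xi>\<rfloor>)"
    unfolding x_def frac_def by (simp add: algebra_simps)
  ultimately have "\<bar>real b ^ k * (real b ^ t - 1) * \<xi>
      - real_of_int (int b ^ k * (int b ^ t - 1) * \<lfloor>\<xi>\<rfloor> + z0)\<bar> \<le> 1 / real b ^ L"
    by simp
  then show ?thesis by blast
qed

text \<open>For \<open>l > 0\<close>, \<open>l\<close> copies give \<open>L = (l - 1) t\<close>
  agreements at distance \<open>t\<close>, hence a fraction with denominator
  \<open>(b^t - 1) b^k\<close> within \<open>b^(-(L + k))\<close> of \<open>\<xi>\<close>. The lower
  bound then forces \<open>L + k \<le> (1 + \<epsilon>)(k + s)\<close>.\<close>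

lemma repetition_bound:
  fixes b s t k l :: nat and \<xi> \<epsilon> :: real
  assumes b: "2 \<le> b" and s: "1 \<le> s" and t: "1 \<le> t" and \<epsilon>: "0 < \<epsilon>"
    and low: "\<And>m z. m0 \<le> m \<Longrightarrow> real (b ^ s) powr (- ((1 + \<epsilon>) * real m)) \<le>
                \<bar>\<xi> - real_of_int z / (real (b ^ t - 1) * real (b ^ s) ^ m)\<bar>"
    and k: "s * m0 \<le> k"
    and rep: "\<forall>i < l * t. digit b \<xi> (Suc k + i) = digit b \<xi> (Suc k + i mod t)"
  shows "real (l * t) \<le> \<epsilon> * real k + ((1 + \<epsilon>) * real s + real t)"
proof (cases "l = 0")
  case True
  then show ?thesis using \<epsilon> by simp
next
  case False
  define L where "L = (l - 1) * t"
  have lt: "l * t = L + t" using False by (cases l) (simp_all add: L_def)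
  have "digit b \<xi> (Suc k + i + t) = digit b \<xi> (Suc k + i)" if "i < L" for i
  proof -
    have "digit b \<xi> (Suc k + (i + t)) = digit b \<xi> (Suc k + (i + t) mod t)"
      using rep that lt by (metis add_less_cancel_right)
    moreover have "digit b \<xi> (Suc k + i) = digit b \<xi> (Suc k + i mod t)"
      using rep that lt by (metis trans_less_add1)
    ultimately show ?thesis by (simp add: add.assoc)
  qed
  from shifted_digits_agree[OF b this] obtain z :: int where
    z: "\<bar>real b ^ k * (real b ^ t - 1) * \<xi> - real_of_int z\<bar> \<le> 1 / real b ^ L" by blast
  \<comment> \<open>The lower bound concerns powers of \<open>b ^ s\<close>, so \<open>k\<close> is
    rounded up to a multiple \<open>s * m\<close>, at a cost of at most \<open>s\<close>, and the
    fraction is expanded accordingly.\<close>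
  define m where "m = k div s + 1"
  have km: "k \<le> s * m" "s * m \<le> k + s"
  proof -
    have "k = s * (k div s) + k mod s" by simp
    moreover have "k mod s < s" using s by (intro mod_less_divisor) simp
    ultimately show "k \<le> s * m" "s * m \<le> k + s" unfolding m_def distrib_left by linarith+
  qed
  have "m0 \<le> k div s" using k s by (simp add: less_eq_div_iff_mult_less_eq mult.commute)
  then have m0: "m0 \<le> m" by (simp add: m_def)
  have b0: "0 < real b" "1 < real b" using b by auto
  have bt: "(2::nat) \<le> b ^ t" using b t self_le_power[of b t] by linarith
  define B where "B = real (b ^ t - 1)"
  have "real 2 \<le> real (b ^ t)" using bt by (rule of_nat_mono)
  then have B: "B = real b ^ t - 1" "1 \<le> B" using bt by (auto simp: B_def of_nat_diff)
  define \<theta> where "\<theta> = real_of_int (z * int b ^ (s * m - k)) / (B * real (b ^ s) ^ m)"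
  have theta: "\<theta> = real_of_int z / (B * real b ^ k)"
  proof -
    have "real (b ^ s) ^ m = real b ^ k * real b ^ (s * m - k)"
      using km(1) by (simp add: power_mult[symmetric] power_add[symmetric])
    then show ?thesis using b0 by (simp add: \<theta>_def)
  qed
  have "real (b ^ s) powr (- ((1 + \<epsilon>) * real m)) \<le> \<bar>\<xi> - \<theta>\<bar>"
    unfolding \<theta>_def B_def by (rule low[OF m0])
  moreover have "\<bar>\<xi> - \<theta>\<bar> \<le> 1 / (real b ^ L * real b ^ k)"
  proof -
    have "\<xi> - \<theta> = (real b ^ k * B * \<xi> - real_of_int z) / (B * real b ^ k)"
      unfolding theta using B b0 by (simp add: field_simps)
    then have "\<bar>\<xi> - \<theta>\<bar> = \<bar>real b ^ k * B * \<xi> - real_of_int z\<bar> / (B * real b ^ k)"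
      using B b0 by (simp add: abs_mult)
    also have "\<dots> \<le> (1 / real b ^ L) / (1 * real b ^ k)"
      using z B b0 by (intro frac_le mult_right_mono) auto
    finally show ?thesis by simp
  qed
  ultimately have "real (b ^ s) powr (- ((1 + \<epsilon>) * real m)) \<le> 1 / (real b ^ L * real b ^ k)" by linarith
  moreover have "1 / (real b ^ L * real b ^ k) = real b powr (- real (L + k))"
    using b0 by (simp add: powr_minus_divide powr_realpow power_add flip: of_nat_add)
  moreover have "real (b ^ s) powr (- ((1 + \<epsilon>) * real m)) = real b powr (- ((1 + \<epsilon>) * real (s * m)))"
    using b0 by (simp add: powr_realpow[symmetric] powr_powr mult_ac)
  ultimately have "- ((1 + \<epsilon>) * real (s * m)) \<le> - real (L + k)"
    using b0 by simp
  then have "real L + real k \<le> (1 + \<epsilon>) * real (s * m)" by simp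
  also have "\<dots> \<le> (1 + \<epsilon>) * real (k + s)" using km(2) \<epsilon> by (intro mult_left_mono of_nat_mono) auto
  finally show ?thesis unfolding lt by (simp add: algebra_simps)
qed

theorem theorem2:
  fixes F :: "nat \<Rightarrow> rat" and \<epsilon> :: real and a :: int
  assumes "rat_G_function F"
    and "\<not> rat_fps_is_rational_function F"
    and "\<epsilon> > 0"
    and "a \<noteq> 0"
  shows "\<exists>M::real. \<forall>(b::nat) (s::nat) (t::nat). b \<ge> 2 \<longrightarrow> s \<ge> 1 \<longrightarrow> real b ^ s \<ge> M \<longrightarrow> t \<ge> 1 \<longrightarrow>
           (let x = real_of_int a / real b ^ s;
                \<xi> = (\<Sum>n. real_of_rat (F n) * x ^ n)
            in summable (\<lambda>n. real_of_rat (F n) * x ^ n) \<and> \<xi> \<notin> \<rat> \<and>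
               limsup (\<lambda>n. ereal (real (Nrep b \<xi> t n) / real n)) \<le> ereal (\<epsilon> / real t))"
proof -
  obtain M :: real where M: "\<forall>\<beta>::nat. M \<le> real \<beta> \<longrightarrow>
     summable (\<lambda>n. real_of_rat (F n) * (real_of_int a / real \<beta>) ^ n) \<and>
     (\<forall>B::nat. 1 \<le> B \<longrightarrow> (\<exists>m0. \<forall>m\<ge>m0. \<forall>z::int.
        real \<beta> powr (- ((1 + \<epsilon>) * real m)) \<le>
          \<bar>(\<Sum>n. real_of_rat (F n) * (real_of_int a / real \<beta>) ^ n) - real_of_int z / (real B * real \<beta> ^ m)\<bar>))"
    using rational_approximation_lower_bound[OF assms] by (elim exE)
  show ?thesis
    unfolding Let_def
  proof (rule exI[of _ M], intro allI impI)
    fix b s t :: nat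
    assume b: "2 \<le> b" and s: "1 \<le> s" and bs: "M \<le> real b ^ s" and t: "1 \<le> t"
    define \<xi> where "\<xi> = (\<Sum>n. real_of_rat (F n) * (real_of_int a / real b ^ s) ^ n)"
    have summ: "summable (\<lambda>n. real_of_rat (F n) * (real_of_int a / real b ^ s) ^ n)"
      using M[THEN spec[of _ "b ^ s"]] bs by simp
    have low: "\<exists>m0. \<forall>m\<ge>m0. \<forall>z::int. real (b ^ s) powr (- ((1 + \<epsilon>) * real m)) \<le>
        \<bar>\<xi> - real_of_int z / (real B * real (b ^ s) ^ m)\<bar>" if "1 \<le> B" for B :: nat
      using M[THEN spec[of _ "b ^ s"]] bs that by (simp add: \<xi>_def)
    \<comment> \<open>A rational value with denominator \<open>v\<close> equals some
      \<open>z / (v (b^s)^m)\<close> exactly, against the positive lower bound.\<close>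
    have "\<xi> \<notin> \<rat>"
    proof
      assume "\<xi> \<in> \<rat>"
      then obtain u v :: int where uv: "\<xi> = real_of_int u / real_of_int v" "0 < v"
        by (auto elim!: Rats_cases')
      have "1 \<le> nat v" using uv by simp
      then obtain m where m: "\<And>z::int. real (b ^ s) powr (- ((1 + \<epsilon>) * real m)) \<le>
          \<bar>\<xi> - real_of_int z / (real (nat v) * real (b ^ s) ^ m)\<bar>" using low by blast
      have "\<xi> - real_of_int (u * int (b ^ s) ^ m) / (real (nat v) * real (b ^ s) ^ m) = 0"
        using uv b by simp
      then have "real (b ^ s) powr (- ((1 + \<epsilon>) * real m)) \<le> 0"
        using m[of "u * int (b ^ s) ^ m"] by simp
      then show False using b by simp
    qed
    \<comment> \<open>The period \<open>t\<close> enters through the denominator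
      \<open>b^t - 1\<close>, which affects only \<open>m0\<close>; thus \<open>M\<close> is uniform
      in \<open>t\<close>.\<close>
    have "2 \<le> b ^ t" using b t self_le_power[of b t] by linarith
    then have "1 \<le> b ^ t - 1" by simp
    from low[OF this] obtain m0 where m0: "\<And>m z. m0 \<le> m \<Longrightarrow> real (b ^ s) powr (- ((1 + \<epsilon>) * real m)) \<le>
        \<bar>\<xi> - real_of_int z / (real (b ^ t - 1) * real (b ^ s) ^ m)\<bar>" by blast
    \<comment> \<open>\<open>K\<close> collects the error terms independent of \<open>n\<close>,
      which disappear after division by \<open>n\<close>.\<close>
    define K where "K = (1 + \<epsilon>) * real s + real t"
    have Nrep_le: "real (Nrep b \<xi> t n) / real n \<le> \<epsilon> / real t + K / real n" if n: "s * m0 + 1 \<le> n" for n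
    proof -
      define k where "k = n - 1"
      have nk: "n = Suc k" "s * m0 \<le> k" using n by (auto simp: k_def)
      let ?P = "\<lambda>l. \<forall>i < l * t. digit b \<xi> (n + i) = digit b \<xi> (n + i mod t)"
      have bound: "real (l * t) \<le> \<epsilon> * real k + K" if "?P l" for l
        unfolding K_def by (rule repetition_bound[OF b s t assms(3) m0 nk(2)]) (use that nk in auto)
      \<comment> \<open>A bound on the admissible \<open>l\<close> is what makes
        \<open>GREATEST\<close> attained.\<close>
      have "l \<le> nat \<lceil>\<epsilon> * real k + K\<rceil>" if "?P l" for l
      proof -
        have "real (l * 1) \<le> real (l * t)" using t by (intro of_nat_mono mult_le_mono2)
        then have "real l \<le> real (l * t)" by simp
        also have "\<dots> \<le> \<epsilon> * real k + K" using bound that by blast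
        finally show ?thesis by linarith
      qed
      moreover have "?P 0" by simp
      ultimately have "?P (Nrep b \<xi> t n)" unfolding Nrep_def
        by (intro GreatestI_nat[of ?P 0]) auto
      then have "real (Nrep b \<xi> t n * t) \<le> \<epsilon> * real k + K" by (rule bound)
      also have "\<dots> \<le> \<epsilon> * real n + K" using nk assms(3) by simp
      finally have "real (Nrep b \<xi> t n) \<le> (\<epsilon> * real n + K) / real t"
        using t by (simp add: pos_le_divide_eq)
      also have "\<dots> \<le> \<epsilon> * real n / real t + K"
      proof -
        have "0 \<le> K" using assms(3) by (simp add: K_def)
        then have "K / real t \<le> K" using t by (simp add: divide_le_eq mult_le_cancel_left1)
        then show ?thesis by (simp add: add_divide_distrib)
      qed
      finally have "real (Nrep b \<xi> t n) / real n \<le> (\<epsilon> * real n / real t + K) / real n"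
        by (rule divide_right_mono) simp
      also have "\<dots> = \<epsilon> / real t + K / real n" using nk by (simp add: add_divide_distrib)
      finally show ?thesis .
    qed
    have "(\<lambda>n. \<epsilon> / real t + K / real n) \<longlonglongrightarrow> \<epsilon> / real t + 0"
      by (intro tendsto_intros lim_const_over_n)
    then have "(\<lambda>n. ereal (\<epsilon> / real t + K / real n)) \<longlonglongrightarrow> ereal (\<epsilon> / real t)" by simp
    then have lim: "limsup (\<lambda>n. ereal (\<epsilon> / real t + K / real n)) = ereal (\<epsilon> / real t)"
      by (intro lim_imp_Limsup) auto
    have "limsup (\<lambda>n. ereal (real (Nrep b \<xi> t n) / real n)) \<le> limsup (\<lambda>n. ereal (\<epsilon> / real t + K / real n))"
      by (rule Limsup_mono) (use Nrep_le in \<open>auto simp: eventually_sequentially\<close>)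
    with lim summ \<open>\<xi> \<notin> \<rat>\<close>
    show "summable (\<lambda>n. real_of_rat (F n) * (real_of_int a / real b ^ s) ^ n) \<and>
        (\<Sum>n. real_of_rat (F n) * (real_of_int a / real b ^ s) ^ n) \<notin> \<rat> \<and>
        limsup (\<lambda>n. ereal (real (Nrep b (\<Sum>n. real_of_rat (F n) * (real_of_int a / real b ^ s) ^ n) t n) / real n))
          \<le> ereal (\<epsilon> / real t)"
      unfolding \<xi>_def by simp
  qed
qed

end
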